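(* Let $n\ge2$. The algebra $S_q(V\otimes V)\rtimes U_q^+(\mathfrak{sl}_n)$ is generated by elements $u_1,\dots,u_{n-1},w,z$ subject to the following defining relations (for all relevant $i,j$): \begin{align*} &[u_i,[u_i,u_j]_q]_{q^{-1}}=0\ \text{ if }|i-j|=1,\qquad u_iu_j=u_ju_i\ \text{ if }|i-j|>1,\\ &u_iw=wu_i\ \text{ if }i\ne1,\qquad u_iz=zu_i\ \text{ if }i\ne2,\qquad zw=wz,\\ &[u_1,[u_1,[u_1,w]]_{q^2}]_{q^{-2}}=0,\qquad [u_2,[u_2,z]_q]_{q^{-1}}=0,\\ &[w,[w,u_1]_{q^2}]_{q^{-2}}=-h\,wz,\qquad [z,[u_2,[u_1,w]_{q^2}]_q]_q=[w,[u_1,[u_2,z]_q]_q]_{q^2},\\ &2[z,[z,u_2]_q]_{q^{-1}}=h\big(z[u_1,u_2]_qw+w[u_2,u_1]_{q^{-1}}z+wu_1[z,u_2]_q+[u_2,z]_{q^{-1}}u_1w\big), \end{align*} where $h=q-q^{-1}$, $[a,b]_v=ab-v\,ba$, $[a,b]=[a,b]_1$, with the convention that $u_2=0$ if $n=2$.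
   Context: All algebras are over $\mathbb C(q)$. $U_q(\mathfrak{sl}_n)$ has generators $E_i,F_i,K_i^{\pm1}$ ($1\le i\le n-1$) with the standard relations ($[E_i,F_j]=\delta_{ij}\frac{K_i-K_i^{-1}}{q-q^{-1}}$, $K_iE_jK_i^{-1}=q^{a_{ij}}E_j$, $K_iF_jK_i^{-1}=q^{-a_{ij}}F_j$, quantum Serre) and coproduct $\Delta(E_i)=E_i\otimes1+K_i\otimes E_i$, $\Delta(F_i)=F_i\otimes K_i^{-1}+1\otimes F_i$; $U_q^+(\mathfrak{sl}_n)$ is generated by the $E_i$. $V$ has basis $v_1,\dots,v_n$ with $E_i(v_j)=\delta_{i,j-1}v_{j-1}$, $F_i(v_j)=\delta_{i,j}v_{j+1}$, $K_i(v_j)=q^{\delta_{i,j}-\delta_{i,j-1}}v_j$. $T:V\otimes V\to V\otimes V$ is given for $i\le j$ by $T(v_i\otimes v_j)=q^{-\delta_{ij}}v_j\otimes v_i$, $T(v_j\otimes v_i)=q^{\delta_{ij}}v_i\otimes v_j-(q-q^{-1})v_j\otimes v_i$; $\Psi_i$ ($1\le i\le 3$) is $T$ acting in factors $i,i+1$ of $V^{\otimes4}$; $\Psi=\Psi_2\Psi_1\Psi_3\Psi_2+(q-q^{-1})(\Psi_1\Psi_2\Psi_1+\Psi_1\Psi_3\Psi_2)+(q-q^{-1})^2\Psi_1\Psi_2$; and $S_q(V\otimes V)=T(V\otimes V)/\langle(\Psi-1)(V^{\otimes4})\rangle$ (tensor algebra of $V\otimes V$ modulo the ideal), which is a $U_q(\mathfrak{sl}_n)$-module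 algebra with the action extending that on $V\otimes V$. Writing $S_q(V\otimes V)=\bigoplus_\nu\mathcal A_\nu$ for the weight decomposition ($K_i|_{\mathcal A_\nu}=q^{(\alpha_i,\nu)}$), the braided cross product $S_q(V\otimes V)\rtimes U_q^+(\mathfrak{sl}_n)$ is $S_q(V\otimes V)\otimes U_q^+(\mathfrak{sl}_n)$ as a vector space, generated by the two subalgebras with cross relations $E_i\cdot a=E_i(a)+q^{(\alpha_i,\nu)}a\cdot E_i$ for $a\in\mathcal A_\nu$. Under the identification, $u_i$ corresponds to $E_{n-i}$, $w$ to $v_n\otimes v_n$, and $z$ to $q(v_{n-1}\otimes v_n-q\,v_n\otimes v_{n-1})$. *)

theory Defs
  imports
    "HOL-Library.Poly_Mapping"
    "HOL-Computational_Algebra.Fraction_Field"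
    "HOL-Computational_Algebra.Polynomial"
    "HOL-Algebra.QuotRing"
begin

section \<open>The ground field and free algebras\<close>

type_synonym Cq = "complex poly fract"

definition qq :: Cq where
  "qq = Fraction_Field.Fract [:0, 1:] 1"

definition hh :: Cq where
  "hh = qq - inverse qq"

datatype 'a word = Word (letters: "'a list")

instantiation word :: (type) monoid_add
begin

definition zero_word :: "'a word" where
  "zero_word = Word []"

definition plus_word :: "'a word \<Rightarrow> 'a word \<Rightarrow> 'a word" where
  "plus_word v w = Word (letters v @ letters w)"

instance
  by standard (simp_all add: zero_word_def plus_word_def)

end

text \<open>Since \<^typ>\<open>'a word\<close> is the free monoid on \<^typ>\<open>'a\<close>, the convolution product makes
  \<^typ>\<open>'a word \<Rightarrow>\<^sub>0 Cq\<close> the free associative algebra on \<^typ>\<open>'a\<close>.\<close>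

type_synonym 'a free = "'a word \<Rightarrow>\<^sub>0 Cq"

abbreviation basis :: "'k \<Rightarrow> ('k \<Rightarrow>\<^sub>0 Cq)" where
  "basis k \<equiv> Poly_Mapping.single k 1"

abbreviation mon :: "'a list \<Rightarrow> 'a free" where
  "mon xs \<equiv> basis (Word xs)"

definition scale :: "Cq \<Rightarrow> ('k \<Rightarrow>\<^sub>0 Cq) \<Rightarrow> ('k \<Rightarrow>\<^sub>0 Cq)" where
  "scale c x = Poly_Mapping.map ((*) c) x"

definition linear_ext :: "('k \<Rightarrow> ('l \<Rightarrow>\<^sub>0 Cq)) \<Rightarrow> ('k \<Rightarrow>\<^sub>0 Cq) \<Rightarrow> ('l \<Rightarrow>\<^sub>0 Cq)" where
  "linear_ext f x = (\<Sum>k\<in>Poly_Mapping.keys x. scale (Poly_Mapping.lookup x k) (f k))"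

definition subalg :: "'a list set \<Rightarrow> 'a free ring" where
  "subalg L = \<lparr>carrier = {x. \<forall>w\<in>Poly_Mapping.keys x. letters w \<in> L},
     mult = (*), one = 1, zero = 0, add = (+)\<rparr>"

definition free_alg :: "'a set \<Rightarrow> 'a free ring" where
  "free_alg X = subalg (lists X)"

lemma ring_subalg:
  assumes "[] \<in> L" and "\<And>u v. u \<in> L \<Longrightarrow> v \<in> L \<Longrightarrow> u @ v \<in> L"
  shows "ring (subalg L)"
proof (rule ringI)
  show "abelian_group (subalg L)"
  proof (rule abelian_groupI)
    fix x y assume "x \<in> carrier (subalg L)" "y \<in> carrier (subalg L)"
    then show "x \<oplus>\<^bsub>subalg L\<^esub> y \<in> carrier (subalg L)"
      using Poly_Mapping.keys_add[of x y] by (auto simp: subalg_def)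
  next
    fix x assume "x \<in> carrier (subalg L)"
    then have "- x \<in> carrier (subalg L)" by (simp add: subalg_def)
    then show "\<exists>y\<in>carrier (subalg L). y \<oplus>\<^bsub>subalg L\<^esub> x = \<zero>\<^bsub>subalg L\<^esub>"
      by (intro bexI[of _ "- x"]) (simp_all add: subalg_def)
  qed (simp_all add: subalg_def add.assoc add.commute)
  show "Group.monoid (subalg L)"
  proof (rule monoidI)
    fix x y assume "x \<in> carrier (subalg L)" "y \<in> carrier (subalg L)"
    then show "x \<otimes>\<^bsub>subalg L\<^esub> y \<in> carrier (subalg L)"
      using Poly_Mapping.keys_mult[of x y] assms(2)
      by (fastforce simp: subalg_def plus_word_def)
  qed (use assms(1) in \<open>simp_all add: subalg_def mult.assoc zero_word_def\<close>)
qed (simp_all add: subalg_def algebra_simps)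

lemma ring_free_alg: "ring (free_alg X)"
  unfolding free_alg_def by (rule ring_subalg) auto

definition bracket :: "Cq \<Rightarrow> 'a free \<Rightarrow> 'a free \<Rightarrow> 'a free" where
  "bracket v a b = a * b - scale v (b * a)"


section \<open>The quantized enveloping algebra and its positive part\<close>

datatype uq_gen = GE nat | GF nat | GK nat | GKinv nat

definition cartan :: "nat \<Rightarrow> nat \<Rightarrow> int" where
  "cartan i j = (if i = j then 2 else if i = j + 1 \<or> j = i + 1 then - 1 else 0)"

abbreviation "eE i \<equiv> mon [GE i]"
abbreviation "eF i \<equiv> mon [GF i]"
abbreviation "eK i \<equiv> mon [GK i]"
abbreviation "eKinv i \<equiv> mon [GKinv i]"

definition serre :: "'a free \<Rightarrow> 'a free \<Rightarrow> 'a free" where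
  "serre a b = a * a * b - scale (qq + inverse qq) (a * b * a) + b * a * a"

definition Uq_free :: "nat \<Rightarrow> uq_gen free ring" where
  "Uq_free n = free_alg (\<Union>i\<in>{1..n - 1}. {GE i, GF i, GK i, GKinv i})"

definition Uq_rels :: "nat \<Rightarrow> uq_gen free set" where
  "Uq_rels n =
     {eK i * eKinv i - 1 | i. i \<in> {1..n - 1}} \<union>
     {eKinv i * eK i - 1 | i. i \<in> {1..n - 1}} \<union>
     {eK i * eK j - eK j * eK i | i j. i \<in> {1..n - 1} \<and> j \<in> {1..n - 1}} \<union>
     {eK i * eE j * eKinv i - scale (qq powi cartan i j) (eE j) | i j.
        i \<in> {1..n - 1} \<and> j \<in> {1..n - 1}} \<union>
     {eK i * eF j * eKinv i - scale (qq powi (- cartan i j)) (eF j) | i j.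
        i \<in> {1..n - 1} \<and> j \<in> {1..n - 1}} \<union>
     {eE i * eF j - eF j * eE i -
        (if i = j then scale (inverse (qq - inverse qq)) (eK i - eKinv i) else 0) | i j.
        i \<in> {1..n - 1} \<and> j \<in> {1..n - 1}} \<union>
     {serre (eE i) (eE j) | i j.
        i \<in> {1..n - 1} \<and> j \<in> {1..n - 1} \<and> (i = j + 1 \<or> j = i + 1)} \<union>
     {serre (eF i) (eF j) | i j.
        i \<in> {1..n - 1} \<and> j \<in> {1..n - 1} \<and> (i = j + 1 \<or> j = i + 1)} \<union>
     {eE i * eE j - eE j * eE i | i j.
        i \<in> {1..n - 1} \<and> j \<in> {1..n - 1} \<and> (i + 1 < j \<or> j + 1 < i)} \<union>
     {eF i * eF j - eF j * eF i | i j.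
        i \<in> {1..n - 1} \<and> j \<in> {1..n - 1} \<and> (i + 1 < j \<or> j + 1 < i)}"

definition Uq_ideal :: "nat \<Rightarrow> uq_gen free set" where
  "Uq_ideal n = genideal (Uq_free n) (Uq_rels n)"

definition Uq :: "nat \<Rightarrow> uq_gen free set ring" where
  "Uq n = Uq_free n Quot Uq_ideal n"

text \<open>A word in the indices \<open>i\<close> stands for the corresponding product of the \<open>E\<^sub>i\<close>.\<close>

definition Uplus_free :: "nat \<Rightarrow> nat free ring" where
  "Uplus_free n = free_alg {1..n - 1}"

definition Uplus_map :: "nat \<Rightarrow> nat free \<Rightarrow> uq_gen free set" where
  "Uplus_map n x =
     Uq_ideal n +>\<^bsub>Uq_free n\<^esub> linear_ext (\<lambda>w. mon (map GE (letters w))) x"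

text \<open>The positive part, as the subalgebra of \<^term>\<open>Uq n\<close> generated by the \<open>E\<^sub>i\<close>, is the image of
  \<^term>\<open>Uplus_map n\<close>, that is, \<^term>\<open>Uplus_free n\<close> modulo the following kernel.\<close>

definition Uplus_kernel :: "nat \<Rightarrow> nat free set" where
  "Uplus_kernel n = a_kernel (Uplus_free n) (Uq n) (Uplus_map n)"


section \<open>The algebra \<open>S\<^sub>q(V \<otimes> V)\<close>\<close>

text \<open>The tensor algebra of \<open>V\<close> is the free algebra on the indices of \<open>v\<^sub>1, \<dots>, v\<^sub>n\<close>; the tensor
  algebra of \<open>V \<otimes> V\<close> is its subalgebra of tensors of even degree.\<close>

definition even_words :: "nat \<Rightarrow> nat list set" where
  "even_words n = {w \<in> lists {1..n}. even (length w)}"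

definition TVV :: "nat \<Rightarrow> nat free ring" where
  "TVV n = subalg (even_words n)"

lemma ring_TVV: "ring (TVV n)"
  unfolding TVV_def by (rule ring_subalg) (auto simp: even_words_def)

definition V4 :: "nat \<Rightarrow> nat free set" where
  "V4 n = {x. \<forall>w\<in>Poly_Mapping.keys x. letters w \<in> lists {1..n} \<and> length (letters w) = 4}"

definition T_op :: "nat \<Rightarrow> nat \<Rightarrow> nat free" where
  "T_op a b =
     (if a \<le> b then scale (if a = b then inverse qq else 1) (mon [b, a])
      else mon [b, a] - scale (qq - inverse qq) (mon [a, b]))"

definition Psi_i :: "nat \<Rightarrow> nat free \<Rightarrow> nat free" where
  "Psi_i i = linear_ext (\<lambda>w. let l = letters w in
     mon (take (i - 1) l) * T_op (l ! (i - 1)) (l ! i) * mon (drop (i + 1) l))"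

definition Psi :: "nat free \<Rightarrow> nat free" where
  "Psi x = Psi_i 2 (Psi_i 1 (Psi_i 3 (Psi_i 2 x)))
     + scale (qq - inverse qq) (Psi_i 1 (Psi_i 2 (Psi_i 1 x)) + Psi_i 1 (Psi_i 3 (Psi_i 2 x)))
     + scale ((qq - inverse qq)\<^sup>2) (Psi_i 1 (Psi_i 2 x))"

definition Sq_ideal :: "nat \<Rightarrow> nat free set" where
  "Sq_ideal n = genideal (TVV n) {Psi x - x | x. x \<in> V4 n}"

definition Sq :: "nat \<Rightarrow> nat free set ring" where
  "Sq n = TVV n Quot Sq_ideal n"

text \<open>\<^term>\<open>wt i w\<close> is \<open>(\<alpha>\<^sub>i, \<nu>)\<close> for the weight \<open>\<nu>\<close> of the tensor \<open>w\<close>, so \<open>K\<^sub>i\<close> acts on \<open>w\<close> by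
  \<open>q ^ wt i w\<close>. The operators \<open>E\<^sub>i\<close> are extended from \<open>V\<close> to tensors by
  \<open>\<Delta>(E\<^sub>i) = E\<^sub>i \<otimes> 1 + K\<^sub>i \<otimes> E\<^sub>i\<close>.\<close>

definition wt :: "nat \<Rightarrow> nat list \<Rightarrow> int" where
  "wt i w = (\<Sum>j\<leftarrow>w. of_bool (j = i) - of_bool (j = i + 1))"

primrec E_word :: "nat \<Rightarrow> nat list \<Rightarrow> nat free" where
  "E_word i [] = 0"
| "E_word i (j # w) =
     (if j = i + 1 then mon [i] else 0) * mon w
     + scale (qq powi wt i [j]) (mon [j] * E_word i w)"


section \<open>The braided cross product\<close>

text \<open>The tensor product of the two free algebras has the basis of pairs of words. On it, left
  multiplication by \<open>E\<^sub>i\<close> is dictated by \<open>E\<^sub>i \<cdot> a = E\<^sub>i(a) + q\<^bsup>(\<alpha>\<^sub>i, \<nu>)\<^esup> a \<cdot> E\<^sub>i\<close>.\<close>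

type_synonym cross = "(nat word \<times> nat word) \<Rightarrow>\<^sub>0 Cq"

definition tensor :: "nat free \<Rightarrow> nat free \<Rightarrow> cross" where
  "tensor a x = linear_ext (\<lambda>v. linear_ext (\<lambda>e. basis (v, e)) x) a"

definition E_lmult :: "nat \<Rightarrow> cross \<Rightarrow> cross" where
  "E_lmult i = linear_ext (\<lambda>(v, e).
     tensor (E_word i (letters v)) (basis e)
     + scale (qq powi wt i (letters v)) (tensor (basis v) (mon [i] * basis e)))"

definition S_lmult :: "nat word \<Rightarrow> cross \<Rightarrow> cross" where
  "S_lmult s = linear_ext (\<lambda>(v, e). basis (s + v, e))"

definition cross_mult :: "cross \<Rightarrow> cross \<Rightarrow> cross" where
  "cross_mult x y = linear_ext (\<lambda>(s, e). S_lmult s (foldr E_lmult (letters e) y)) x"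

definition free_cross :: "nat \<Rightarrow> cross ring" where
  "free_cross n =
     \<lparr>carrier = {x. \<forall>(v, e)\<in>Poly_Mapping.keys x.
         letters v \<in> even_words n \<and> letters e \<in> lists {1..n - 1}},
      mult = cross_mult, one = tensor 1 1, zero = 0, add = (+)\<rparr>"

text \<open>If \<open>S = F/I\<close> and \<open>U = G/J\<close>, then \<open>S \<otimes> U = (F \<otimes> G)/(I \<otimes> G + F \<otimes> J)\<close>. So the underlying vector
  space of \<open>cross_product n\<close> below is the tensor product of \<^term>\<open>Sq n\<close> and the positive part.\<close>

definition cross_ideal :: "nat \<Rightarrow> cross set" where
  "cross_ideal n = module.span scale
     ({tensor a x | a x. a \<in> Sq_ideal n \<and> x \<in> carrier (Uplus_free n)} \<union>
      {tensor a x | a x. a \<in> carrier (TVV n) \<and> x \<in> Uplus_kernel n})"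

definition cross_product :: "nat \<Rightarrow> cross set ring" where
  "cross_product n = free_cross n Quot cross_ideal n"

text \<open>The element \<open>a \<otimes> x\<close> of the cross product.\<close>

definition cross_elem :: "nat \<Rightarrow> nat free \<Rightarrow> nat free \<Rightarrow> cross set" where
  "cross_elem n a x = cross_ideal n +>\<^bsub>free_cross n\<^esub> tensor a x"


section \<open>The algebra given by generators and relations\<close>

datatype pgen = GU nat | GW | GZ

text \<open>The value \<open>0\<close> outside \<open>1, \<dots>, n - 1\<close> implements the convention \<open>u\<^sub>2 = 0\<close> for \<open>n = 2\<close>.\<close>

definition uu :: "nat \<Rightarrow> nat \<Rightarrow> pgen free" where
  "uu n i = (if i \<in> {1..n - 1} then mon [GU i] else 0)"

abbreviation "ww \<equiv> mon [GW]"
abbreviation "zz \<equiv> mon [GZ]"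

definition pres_free :: "nat \<Rightarrow> pgen free ring" where
  "pres_free n = free_alg (GU ` {1..n - 1} \<union> {GW, GZ})"

definition pres_rels :: "nat \<Rightarrow> pgen free set" where
  "pres_rels n =
     {bracket (inverse qq) (uu n i) (bracket qq (uu n i) (uu n j)) | i j.
        i \<in> {1..n - 1} \<and> j \<in> {1..n - 1} \<and> (i = j + 1 \<or> j = i + 1)} \<union>
     {uu n i * uu n j - uu n j * uu n i | i j.
        i \<in> {1..n - 1} \<and> j \<in> {1..n - 1} \<and> (i + 1 < j \<or> j + 1 < i)} \<union>
     {uu n i * ww - ww * uu n i | i. i \<in> {1..n - 1} \<and> i \<noteq> 1} \<union>
     {uu n i * zz - zz * uu n i | i. i \<in> {1..n - 1} \<and> i \<noteq> 2} \<union>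
     {zz * ww - ww * zz,
      bracket (inverse qq ^ 2) (uu n 1) (bracket (qq ^ 2) (uu n 1) (bracket 1 (uu n 1) ww)),
      bracket (inverse qq) (uu n 2) (bracket qq (uu n 2) zz),
      bracket (inverse qq ^ 2) ww (bracket (qq ^ 2) ww (uu n 1)) + scale hh (ww * zz),
      bracket qq zz (bracket qq (uu n 2) (bracket (qq ^ 2) (uu n 1) ww))
        - bracket (qq ^ 2) ww (bracket qq (uu n 1) (bracket qq (uu n 2) zz)),
      scale 2 (bracket (inverse qq) zz (bracket qq zz (uu n 2)))
        - scale hh
           (zz * bracket qq (uu n 1) (uu n 2) * ww
            + ww * bracket (inverse qq) (uu n 2) (uu n 1) * zz
            + ww * uu n 1 * bracket qq zz (uu n 2)
            + bracket (inverse qq) (uu n 2) zz * uu n 1 * ww)}"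

definition pres_ideal :: "nat \<Rightarrow> pgen free set" where
  "pres_ideal n = genideal (pres_free n) (pres_rels n)"

definition pres_alg :: "nat \<Rightarrow> pgen free set ring" where
  "pres_alg n = pres_free n Quot pres_ideal n"

definition pres_elem :: "nat \<Rightarrow> pgen free \<Rightarrow> pgen free set" where
  "pres_elem n x = pres_ideal n +>\<^bsub>pres_free n\<^esub> x"

end

theory Submission
  imports Defs
begin

text \<open>Letters and generators are matched by \<open>u\<^sub>i \<mapsto> E\<^sub>n\<^sub>-\<^sub>i\<close>. Sending the generators \<open>u\<^sub>i\<close>, \<open>w\<close>, \<open>z\<close> to the
  stated elements defines a homomorphism \<open>\<Phi>\<close> from the presented algebra to the cross product; for the
  quadratic relators this means that they are \<open>(\<Psi> - 1) x\<close> for explicit \<open>x\<close>, up to multiples of the simpler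
  ones. It is onto because \<open>V \<otimes> V\<close> is generated from \<open>w\<close> and \<open>z\<close> by the \<open>E\<^sub>k\<close>.

  For injectivity one builds the inverse \<open>\<Theta>\<close>. In the presented algebra let \<open>\<kappa>\<^sub>k\<close> be the diagonal
  automorphism corresponding to \<open>K\<close> and \<open>ad\<^sub>k x = u\<^sub>k x - \<kappa>\<^sub>k(x) u\<^sub>k\<close>. The \<open>ad\<^sub>k\<close> satisfy the Serre
  relations, and \<open>w\<close> and \<open>z\<close> satisfy the relations of extremal vectors of the symmetric and the
  exterior square of \<open>V\<close>, so they generate elements \<open>Y a b\<close> on which the \<open>ad\<^sub>k\<close> act as the \<open>E\<^sub>k\<close> act on
  \<open>V \<otimes> V\<close>. It remains to see that \<open>(\<Psi> - 1) x\<close> becomes \<open>0\<close> in the \<open>Y a b\<close> for all \<open>x \<in> V\<^sup>\<otimes>\<^sup>4\<close>. The set of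
  such \<open>x\<close> is stable under the \<open>E\<^sub>k\<close>. A word with a letter \<open>k < n\<close> but without \<open>k + 1\<close> is a multiple of
  \<open>E\<^sub>k\<close> of a word with larger letters, so only words in the top letters are left: those in which
  \<open>k + 1\<close> occurs once and \<open>k\<close> at least twice also lie in the image of \<open>E\<^sub>k\<close>, and the others follow from the
  quadratic relations by linear algebra.\<close>

section \<open>Linear maps on free modules\<close>

text \<open>The positive part is given only as a subalgebra of U_q(sl_n), so its relations must be
  found before a map out of it can be defined. That the Serre relations suffice is read off from a
  module: U_q(sl_n) acts on the free algebra in the E_i modulo the Serre ideal, and an element of
  the positive part is recovered there from its action on 1. No basis of either algebra is
  constructed. \<open>Theta\<close> is a linear map on the free cross product that carries left
  multiplication by generators to left multiplication in the presented algebra, so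
  \<open>Theta\<close> after \<open>Phi\<close> is the class map, and injectivity follows once
  \<open>Theta\<close> kills \<open>cross_ideal\<close>. The same identity lets one computation
  serve both directions: the image of a quadratic relator, evaluated once in the free cross product,
  shows that the relator goes to zero there and also that the \<open>Y a b\<close> satisfy the
  corresponding relation. The remaining obstacle is that n is arbitrary. Stability under the E_k
  reduces all words of length four to those on at most four consecutive letters ending at n, and
  these look the same for every n.\<close>

lemma lookup_scale [simp]: "Poly_Mapping.lookup (scale c x) k = c * Poly_Mapping.lookup x k"
  by (simp add: scale_def Poly_Mapping.map.rep_eq when_def)

interpretation scale: vector_space scale
  by standard (rule poly_mapping_eqI, simp add: lookup_add algebra_simps)+

abbreviation lin :: "(('k \<Rightarrow>\<^sub>0 Cq) \<Rightarrow>
    ('l \<Rightarrow>\<^sub>0 Cq)) \<Rightarrow> bool" where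
  "lin \<equiv> Vector_Spaces.linear scale scale"

lemma keys_scale: "Poly_Mapping.keys (scale c x) \<subseteq> Poly_Mapping.keys x"
  by (auto simp: in_keys_iff)

lemma poly_mapping_sum_basis:
  fixes x :: "'k \<Rightarrow>\<^sub>0 Cq"
  shows "x = (\<Sum>k\<in>Poly_Mapping.keys x. scale (Poly_Mapping.lookup x k) (basis k))"
proof (rule poly_mapping_eqI)
  fix j
  have "(\<Sum>k\<in>Poly_Mapping.keys x. Poly_Mapping.lookup x k * (1 when k = j)) =
      (\<Sum>k\<in>Poly_Mapping.keys x. if k = j then Poly_Mapping.lookup x k else 0)"
    by (rule sum.cong) auto
  also have "\<dots> = Poly_Mapping.lookup x j"
    by (simp add: in_keys_iff)
  finally show "Poly_Mapping.lookup x j = Poly_Mapping.lookup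
      (\<Sum>k\<in>Poly_Mapping.keys x. scale (Poly_Mapping.lookup x k) (basis k)) j"
    by (simp add: lookup_sum lookup_single)
qed

lemma span_basis_induct [consumes 1, case_names zero add scale basis]:
  assumes "Poly_Mapping.keys x \<subseteq> A"
    and "P 0" and "\<And>x y. P x \<Longrightarrow> P y \<Longrightarrow>
        P (x + y)" and "\<And>c x. P x \<Longrightarrow> P (scale c x)"
    and "\<And>k. k \<in> A \<Longrightarrow> P (basis k)"
  shows "P x"
proof -
  have "P (\<Sum>k\<in>B. scale (Poly_Mapping.lookup x k) (basis k))"
    if "finite B" "B \<subseteq> A" for B
    using that by (induction B) (auto intro!: assms(2-))
  then show ?thesis
    using assms(1) poly_mapping_sum_basis[of x] by (metis finite_keys)
qed

text \<open>Unlike \<open>linear_ext\<close>, the target is an arbitrary vector space over C(q); the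
  presented algebra \<open>palg\<close> is a quotient type and not a type of finitely supported
  functions.\<close>

definition lext :: "(Cq \<Rightarrow> 'b \<Rightarrow> 'b::ab_group_add) \<Rightarrow>
    ('k \<Rightarrow> 'b) \<Rightarrow> ('k \<Rightarrow>\<^sub>0 Cq) \<Rightarrow> 'b" where
  "lext s f x = (\<Sum>k\<in>Poly_Mapping.keys x. s (Poly_Mapping.lookup x k) (f k))"

lemma linear_ext_eq_lext: "linear_ext = lext scale"
  by (intro ext) (simp add: linear_ext_def lext_def)

lemma linear_lext:
  fixes f :: "'k \<Rightarrow> 'b::ab_group_add"
  assumes "vector_space s"
  shows "Vector_Spaces.linear scale s (lext s f)"
proof -
  interpret s: vector_space s by fact
  have sup: "lext s f x = (\<Sum>k\<in>A. s (Poly_Mapping.lookup x k) (f k))"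
    if "finite A" "Poly_Mapping.keys x \<subseteq> A" for x :: "'k \<Rightarrow>\<^sub>0 Cq" and A
    unfolding lext_def using that by (intro sum.mono_neutral_left) (auto simp: in_keys_iff)
  show ?thesis
  proof (unfold Vector_Spaces.linear_iff, intro conjI allI)
    fix x y :: "'k \<Rightarrow>\<^sub>0 Cq" and c
    let ?A = "Poly_Mapping.keys x \<union> Poly_Mapping.keys y"
    show "lext s f (x + y) = lext s f x + lext s f y"
      using sup[of ?A x] sup[of ?A y] sup[of ?A "x + y"] Poly_Mapping.keys_add[of x y]
      by (simp add: lookup_add s.scale_left_distrib sum.distrib)
    show "lext s f (scale c x) = s c (lext s f x)"
      using sup[of "Poly_Mapping.keys x" "scale c x"] keys_scale[of c x]
      by (simp add: lext_def s.scale_sum_right)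
  qed (use scale.vector_space_axioms assms in auto)
qed

lemma lext_basis [simp]:
  assumes "vector_space s" shows "lext s f (basis k) = f k"
proof -
  interpret s: vector_space s by fact
  show ?thesis by (simp add: lext_def)
qed

lemma lin_linear_ext: "lin (linear_ext f)"
  unfolding linear_ext_eq_lext by (rule linear_lext) (rule scale.vector_space_axioms)

lemma linear_ext_basis [simp]: "linear_ext f (basis k) = f k"
  unfolding linear_ext_eq_lext by (simp add: scale.vector_space_axioms)

lemma linD:
  assumes "lin f"
  shows "f (x + y) = f x + f y" "f (scale c x) = scale c (f x)" "f 0 = 0" "f (- x) = - f x"
    "f (x - y) = f x - f y"
  using assms unfolding module_hom_iff_linear[symmetric]
  by (auto simp: module_hom.add module_hom.scale module_hom.zero module_hom.neg module_hom.diff)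

lemmas linear_ext_simps [simp] = linD[OF lin_linear_ext]

lemma linI:
  assumes "\<And>x y. f (x + y) = f x + f y" "\<And>c x. f (scale c x) = scale c (f x)"
  shows "lin f"
  using assms by (auto simp: Vector_Spaces.linear_iff scale.vector_space_axioms)

lemma lin_eqI:
  assumes "lin f" "lin g" "Poly_Mapping.keys x \<subseteq> A" "\<And>k. k \<in> A \<Longrightarrow> f (basis k)
      = g (basis k)"
  shows "f x = g x"
  using assms(3) by (induction rule: span_basis_induct)
    (auto simp: linD[OF assms(1)] linD[OF assms(2)] assms(4))

lemma lin_eqI_UNIV:
  assumes "lin f" "lin g" "\<And>k. f (basis k) = g (basis k)"
  shows "f x = g x"
  using lin_eqI[OF assms(1,2), of x UNIV] assms(3) by auto

lemma lin_comp: "lin f \<Longrightarrow> lin g \<Longrightarrow> lin (\<lambda>x. f (g x))"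
  by (rule linI) (simp_all add: linD)

lemma lin_id: "lin (\<lambda>x. x)"
  by (rule linI) simp_all

lemma lin_foldr: "(\<And>i. lin (G i)) \<Longrightarrow> lin (foldr G l)"
proof (induction l)
  case Nil
  then show ?case using lin_id by (simp add: id_def)
next
  case (Cons a l)
  have "foldr G (a # l) = (\<lambda>x. G a (foldr G l x))"
    by (simp add: fun_eq_iff)
  then show ?case using lin_comp[OF Cons.prems Cons.IH[OF Cons.prems]] by simp
qed

section \<open>Free algebras\<close>

lemma scale_eq_mult: "scale c x = Poly_Mapping.single 0 c * x"
  for x :: "'a free"
  unfolding scale_def by (rule mult_map_scale_conv_mult)

lemma single_0_commute: "Poly_Mapping.single 0 c * x = x * Poly_Mapping.single 0 c"
  for x :: "'a free"
proof -
  have eq: "scale d y = Poly_Mapping.single 0 d * y" for d and y :: "'a free"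
    by (rule scale_eq_mult)
  have c: "Poly_Mapping.single 0 c * Poly_Mapping.single 0 d =
      Poly_Mapping.single 0 d * (Poly_Mapping.single 0 c :: 'a free)" for d
    by (simp add: mult_single mult.commute[of c d])
  have "lin (\<lambda>x::'a free. Poly_Mapping.single 0 c * x)"
  proof (rule linI)
    fix d and y :: "'a free"
    show "Poly_Mapping.single 0 c * scale d y = scale d (Poly_Mapping.single 0 c * y)"
      unfolding eq mult.assoc[symmetric] c ..
  qed (rule distrib_left)
  moreover have "lin (\<lambda>x::'a free. x * Poly_Mapping.single 0 c)"
    by (rule linI) (simp_all only: distrib_right eq mult.assoc)
  ultimately show ?thesis
    by (rule lin_eqI_UNIV) (simp add: mult_single)
qed

lemma scale_mult_left [simp]: "scale c x * y = scale c (x * y)"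
  for x :: "'a free"
  unfolding scale_eq_mult by (rule mult.assoc)

lemma scale_mult_right [simp]: "x * scale c y = scale c (x * y)"
  for x :: "'a free"
  unfolding scale_eq_mult mult.assoc[symmetric] single_0_commute[of c x] ..

lemma mon_mult: "mon xs * mon ys = mon (xs @ ys)"
  by (simp add: mult_single plus_word_def)

lemma mon_mult_assoc: "mon xs * (mon ys * z) = mon (xs @ ys) * z"
  by (simp add: mon_mult flip: mult.assoc)

lemma one_eq_mon: "1 = mon []"
  by (simp add: zero_word_def flip: single_one)

lemma lin_mult_left: "lin (\<lambda>x. (a::'a free) * x)"
  by (rule linI) (simp_all add: distrib_left)

lemma free_induct [case_names zero add scale mon]:
  assumes "P 0" "\<And>x y. P x \<Longrightarrow> P y \<Longrightarrow>
      P (x + y)" "\<And>c x. P x \<Longrightarrow> P (scale c x)" "\<And>w. P (mon w)"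
  shows "P (x :: 'a free)"
  using span_basis_induct[of x UNIV P] assms by (metis subset_UNIV word.exhaust)

text \<open>By freeness, any linear operators attached to the letters make the space a module. This
  one construction gives the action of U_q(sl_n) on its lowest weight module, left multiplication by
  the E_i in the cross product, and the map out of the presentation.\<close>

definition act :: "(Cq \<Rightarrow> 'b \<Rightarrow> 'b::ab_group_add) \<Rightarrow>
    ('a \<Rightarrow> 'b \<Rightarrow> 'b) \<Rightarrow> 'a free \<Rightarrow> 'b \<Rightarrow> 'b" where
  "act s G x y = lext s (\<lambda>w. foldr G (letters w) y) x"

locale free_module = vector_space s for s :: "Cq \<Rightarrow> 'b \<Rightarrow> 'b::ab_group_add" +
  fixes G :: "'a \<Rightarrow> 'b \<Rightarrow> 'b"
  assumes linG: "\<And>i. Vector_Spaces.linear s s (G i)"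
begin

lemma G_simps: "G i (x + y) = G i x + G i y" "G i (s c x) = s c (G i x)" "G i 0 = 0"
  using linG[of i] unfolding module_hom_iff_linear[symmetric]
  by (auto simp: module_hom.add module_hom.scale module_hom.zero)

lemma foldr_simps: "foldr G l (x + y) = foldr G l x + foldr G l y"
    "foldr G l (s c x) = s c (foldr G l x)" "foldr G l 0 = 0"
  by (induction l) (auto simp: G_simps)

lemma act_left:
  "act s G (a + b) y = act s G a y + act s G b y" "act s G (Defs.scale c a) y = s c (act s G a y)"
  "act s G 0 y = 0" "act s G (a - b) y = act s G a y - act s G b y" "act s G (- a) y = - act s G a y"
  using linear_lext[OF vector_space_axioms, of "\<lambda>w. foldr G (letters w) y"]
  unfolding act_def module_hom_iff_linear[symmetric]
  by (auto simp: module_hom.add module_hom.scale module_hom.zero module_hom.diff module_hom.neg)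

lemma act_mon: "act s G (mon l) y = foldr G l y"
  by (simp add: act_def vector_space_axioms)

lemma act_one: "act s G 1 y = y"
  by (simp add: one_eq_mon act_mon)

lemma act_right:
  "act s G a (y + z) = act s G a y + act s G a z" "act s G a (s c y) = s c (act s G a y)"
  "act s G a 0 = 0"
  by (induction a rule: free_induct)
    (auto simp: act_left act_mon foldr_simps scale_right_distrib scale_left_commute algebra_simps)

lemma act_mult: "act s G (a * b) y = act s G a (act s G b y)"
proof (induction a rule: free_induct)
  case (mon v)
  show ?case
    by (induction b rule: free_induct)
      (auto simp: act_left act_mon mon_mult act_right foldr_simps distrib_left)
qed (auto simp: act_left distrib_right)

end

section \<open>Two-sided ideals\<close>

text \<open>Ideals of a whole type class ring, free of carriers, for inductions and for the quotient
  type below. They are compared with \<open>genideal\<close> inside a free algebra on fewer letters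
  by means of \<open>restrict_words\<close>.\<close>

inductive_set rideal :: "'r::ring_1 set \<Rightarrow> 'r set" for R where
  zero: "0 \<in> rideal R"
| incl: "r \<in> R \<Longrightarrow> r \<in> rideal R"
| add: "x \<in> rideal R \<Longrightarrow> y \<in> rideal R \<Longrightarrow> x + y \<in> rideal R"
| lmult: "x \<in> rideal R \<Longrightarrow> a * x \<in> rideal R"
| rmult: "x \<in> rideal R \<Longrightarrow> x * a \<in> rideal R"

lemma rideal_uminus: "x \<in> rideal R \<Longrightarrow> - x \<in> rideal R"
  using rideal.lmult[of x R "- 1"] by simp

lemma rideal_diff: "x \<in> rideal R \<Longrightarrow> y \<in> rideal R \<Longrightarrow> x - y \<in> rideal R"
  using rideal.add[of x R "- y"] rideal_uminus[of y R] by simp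

lemma rideal_scale: "x \<in> rideal R \<Longrightarrow> scale c x \<in> rideal R"
  for x :: "'a free"
  unfolding scale_eq_mult by (rule rideal.lmult)

section \<open>Retraction onto a smaller alphabet\<close>

definition restrict_words :: "'a set \<Rightarrow> 'a free \<Rightarrow> 'a free" where
  "restrict_words X = linear_ext (\<lambda>w. if set (letters w) \<subseteq> X then basis w else 0)"

lemma restrict_words_mon: "restrict_words X (mon l) = (if set l \<subseteq> X then mon l else 0)"
  by (simp add: restrict_words_def)

lemma lin_restrict_words: "lin (restrict_words X)"
  unfolding restrict_words_def by (rule lin_linear_ext)

lemmas restrict_words_simps = linD[OF lin_restrict_words]

lemma restrict_words_mult: "restrict_words X (a * b) = restrict_words X a * restrict_words X b"
proof (induction a rule: free_induct)
  case (mon v)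
  show ?case
    by (induction b rule: free_induct)
      (auto simp: restrict_words_mon mon_mult restrict_words_simps distrib_left)
qed (auto simp: restrict_words_simps distrib_right)

lemma carrier_free_alg: "x \<in> carrier (free_alg X) \<longleftrightarrow>
    (\<forall>w\<in>Poly_Mapping.keys x. set (letters w) \<subseteq> X)"
  by (auto simp: free_alg_def subalg_def in_lists_conv_set)

lemma free_alg_ops [simp]: "x \<otimes>\<^bsub>free_alg X\<^esub> y
    = x * y" "x \<oplus>\<^bsub>free_alg X\<^esub> y = x + y"
    "\<one>\<^bsub>free_alg X\<^esub> = 1" "\<zero>\<^bsub>free_alg X\<^esub> = 0"
  by (simp_all add: free_alg_def subalg_def)

lemma restrict_words_carrier: "restrict_words X x \<in> carrier (free_alg X)"
proof (induction x rule: free_induct)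
  case (add x y)
  then show ?case using Poly_Mapping.keys_add[of "restrict_words X x" "restrict_words X y"]
    by (force simp: restrict_words_simps carrier_free_alg)
next
  case (scale c x)
  then show ?case using keys_scale[of c "restrict_words X x"]
    by (force simp: restrict_words_simps carrier_free_alg)
qed (auto simp: restrict_words_simps restrict_words_mon carrier_free_alg)

lemma restrict_words_id: "x \<in> carrier (free_alg X) \<Longrightarrow> restrict_words X x = x"
proof -
  assume "x \<in> carrier (free_alg X)"
  then have "Poly_Mapping.keys x \<subseteq> {w. set (letters w) \<subseteq> X}"
    by (auto simp: carrier_free_alg)
  then show ?thesis
    by (induction rule: span_basis_induct) (auto simp: restrict_words_simps restrict_words_def)
qed

text \<open>Killing the letters outside X is a ring homomorphism, so the image of an ideal is
  controlled by the images of its generators.\<close>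

lemma rideal_imp_genideal:
  assumes "\<And>r. r \<in> R \<Longrightarrow> restrict_words X r \<in> genideal (free_alg X) R'"
    and R': "R' \<subseteq> carrier (free_alg X)" and "x \<in> rideal R"
  shows "restrict_words X x \<in> genideal (free_alg X) R'"
proof -
  interpret F: ring "free_alg X" by (rule ring_free_alg)
  interpret I: ideal "genideal (free_alg X) R'" "free_alg X"
    by (rule F.genideal_ideal[OF R'])
  show ?thesis
    using assms(3)
  proof induction
    case zero
    then show ?case using I.zero_closed by (simp add: restrict_words_simps)
  next
    case (add x y)
    then show ?case using I.a_closed[of "restrict_words X x" "restrict_words X y"]
      by (simp add: restrict_words_simps)
  next
    case (lmult x a)
    then show ?case
      using I.I_l_closed[of "restrict_words X x" "restrict_words X a"] restrict_words_carrier[of X a]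
      by (simp add: restrict_words_mult)
  next
    case (rmult x a)
    then show ?case
      using I.I_r_closed[of "restrict_words X x" "restrict_words X a"] restrict_words_carrier[of X a]
      by (simp add: restrict_words_mult)
  qed (use assms(1) in auto)
qed

text \<open>The elements of the carrier with property P form an ideal containing S; closure under
  negation comes from multiplication by -1.\<close>

lemma genideal_induct [consumes 3, case_names zero incl add lmult rmult]:
  assumes "ring F" "S \<subseteq> carrier F" "x \<in> genideal F S"
    and "P \<zero>\<^bsub>F\<^esub>" and "\<And>x. x \<in> S \<Longrightarrow> P x"
    and "\<And>x y. x \<in> carrier F \<Longrightarrow> y \<in> carrier F \<Longrightarrow>
        P x \<Longrightarrow> P y \<Longrightarrow> P (x \<oplus>\<^bsub>F\<^esub> y)"
    and lm: "\<And>a x. a \<in> carrier F \<Longrightarrow> x \<in> carrier F \<Longrightarrow>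
        P x \<Longrightarrow> P (a \<otimes>\<^bsub>F\<^esub> x)"
    and rm: "\<And>a x. a \<in> carrier F \<Longrightarrow> x \<in> carrier F \<Longrightarrow>
        P x \<Longrightarrow> P (x \<otimes>\<^bsub>F\<^esub> a)"
  shows "P x"
proof -
  interpret F: ring F by fact
  let ?I = "{x \<in> carrier F. P x}"
  have neg: "\<ominus>\<^bsub>F\<^esub> x \<in> ?I" if "x \<in> ?I" for x
  proof -
    have "\<ominus>\<^bsub>F\<^esub> x =
        (\<ominus>\<^bsub>F\<^esub> \<one>\<^bsub>F\<^esub>) \<otimes>\<^bsub>F\<^esub> x"
      using that by (simp add: F.l_minus)
    then show ?thesis using that lm[of "\<ominus>\<^bsub>F\<^esub> \<one>\<^bsub>F\<^esub>" x] by auto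
  qed
  have "ideal ?I F"
  proof (rule idealI)
    show "subgroup ?I (add_monoid F)"
    proof (rule group.subgroupI)
      show "Group.group (add_monoid F)" by (rule F.add.is_group)
      show "?I \<noteq> {}" using assms(4) by auto
      fix x assume "x \<in> ?I"
      then show "inv\<^bsub>add_monoid F\<^esub> x \<in> ?I" using neg unfolding a_inv_def by blast
    qed (use assms(6) in auto)
  qed (use assms in auto)
  then show ?thesis
    using F.genideal_minimal[of ?I S] assms(2,3,5) by auto
qed

section \<open>Quantum parameters\<close>

abbreviation "pp \<equiv> inverse qq"

lemma qq_nonzero [simp]: "qq \<noteq> 0"
  by (simp add: qq_def Zero_fract_def eq_fract)

lemma qq_sq_nonzero [simp]: "1 + qq * qq \<noteq> 0" "qq * qq - 1 \<noteq> 0" "1 + qq * qq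
    + qq * qq * qq * qq \<noteq> 0"
  by (simp_all add: qq_def Zero_fract_def One_fract_def eq_fract one_pCons)

lemma qint2_nonzero [simp]: "qq + pp \<noteq> 0"
  using qq_sq_nonzero(1) by (simp add: field_simps)

lemma two_nonzero_Cq [simp]: "(2::Cq) \<noteq> 0"
proof -
  have "(2::Cq) = 1 + 1" by simp
  also have "\<dots> = Fraction_Field.Fract [:2:] 1"
    unfolding One_fract_def by (simp add: one_pCons)
  also have "\<dots> \<noteq> Fraction_Field.Fract 0 1"
    by (simp add: eq_fract)
  finally show ?thesis by (simp add: Zero_fract_def)
qed

lemma scale_qp [simp]: "scale qq (scale pp x) = x" "scale pp (scale qq x) = x"
  by simp_all

lemma cartan_simps: "cartan i i = 2" "i = j + 1 \<or> j = i + 1 \<Longrightarrow> cartan i j = - 1"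
    "i + 1 < j \<or> j + 1 < i \<Longrightarrow> cartan i j = 0"
  by (auto simp: cartan_def)

lemma powi_simps: "qq powi (- 1) = pp" "qq powi (- 2) = pp * pp" "qq powi 2 = qq * qq"
  by (simp_all add: power_int_minus power2_eq_square)

section \<open>The coproduct and the Serre relations\<close>

text \<open>If \<open>E\<^sub>i\<close> acts on a product \<open>a x\<close> through \<open>E\<^sub>i \<otimes> 1 + K\<^sub>i \<otimes> E\<^sub>i\<close>, then the Serre element
  \<open>S\<close> of \<open>E\<^sub>i, E\<^sub>j\<close> acts through \<open>S \<otimes> 1 + K\<^sub>i\<^sup>2 K\<^sub>j \<otimes> S\<close>.\<close>

locale coproduct = A: vector_space sA + B: vector_space sB
  for sA :: "Cq \<Rightarrow> 'a \<Rightarrow> 'a::ab_group_add" and sB ::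
      "Cq \<Rightarrow> 'b \<Rightarrow> 'b::ab_group_add" +
  fixes Bm :: "'a \<Rightarrow> 'x \<Rightarrow> 'b" and EA KA :: "nat \<Rightarrow> 'a \<Rightarrow> 'a"
      and EY :: "nat \<Rightarrow> 'x \<Rightarrow> 'x"
    and EB :: "nat \<Rightarrow> 'b \<Rightarrow> 'b" and P :: "nat \<Rightarrow> bool"
  assumes B_scale: "Bm (sA c a) x = sB c (Bm a x)"
    and EA_scale: "P i \<Longrightarrow> EA i (sA c a) = sA c (EA i a)"
    and KA_scale: "P i \<Longrightarrow> KA i (sA c a) = sA c (KA i a)"
    and KE: "P i \<Longrightarrow> P j \<Longrightarrow> KA i (EA j a) = sA (qq powi cartan i j) (EA j (KA i a))"
    and KK: "P i \<Longrightarrow> P j \<Longrightarrow> KA i (KA j a) = KA j (KA i a)"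
    and EB_add: "P i \<Longrightarrow> EB i (y + z) = EB i y + EB i z"
    and EB_scale: "P i \<Longrightarrow> EB i (sB c y) = sB c (EB i y)"
    and EB_prod: "P i \<Longrightarrow> EB i (Bm a x) = Bm (EA i a) x + Bm (KA i a) (EY i x)"
begin

lemma coproduct_commutator:
  assumes "i + 1 < j \<or> j + 1 < i" "P i" "P j"
  shows "EB i (EB j (Bm a x)) - EB j (EB i (Bm a x)) =
    Bm (EA i (EA j a)) x - Bm (EA j (EA i a)) x
    + (Bm (KA i (KA j a)) (EY i (EY j x)) - Bm (KA i (KA j a)) (EY j (EY i x)))"
proof -
  have "cartan i j = 0" "cartan j i = 0"
    using assms by (auto simp: cartan_def)
  then show ?thesis
    using assms(2,3) by (simp add: EB_prod EB_add KE KK[of j i])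
qed

text \<open>The mixed terms cancel: moving the K past the E by \<open>KE\<close> leaves coefficients
  such as 1 - (q + q^-1) q^-1 + q^-2 = 0.\<close>

lemma coproduct_serre:
  assumes "i = j + 1 \<or> j = i + 1" "P i" "P j"
  shows "EB i (EB i (EB j (Bm a x))) - sB (qq + pp) (EB i (EB j (EB i (Bm a x)))) + EB j (EB i (EB i (Bm a x))) =
    (Bm (EA i (EA i (EA j a))) x - sB (qq + pp) (Bm (EA i (EA j (EA i a))) x) + Bm (EA j (EA i (EA i a))) x)
    + (Bm (KA i (KA i (KA j a))) (EY i (EY i (EY j x))) - sB (qq + pp) (Bm (KA i (KA i (KA j a))) (EY i (EY j
        (EY i x))))
       + Bm (KA i (KA i (KA j a))) (EY j (EY i (EY i x))))"
proof -
  have adj: "cartan i j = - 1" "cartan j i = - 1" "cartan i i = 2"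
    using assms(1) by (auto simp: cartan_def)
  have qp: "sB qq (sB pp y) = y" "sB pp (sB qq y) = y" "sA qq (sA pp a) = a" "sA pp (sA qq a) = a" for y a
    by simp_all
  \<comment> \<open>Powers of q are kept as nested scalings by \<open>qq\<close> and
    \<open>pp\<close>, which cancel pairwise in simplification; this is why
    \<open>scale_scale\<close> is removed from the simp set.\<close>
  have pw: "sA (qq\<^sup>2) a = sA qq (sA qq a)" "sA (qq powi (- 1)) a = sA pp a" for a
    by (simp_all add: powi_simps power2_eq_square)
  show ?thesis
    using assms(2,3) by (simp add: EB_prod EB_add EB_scale EA_scale KA_scale B_scale KE adj pw qp KK[of j i]
      B.scale_left_distrib B.scale_right_distrib A.scale_right_distrib
      del: A.scale_scale B.scale_scale)
qed

end

section \<open>The kernel of the positive part\<close>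

definition Serre_rels :: "nat \<Rightarrow> nat free set" where
  "Serre_rels n = {serre (mon [i]) (mon [j]) | i j. i \<in> {1..n - 1} \<and> j \<in> {1..n - 1} \<and> (i
      = j + 1 \<or> j = i + 1)} \<union>
    {mon [i] * mon [j] - mon [j] * mon [i] | i j. i \<in> {1..n - 1} \<and> j \<in> {1..n - 1} \<and> (i
        + 1 < j \<or> j + 1 < i)}"

text \<open>\<open>U\<^sub>q(sl\<^sub>n)\<close> acts on the free algebra in the \<open>E\<^sub>i\<close> as on the Verma module of lowest weight \<open>0\<close>,
  except that the Serre relations of the \<open>E\<^sub>i\<close> only hold modulo \<^const>\<open>Serre_rels\<close>.\<close>

definition KU :: "int \<Rightarrow> nat \<Rightarrow> nat free \<Rightarrow> nat free" where
  "KU e i = linear_ext (\<lambda>w. scale (qq powi (e * (\<Sum>j\<leftarrow>letters w. cartan i j))) (basis w))"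

text \<open>The relation [E_j, F_i] = delta_ij (K_i - K_i^-1) / (q - q^-1), read as a rule for
  moving F_i past the first letter until it meets the empty word, which it kills.\<close>

primrec F_word :: "nat \<Rightarrow> nat list \<Rightarrow> nat free" where
  "F_word i [] = 0"
| "F_word i (j # w) = mon [j] * F_word i w
     - (if i = j then scale (inverse (qq - pp)) (KU 1 i (mon w) - KU (- 1) i (mon w)) else 0)"

definition FU :: "nat \<Rightarrow> nat free \<Rightarrow> nat free" where
  "FU i = linear_ext (\<lambda>w. F_word i (letters w))"

primrec verma :: "uq_gen \<Rightarrow> nat free \<Rightarrow> nat free" where
  "verma (GE i) = (*) (mon [i])"
| "verma (GF i) = FU i"
| "verma (GK i) = KU 1 i"
| "verma (GKinv i) = KU (- 1) i"

lemma lin_KU: "lin (KU e i)" and lin_FU: "lin (FU i)"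
  unfolding KU_def FU_def by (rule lin_linear_ext)+

lemmas KU_lin = linD[OF lin_KU] and FU_lin = linD[OF lin_FU]

lemma KU_mult: "KU e i (x * y) = KU e i x * KU e i y"
proof (induction x rule: free_induct)
  case (mon v)
  show ?case
    by (induction y rule: free_induct)
      (auto simp: KU_def mon_mult distrib_left distrib_left power_int_add)
qed (auto simp: KU_lin distrib_right)

lemma KU_mon1: "KU e i (mon [j]) = scale (qq powi (e * cartan i j)) (mon [j])"
  by (simp add: KU_def)

lemma KU_one: "KU e i 1 = 1"
  by (simp add: KU_def one_eq_mon)

lemma KU_inverse: "KU (- e) i (KU e i x) = x"
proof (induction x rule: free_induct)
  case (mon w)
  then show ?case by (simp add: KU_def power_int_minus)
qed (simp_all add: KU_lin)

lemma KU_commute: "KU e i (KU f j x) = KU f j (KU e i x)"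
proof (induction x rule: free_induct)
  case (mon w)
  then show ?case by (simp add: KU_def mult.commute)
qed (simp_all add: KU_lin)

lemma FU_mon_mult: "FU i (mon [j] * x) = mon [j] * FU i x
    - (if i = j then scale (inverse (qq - pp)) (KU 1 i x - KU (- 1) i x) else 0)"
proof (induction x rule: free_induct)
  case (mon w)
  then show ?case by (simp add: FU_def mon_mult)
qed (simp_all add: FU_lin KU_lin distrib_left scale.scale_right_distrib scale.scale_right_diff_distrib mult.commute)

lemma FU_one: "FU i 1 = 0"
  by (simp add: FU_def one_eq_mon)

lemma KU_FU: "KU e i (FU j x) = scale (qq powi (- (e * cartan i j))) (FU j (KU e i x))"
proof (induction x rule: free_induct)
  case (mon w)
  then show ?case
  proof (induction w)
    case Nil
    then show ?case by (simp add: FU_one KU_lin flip: one_eq_mon) (simp add: KU_one FU_one)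
  next
    case (Cons k w)
    have inv: "inverse a * (b * a) = b" if "a \<noteq> 0" for a b :: Cq
      using that by simp
    have "KU e i (FU j (mon [k] * mon w)) = scale (qq powi (- (e * cartan i j))) (FU j (KU e i (mon [k] * mon w)))"
      by (cases "k = j") (simp_all add: inv FU_mon_mult KU_mult KU_lin FU_lin Cons KU_mon1 power_int_minus
          scale.scale_right_diff_distrib KU_commute mult.commute)
    then show ?case unfolding mon_mult by simp
  qed
next
  case (add x y)
  then show ?case by (simp add: FU_lin KU_lin scale.scale_right_distrib)
next
  case (scale c x)
  then show ?case by (simp add: FU_lin KU_lin mult.commute)
qed (simp add: FU_lin KU_lin)

section \<open>Serre elements in the E and in the F on the lowest weight module\<close>

lemma FU_serre_aux:
  assumes "i = j + 1 \<or> j = i + 1"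
  shows "FU i (FU i (FU j (mon [k] * x))) - scale (qq + pp) (FU i (FU j (FU i (mon [k] * x)))) + FU j (FU i
      (FU i (mon [k] * x)))
    = mon [k] * (FU i (FU i (FU j x)) - scale (qq + pp) (FU i (FU j (FU i x))) + FU j (FU i (FU i x)))"
proof -
  have adj: "cartan i j = - 1" "cartan j i = - 1" "cartan i i = 2" "i \<noteq> j"
    using assms by (auto simp: cartan_def)
  have pw: "scale (qq\<^sup>2) a = scale qq (scale qq a)" "scale (qq powi (- 1)) a = scale pp a"
     "scale (qq powi (- 2)) a = scale pp (scale pp a)"  "scale (qq powi 1) a = scale qq a" for a :: "nat free"
    by (simp_all add: powi_simps power2_eq_square)
  show ?thesis
    using adj
    by (cases "k = i"; cases "k = j")
     (simp_all add: FU_mon_mult FU_lin KU_lin KU_FU pw algebra_simps scale.scale_left_distrib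
      scale.scale_right_distrib scale.scale_right_diff_distrib scale.scale_left_commute[of "inverse (qq - pp)"]
      del: scale.scale_scale)
qed

text \<open>The Serre element in the E is a singular vector: for k = i or k = j the terms with K
  produced by F_k cancel. Hence the ideal it generates is stable under F_k.\<close>

lemma serre_FU_aux:
  assumes "i = j + 1 \<or> j = i + 1"
  shows "FU k (serre (mon [i]) (mon [j]) * x) = serre (mon [i]) (mon [j]) * FU k x"
proof -
  have adj: "cartan i j = - 1" "cartan j i = - 1" "cartan i i = 2" "i \<noteq> j" "cartan j j = 2"
    using assms by (auto simp: cartan_def)
  have pw: "scale (qq\<^sup>2) a = scale qq (scale qq a)" "scale (qq powi (- 1)) a = scale pp a"
     "scale (qq powi (- 2)) a = scale pp (scale pp a)"  "scale (qq powi 1) a = scale qq a" for a :: "nat free"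
    by (simp_all add: powi_simps power2_eq_square)
  have "FU k (serre (mon [i]) (mon [j]) * x) = FU k (mon [i] * (mon [i] * (mon [j] * x)))
    - scale (qq + pp) (FU k (mon [i] * (mon [j] * (mon [i] * x)))) + FU k (mon [j] * (mon [i] * (mon [i] * x)))"
    by (simp add: serre_def FU_lin distrib_right left_diff_distrib mult.assoc)
  also have "\<dots> = mon [i] * (mon [i] * (mon [j] * FU k x))
    - scale (qq + pp) (mon [i] * (mon [j] * (mon [i] * FU k x))) + mon [j] * (mon [i] * (mon [i] * FU k x))"
    using adj
    by (cases "k = i"; cases "k = j")
     (simp_all add: FU_mon_mult FU_lin KU_lin KU_mult KU_mon1 pw distrib_left right_diff_distrib
         scale.scale_left_distrib
      scale.scale_right_distrib scale.scale_right_diff_distrib scale.scale_left_commute[of "inverse (qq - pp)"]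
      del: scale.scale_scale)
  also have "\<dots> = serre (mon [i]) (mon [j]) * FU k x"
    by (simp add: serre_def distrib_right left_diff_distrib mult.assoc)
  finally show ?thesis .
qed

text \<open>The Serre element in the F commutes with left multiplication by every letter
  (\<open>FU_serre_aux\<close>) and kills 1. So the F satisfy their Serre relations exactly on the
  free algebra, whereas the E do so only modulo the ideal.\<close>

lemma FU_serre:
  assumes "i = j + 1 \<or> j = i + 1"
  shows "FU i (FU i (FU j x)) - scale (qq + pp) (FU i (FU j (FU i x))) + FU j (FU i (FU i x)) = 0"
proof (induction x rule: free_induct)
  case (mon w)
  then show ?case
  proof (induction w)
    case Nil
    then show ?case by (simp add: FU_one FU_lin flip: one_eq_mon)
  next
    case (Cons k w)
    then show ?case using FU_serre_aux[OF assms, of k "mon w"] by (simp add: mon_mult)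
  qed
next
  case (add x y)
  have "FU i (FU i (FU j (x + y))) - scale (qq + pp) (FU i (FU j (FU i (x + y)))) + FU j (FU i (FU i (x + y)))
    = (FU i (FU i (FU j x)) - scale (qq + pp) (FU i (FU j (FU i x))) + FU j (FU i (FU i x)))
     + (FU i (FU i (FU j y)) - scale (qq + pp) (FU i (FU j (FU i y))) + FU j (FU i (FU i y)))"
    by (simp add: FU_lin scale.scale_right_distrib)
  then show ?case unfolding add by simp
next
  case (scale c x)
  have "FU i (FU i (FU j (scale c x))) - scale (qq + pp) (FU i (FU j (FU i (scale c x)))) + FU j (FU i (FU i
      (scale c x)))
    = scale c (FU i (FU i (FU j x)) - scale (qq + pp) (FU i (FU j (FU i x))) + FU j (FU i (FU i x)))"
    by (simp add: FU_lin scale.scale_right_distrib scale.scale_right_diff_distrib mult.commute)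
  then show ?case unfolding scale by simp
qed (simp add: FU_lin)

lemma FU_commute:
  assumes "i + 1 < j \<or> j + 1 < i"
  shows "FU i (FU j x) = FU j (FU i x)"
proof (induction x rule: free_induct)
  case (mon w)
  then show ?case
  proof (induction w)
    case Nil
    then show ?case by (simp add: FU_one FU_lin flip: one_eq_mon)
  next
    case (Cons k w)
    have "cartan i j = 0" "cartan j i = 0" "i \<noteq> j"
      using assms by (auto simp: cartan_def)
    then have "FU i (FU j (mon [k] * mon w)) = FU j (FU i (mon [k] * mon w))"
      using Cons by (cases "k = i"; cases "k = j") (simp_all add: FU_mon_mult FU_lin KU_FU)
    then show ?case by (simp add: mon_mult)
  qed
qed (simp_all add: FU_lin)

lemma commutator_FU_aux:
  assumes "i + 1 < j \<or> j + 1 < i"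
  shows "FU k ((mon [i] * mon [j] - mon [j] * mon [i]) * x) = (mon [i] * mon [j] - mon [j] * mon [i]) * FU k x"
proof -
  have adj: "cartan i j = 0" "cartan j i = 0" "i \<noteq> j"
    using assms by (auto simp: cartan_def)
  have "FU k (mon [i] * (mon [j] * x)) - FU k (mon [j] * (mon [i] * x))
      = mon [i] * (mon [j] * FU k x) - mon [j] * (mon [i] * FU k x)"
    using adj by (cases "k = i"; cases "k = j")
      (simp_all add: FU_mon_mult FU_lin KU_mult KU_mon1 algebra_simps scale.scale_right_diff_distrib)
  then show ?thesis by (simp add: left_diff_distrib FU_lin mult.assoc)
qed

lemma KU_serre:
  "KU e k (serre (mon [i]) (mon [j])) =
    scale (qq powi (e * cartan k i) * (qq powi (e * cartan k i) * qq powi (e * cartan k j))) (serre (mon [i])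
        (mon [j]))"
  by (simp add: serre_def KU_lin KU_mult KU_mon1 scale.scale_right_distrib scale.scale_right_diff_distrib
      mult.commute mult.left_commute)

lemma KU_Serre_rels: "r \<in> Serre_rels n \<Longrightarrow> \<exists>c. KU e k r = scale c r"
  by (auto simp: Serre_rels_def KU_serre KU_lin KU_mult KU_mon1 mult.commute simp flip:
      scale.scale_right_diff_distrib)

lemma FU_Serre_rels: "r \<in> Serre_rels n \<Longrightarrow> FU k (r * x) = r * FU k x"
  unfolding Serre_rels_def by (auto simp: serre_FU_aux commutator_FU_aux simp del: mult.assoc)

lemma KU_rideal: "x \<in> rideal (Serre_rels n) \<Longrightarrow> KU e k x \<in> rideal (Serre_rels n)"
proof (induction rule: rideal.induct)
  case (incl r)
  then show ?case using KU_Serre_rels[OF incl, of e k] by (metis rideal.incl rideal_scale)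
qed (auto simp: KU_lin KU_mult intro: rideal.intros)

lemma FU_rideal_lmult:
  assumes "x \<in> rideal (Serre_rels n)" "FU k x \<in> rideal (Serre_rels n)"
  shows "FU k (a * x) \<in> rideal (Serre_rels n)"
proof (induction a rule: free_induct)
  case (mon w)
  show ?case
  proof (induction w)
    case Nil
    then show ?case using assms by (simp flip: one_eq_mon)
  next
    case (Cons j w)
    have "FU k (mon [j] * (mon w * x)) \<in> rideal (Serre_rels n)"
      unfolding FU_mon_mult using Cons assms
      by (auto intro!: rideal_diff rideal.lmult rideal_scale KU_rideal rideal.zero)
    then show ?case by (simp only: mon_mult_assoc append.simps)
  qed
qed (auto simp: distrib_right FU_lin intro: rideal.intros rideal_scale)

lemma FU_rideal: "x \<in> rideal (Serre_rels n) \<Longrightarrow> FU k x \<in> rideal (Serre_rels n)"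
proof -
  assume "x \<in> rideal (Serre_rels n)"
  \<comment> \<open>Strengthened by an arbitrary right factor: F_k can be moved past a relator
    standing on the left, and this form survives multiplication on the right.\<close>
  then have "x \<in> rideal (Serre_rels n) \<and> (\<forall>b. FU k (x * b) \<in> rideal (Serre_rels n))"
  proof (induction rule: rideal.induct)
    case (lmult x a)
    then show ?case by (auto simp: mult.assoc intro: rideal.intros FU_rideal_lmult)
  next
    case (rmult x a)
    then show ?case by (auto simp: mult.assoc intro: rideal.intros)
  qed (auto simp: FU_lin FU_Serre_rels distrib_right intro: rideal.intros)
  then show ?thesis by (metis mult.right_neutral)
qed

interpretation verma: free_module scale verma
proof (intro free_module.intro free_module_axioms.intro)
  fix g show "lin (verma g)"
    by (cases g) (simp_all add: lin_KU lin_FU lin_mult_left)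
qed (rule scale.vector_space_axioms)

lemma verma_rideal: "x \<in> rideal (Serre_rels n) \<Longrightarrow> act scale verma y x \<in> rideal (Serre_rels n)"
proof (induction y rule: free_induct)
  case (mon w)
  have "verma g z \<in> rideal (Serre_rels n)" if "z \<in> rideal (Serre_rels n)" for g z
    using that by (cases g) (auto intro: rideal.lmult KU_rideal FU_rideal)
  then have "foldr verma w x \<in> rideal (Serre_rels n)"
    using mon by (induction w) auto
  then show ?case by (simp add: verma.act_mon)
qed (auto simp: verma.act_left intro: rideal.intros rideal_scale)

text \<open>Relations among the E act as left multiplication by a relator of
  \<open>Serre_rels\<close>, all others act as zero. With \<open>verma_rideal\<close> the quotient
  by the Serre ideal is thus a module of U_q(sl_n).\<close>

lemma verma_Uq_rels:
  assumes "y \<in> Uq_rels n"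
  shows "act scale verma y x \<in> rideal (Serre_rels n)"
proof -
  note a = verma.act_left verma.act_mult verma.act_mon
  have m: "act scale verma (mon [g]) z = verma g z" for g z
    by (simp add: verma.act_mon)
  have K: "KU 1 i (KU (- 1) i z) = z" "KU (- 1) i (KU 1 i z) = z" for i z
    using KU_inverse[of "- 1" i z] KU_inverse[of 1 i z] by simp_all
  note ops = verma.act_left verma.act_mult verma.act_one m serre_def
  consider
      i where "y = eK i * eKinv i - 1" | i where "y = eKinv i * eK i - 1"
    | i j where "y = eK i * eK j - eK j * eK i"
    | i j where "y = eK i * eE j * eKinv i - scale (qq powi cartan i j) (eE j)"
    | i j where "y = eK i * eF j * eKinv i - scale (qq powi (- cartan i j)) (eF j)"
    | i j where "y = eE i * eF j - eF j * eE i -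
        (if i = j then scale (inverse (qq - inverse qq)) (eK i - eKinv i) else 0)"
    | i j where "y = serre (eE i) (eE j)" "i \<in> {1..n - 1}" "j \<in> {1..n - 1}" "i = j + 1 \<or> j = i + 1"
    | i j where "y = serre (eF i) (eF j)" "i = j + 1 \<or> j = i + 1"
    | i j where "y = eE i * eE j - eE j * eE i" "i \<in> {1..n - 1}" "j \<in> {1..n - 1}" "i + 1 < j \<or> j + 1 < i"
    | i j where "y = eF i * eF j - eF j * eF i" "i + 1 < j \<or> j + 1 < i"
    using assms unfolding Uq_rels_def by blast
  then show ?thesis
  proof cases
    case (4 i j)
    then show ?thesis by (simp add: ops KU_mult KU_mon1 K KU_lin rideal.zero)
  next
    case (5 i j)
    then show ?thesis by (simp add: ops K KU_FU KU_lin rideal.zero)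
  next
    case (6 i j)
    then show ?thesis by (auto simp add: ops FU_mon_mult rideal.zero)
  next
    case (7 i j)
    have "act scale verma y x = serre (mon [i]) (mon [j]) * x"
      by (simp add: 7(1) ops distrib_right left_diff_distrib mult.assoc)
    moreover have "serre (mon [i]) (mon [j]) \<in> Serre_rels n"
      using 7 unfolding Serre_rels_def by blast
    ultimately show ?thesis by (simp add: rideal.rmult rideal.incl)
  next
    case (8 i j)
    then show ?thesis using FU_serre[OF 8(2), of x] by (simp add: ops rideal.zero)
  next
    case (9 i j)
    have "act scale verma y x = (mon [i] * mon [j] - mon [j] * mon [i]) * x"
      by (simp add: 9(1) ops distrib_right left_diff_distrib mult.assoc)
    moreover have "mon [i] * mon [j] - mon [j] * mon [i] \<in> Serre_rels n"
      using 9 unfolding Serre_rels_def by blast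
    ultimately show ?thesis by (simp add: rideal.rmult rideal.incl)
  next
    case (10 i j)
    then show ?thesis by (simp add: ops rideal.zero FU_commute[OF 10(2)])
  qed (simp_all add: ops K rideal.zero KU_commute)
qed

lemma mon_carrier: "mon l \<in> carrier (free_alg X) \<longleftrightarrow> set l \<subseteq> X"
  by (simp add: carrier_free_alg)

lemma carrier_free_alg_diff: "x \<in> carrier (free_alg X) \<Longrightarrow>
    y \<in> carrier (free_alg X) \<Longrightarrow> x - y \<in> carrier (free_alg X)"
  by (metis restrict_words_id restrict_words_carrier restrict_words_simps(5))

lemma carrier_free_alg_scale: "x \<in> carrier (free_alg X) \<Longrightarrow> scale c x \<in> carrier (free_alg X)"
  by (metis restrict_words_id restrict_words_carrier restrict_words_simps(2))

lemma carrier_free_alg_add: "x \<in> carrier (free_alg X) \<Longrightarrow>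
    y \<in> carrier (free_alg X) \<Longrightarrow> x + y \<in> carrier (free_alg X)"
  by (metis restrict_words_id restrict_words_carrier restrict_words_simps(1))

lemma carrier_free_alg_mult: "x \<in> carrier (free_alg X) \<Longrightarrow>
    y \<in> carrier (free_alg X) \<Longrightarrow> x * y \<in> carrier (free_alg X)"
  by (metis restrict_words_id restrict_words_carrier restrict_words_mult)

lemma carrier_free_alg_0_1: "0 \<in> carrier (free_alg X)" "1 \<in> carrier (free_alg X)"
  by (simp_all add: carrier_free_alg zero_word_def)

lemmas carrier_free_alg_intros = carrier_free_alg_diff carrier_free_alg_scale carrier_free_alg_add
  carrier_free_alg_mult carrier_free_alg_0_1

lemma Uq_rels_carrier: "Uq_rels n \<subseteq> carrier (Uq_free n)"
proof -
  have "serre x y \<in> carrier (free_alg X)" if "x \<in> carrier (free_alg X)" "y \<in> carrier (free_alg X)"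
    for x y :: "uq_gen free" and X
    unfolding serre_def using that by (intro carrier_free_alg_intros)
  then show ?thesis
    unfolding Uq_rels_def Uq_free_def
    by (auto intro!: carrier_free_alg_intros simp: mon_carrier)
qed

lemma Uq_ideal: "ideal (Uq_ideal n) (Uq_free n)"
  unfolding Uq_ideal_def Uq_free_def
  by (rule ring.genideal_ideal[OF ring_free_alg Uq_rels_carrier[unfolded Uq_free_def]])

section \<open>The positive part inside U_q(sl_n)\<close>

definition U_embed :: "nat free \<Rightarrow> uq_gen free" where
  "U_embed = linear_ext (\<lambda>w. mon (map GE (letters w)))"

lemma U_embed_lin: "lin U_embed"
  unfolding U_embed_def by (rule lin_linear_ext)

lemmas U_embed_simps = linD[OF U_embed_lin]

lemma U_embed_mon: "U_embed (mon l) = mon (map GE l)"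
  by (simp add: U_embed_def)

lemma U_embed_one: "U_embed 1 = 1"
  by (simp add: one_eq_mon U_embed_mon)

lemma U_embed_mult: "U_embed (x * y) = U_embed x * U_embed y"
proof (induction x rule: free_induct)
  case (mon v)
  show ?case
    by (induction y rule: free_induct) (auto simp: U_embed_simps U_embed_mon mon_mult distrib_left)
qed (auto simp: U_embed_simps distrib_right)

lemma U_embed_carrier:
  assumes "x \<in> carrier (Uplus_free n)"
  shows "U_embed x \<in> carrier (Uq_free n)"
proof -
  have "Poly_Mapping.keys x \<subseteq> {w. set (letters w) \<subseteq> {1..n - 1}}"
    using assms by (auto simp: Uplus_free_def carrier_free_alg)
  then show ?thesis
    unfolding Uq_free_def
    by (induction rule: span_basis_induct)
      (auto simp: U_embed_simps carrier_free_alg_intros U_embed_def mon_carrier)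
qed

lemma Uplus_kernel_iff_Uq_ideal:
  "x \<in> Uplus_kernel n \<longleftrightarrow> x \<in> carrier (Uplus_free n) \<and> U_embed x \<in> Uq_ideal n"
proof -
  interpret I: ideal "Uq_ideal n" "Uq_free n" by (rule Uq_ideal)
  have "(Uq_ideal n +>\<^bsub>Uq_free n\<^esub> y = Uq_ideal n) \<longleftrightarrow> y \<in> Uq_ideal n" if "y
      \<in> carrier (Uq_free n)" for y
    using that I.a_rcos_self[of y] I.a_rcos_const[of y] by auto
  then show ?thesis
    using U_embed_carrier[of x n]
    by (auto simp: Uplus_kernel_def a_kernel_def' Uplus_map_def Uq_def FactRing_def U_embed_def)
qed

lemma verma_U_embed: "act scale verma (U_embed x) y = x * y"
proof (induction x rule: free_induct)
  case (mon w)
  show ?case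
    by (induction w) (simp_all add: U_embed_mon U_embed_one verma.act_mon verma.act_one mon_mult flip:
        one_eq_mon mult.assoc)
qed (simp_all add: U_embed_simps verma.act_left distrib_right)

lemma rideal_Serre_rels_imp_genideal:
  assumes "x \<in> carrier (Uplus_free n)" "x \<in> rideal (Serre_rels n)"
  shows "Serre_rels n \<subseteq> carrier (Uplus_free n)" "x \<in> genideal (Uplus_free n) (Serre_rels n)"
proof -
  show sc: "Serre_rels n \<subseteq> carrier (Uplus_free n)"
    unfolding Serre_rels_def Uplus_free_def serre_def
    by (auto intro!: carrier_free_alg_intros simp: mon_carrier)
  have "restrict_words {1..n - 1} x \<in> genideal (free_alg {1..n - 1}) (Serre_rels n)"
    using _ sc[unfolded Uplus_free_def] assms(2)
  proof (rule rideal_imp_genideal)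
    fix r assume r: "r \<in> Serre_rels n"
    then have "restrict_words {1..n - 1} r = r"
      using sc by (intro restrict_words_id) (auto simp: Uplus_free_def)
    then show "restrict_words {1..n - 1} r \<in> genideal (free_alg {1..n - 1}) (Serre_rels n)"
      using r ring.genideal_self[OF ring_free_alg sc[unfolded Uplus_free_def]] by auto
  qed
  then show "x \<in> genideal (Uplus_free n) (Serre_rels n)"
    using assms(1) by (simp add: restrict_words_id Uplus_free_def)
qed

text \<open>If x vanishes in U_q(sl_n), it acts as zero on the module, and its value on 1 is x
  itself by \<open>verma_U_embed\<close>, so x lies in the Serre ideal. This takes the place of the
  triangular decomposition. Conversely, the Serre relations are among the relations of
  U_q(sl_n).\<close>

lemma Uplus_kernel_eq:
  "x \<in> Uplus_kernel n \<longleftrightarrow> x \<in> carrier (Uplus_free n) \<and> x \<in> rideal (Serre_rels n)"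
proof (cases "x \<in> carrier (Uplus_free n)")
  case True
  have "x \<in> rideal (Serre_rels n)" if "U_embed x \<in> Uq_ideal n"
  proof -
    have "\<forall>z. act scale verma (U_embed x) z \<in> rideal (Serre_rels n)"
      using ring_free_alg Uq_rels_carrier that[unfolded Uq_ideal_def] unfolding Uq_free_def
      by (rule genideal_induct)
        (auto simp: verma.act_left verma.act_mult verma_Uq_rels intro: verma_rideal rideal.intros)
    then show ?thesis by (metis verma_U_embed mult.right_neutral)
  qed
  moreover have "U_embed x \<in> Uq_ideal n" if "x \<in> rideal (Serre_rels n)"
  proof -
    interpret I: ideal "Uq_ideal n" "Uq_free n" by (rule Uq_ideal)
    show ?thesis
      using ring_free_alg rideal_Serre_rels_imp_genideal[OF True that, unfolded Uplus_free_def]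
    proof (rule genideal_induct)
      fix r assume "r \<in> Serre_rels n"
      then consider
          i j where "r = serre (mon [i]) (mon [j])" "i \<in> {1..n - 1}" "j \<in> {1..n - 1}" "i = j + 1 \<or> j
              = i + 1"
        | i j where "r = mon [i] * mon [j] - mon [j] * mon [i]" "i \<in> {1..n - 1}" "j \<in> {1..n - 1}"
            "i + 1 < j \<or> j + 1 < i"
        unfolding Serre_rels_def by blast
      then have "U_embed r \<in> Uq_rels n"
      proof cases
        case (1 i j)
        have "U_embed r = serre (eE i) (eE j)"
          by (simp add: 1(1) serre_def U_embed_simps U_embed_mult U_embed_mon)
        then show ?thesis using 1(2-) unfolding Uq_rels_def by blast
      next
        case (2 i j)
        have "U_embed r = eE i * eE j - eE j * eE i"
          by (simp add: 2(1) U_embed_simps U_embed_mult U_embed_mon)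
        then show ?thesis using 2(2-) unfolding Uq_rels_def by blast
      qed
      then show "U_embed r \<in> Uq_ideal n"
        using ring.genideal_self[OF ring_free_alg Uq_rels_carrier[unfolded Uq_free_def]]
        unfolding Uq_ideal_def Uq_free_def by blast
    next
      fix a y assume *: "a \<in> carrier (free_alg {1..n - 1})" "U_embed y \<in> Uq_ideal n"
      then show "U_embed (a \<otimes>\<^bsub>free_alg {1..n - 1}\<^esub> y) \<in> Uq_ideal n"
          "U_embed (y \<otimes>\<^bsub>free_alg {1..n - 1}\<^esub> a) \<in> Uq_ideal n"
        using I.I_l_closed[of "U_embed y" "U_embed a"] I.I_r_closed[of "U_embed y" "U_embed a"]
          U_embed_carrier[of a n]
        by (simp_all add: U_embed_mult Uq_free_def Uplus_free_def)
    next
      fix y z assume "U_embed y \<in> Uq_ideal n" "U_embed z \<in> Uq_ideal n"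
      then show "U_embed (y \<oplus>\<^bsub>free_alg {1..n - 1}\<^esub> z) \<in> Uq_ideal n"
        using additive_subgroup.a_closed[OF I.additive_subgroup_axioms, of "U_embed y" "U_embed z"]
        by (simp add: U_embed_simps Uq_free_def)
    qed (use additive_subgroup.zero_closed[OF I.additive_subgroup_axioms] in
        \<open>simp add: U_embed_simps Uq_free_def\<close>)
  qed
  ultimately show ?thesis using True by (auto simp: Uplus_kernel_iff_Uq_ideal)
qed (simp add: Uplus_kernel_iff_Uq_ideal)

section \<open>Lowest weight vectors for the Serre relations\<close>

text \<open>An action of the positive part for indices 1, 2, ... without upper bound, matching the
  algebra with all u_i; index 0 acts by zero, so that no lower bound on indices has to be carried
  along.\<close>

locale serre_module = vector_space s for s :: "Cq \<Rightarrow> 'b \<Rightarrow> 'b::ab_group_add" +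
  fixes E :: "nat \<Rightarrow> 'b \<Rightarrow> 'b"
  assumes linE: "Vector_Spaces.linear s s (E i)"
    and E_serre: "i = j + 1 \<or> j = i + 1 \<Longrightarrow>
      E i (E i (E j x)) - s (qq + pp) (E i (E j (E i x))) + E j (E i (E i x)) = 0"
    and E_commute: "i + 1 < j \<or> j + 1 < i \<Longrightarrow> E i (E j x) = E j (E i x)"
    and E_0: "E 0 x = 0"
begin

abbreviation "d \<equiv> qq + pp"

lemma E_lin: "E i (x + y) = E i x + E i y" "E i (x - y) = E i x - E i y" "E i (s c x) = s c (E i x)" "E i 0 = 0"
  using linE[of i] unfolding module_hom_iff_linear[symmetric]
  by (auto simp: module_hom.add module_hom.diff module_hom.scale module_hom.zero)

lemma E_sq: "E i y = 0 \<Longrightarrow> i = j + 1 \<or> j = i + 1 \<Longrightarrow> E i (E i (E j y)) = 0"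
  using E_serre[of i j y] by (simp add: E_lin)

lemma E_sandwich:
  "E j y = 0 \<Longrightarrow> E i (E i y) = 0 \<Longrightarrow> i = j + 1 \<or> j = i + 1 \<Longrightarrow>
      E i (E j (E i y)) = 0"
  using E_serre[of i j y] by (simp add: E_lin)

text \<open>E_k raises an index k - 1 to k. Starting from the pair of indices 1, 0,
  \<open>col\<close> raises the larger one to a + 1, and \<open>row\<close> then raises the smaller
  one to b.\<close>

primrec col :: "'b \<Rightarrow> nat \<Rightarrow> 'b" where
  "col x 0 = x"
| "col x (Suc a) = E (a + 2) (col x a)"

primrec row :: "'b \<Rightarrow> nat \<Rightarrow> 'b" where
  "row y 0 = y"
| "row y (Suc b) = E (b + 1) (row y b)"

end

text \<open>The vectors \<open>row (col x a) b\<close> with \<open>b \<le> a\<close> are those with indices \<open>a + 1 > b\<close> in the symmetric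
  or exterior square, generated from the vector \<open>x\<close> with indices \<open>1, 0\<close>.\<close>

locale serre_chain = serre_module +
  fixes x
  assumes E_ge3: "k \<ge> 3 \<Longrightarrow> E k x = 0" and E2: "E 2 (E 2 x) = 0" and E112: "E 1 (E 1 (E 2 x)) = 0"
begin

lemma col_high: "k \<ge> a + 3 \<Longrightarrow> E k (col x a) = 0"
  by (induction a) (auto simp: E_ge3 E_commute[of k] E_lin)

lemma col_sq: "E (a + 2) (E (a + 2) (col x a)) = 0"
proof (cases a)
  case (Suc b)
  show ?thesis unfolding Suc col.simps by (rule E_sq) (auto intro: col_high)
qed (use E2 in \<open>simp add: numeral_2_eq_2\<close>)

lemma col_mid: "2 \<le> k \<Longrightarrow> k \<le> a + 1 \<Longrightarrow> E k (col x a) = 0"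
proof (induction a arbitrary: k)
  case (Suc a)
  consider "k = a + 2" | "k = a + 1" | "k \<le> a" using Suc.prems by linarith
  then show ?case
  proof cases
    case 1
    then show ?thesis using col_sq[of a] by simp
  next
    case 2
    then obtain b where a: "a = Suc b" using Suc.prems by (cases a) auto
    have "E (b + 2) (E (b + 3) (E (b + 2) (col x b))) = 0"
      by (rule E_sandwich) (auto simp: col_high col_sq[simplified])
    then show ?thesis using 2 by (simp add: a eval_nat_numeral)
  next
    case 3
    then show ?thesis using Suc by (simp add: E_commute[of k "Suc (Suc a)"] E_lin)
  qed
qed auto

lemma col_1: "E 1 (E 1 (col x (Suc a))) = 0"
proof (induction a)
  case 0
  then show ?case using E112 by (simp add: numeral_2_eq_2)
next
  case (Suc a)
  have "E 1 (E (a + 3) y) = E (a + 3) (E 1 y)" for y by (rule E_commute) simp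
  then show ?case using Suc by (simp add: E_lin eval_nat_numeral)
qed

lemma row_high: "b \<le> a \<Longrightarrow> k \<ge> b + 2 \<Longrightarrow> k \<noteq> a + 2 \<Longrightarrow>
    E k (row (col x a) b) = 0"
proof (induction b)
  case 0
  then show ?case using col_mid[of k a] col_high[of a k] by (cases "k \<le> a + 1") auto
next
  case (Suc b)
  then show ?case by (simp add: E_commute[of k "Suc b"] E_lin)
qed

lemma row_sq: "b < a \<Longrightarrow> E (b + 1) (E (b + 1) (row (col x a) b)) = 0"
proof (cases b)
  case 0
  assume "b < a"
  then show ?thesis using col_1[of "a - 1"] 0 by simp
next
  case (Suc c)
  assume "b < a"
  then show ?thesis unfolding Suc row.simps by (intro E_sq) (auto intro: row_high)
qed

lemma row_mid: "1 \<le> k \<Longrightarrow> k \<le> b \<Longrightarrow> b \<le> a \<Longrightarrow>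
    E k (row (col x a) b) = 0"
proof (induction b arbitrary: k)
  case (Suc b)
  consider "k = b + 1" | "k = b" | "k < b" using Suc.prems by linarith
  then show ?case
  proof cases
    case 1
    then show ?thesis using row_sq[of b a] Suc.prems by simp
  next
    case 2
    then obtain c where b: "b = Suc c" using Suc.prems by (cases b) auto
    have "E (c + 1) (E (c + 2) (E (c + 1) (row (col x a) c))) = 0"
      using Suc.prems 2 b row_sq[of c a] by (intro E_sandwich) (auto intro!: row_high)
    then show ?thesis using 2 by (simp add: b eval_nat_numeral)
  next
    case 3
    then show ?thesis using Suc by (simp add: E_commute[of k "Suc b"] E_lin)
  qed
qed auto

lemma row_col: "b \<le> a \<Longrightarrow> E (a + 2) (row (col x a) b) = row (col x (Suc a)) b"
proof (induction b)
  case (Suc b)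
  then show ?case using E_commute[of "a + 2" "b + 1"] by simp
qed simp

lemma row_zero:
  assumes "b \<le> a" "k \<noteq> b + 1" "k \<noteq> a + 2"
  shows "E k (row (col x a) b) = 0"
proof -
  consider "k = 0" | "1 \<le> k \<and> k \<le> b" | "k \<ge> b + 2" using assms(2) by linarith
  then show ?thesis using assms row_mid row_high E_0 by cases auto
qed

text \<open>The hypothesis singles out the exterior square: a vector with indices a + 1, a would be
  sent to one with two equal indices. The induction step is \<open>E_sandwich\<close> for E_(a+2)
  and E_(a+1).\<close>

lemma row_diag:
  assumes "E 1 x = 0"
  shows "E (a + 1) (row (col x a) a) = 0"
proof (induction a)
  case (Suc a)
  let ?y = "row (col x a) a"
  have 1: "row (col x (Suc a)) (Suc a) = E (a + 1) (E (a + 2) ?y)"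
    using row_col[of a a] by simp
  have "E (a + 2) (E (a + 2) ?y) = 0"
    unfolding row_col[OF order_refl] by (rule row_high) auto
  then show ?case using E_sandwich[of "a + 1" ?y "a + 2"] Suc unfolding 1 by simp
qed (use assms in simp)

end

text \<open>Lowest weight vectors \<open>w\<close> and \<open>l\<close> of the symmetric and the exterior square generate a copy of
  \<open>V \<otimes> V\<close>, with basis \<open>Y a b\<close>. The index \<open>a\<close> stands for the basis vector \<open>v\<^sub>n\<^sub>-\<^sub>a\<close> of \<open>V\<close>.\<close>

locale tensor_square = serre_module +
  fixes w l
  assumes w: "k \<noteq> 1 \<Longrightarrow> E k w = 0" and w3: "E 1 (E 1 (E 1 w)) = 0"
    and l: "k \<noteq> 2 \<Longrightarrow> E k l = 0" and l2: "E 2 (E 2 l) = 0"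
begin

text \<open>The Serre relation at w and at E_1 w gives d X = Z and X = d Z with d = q + q^-1, and
  d^2 - 1 = q^2 + 1 + q^-2 is nonzero.\<close>

lemma E11211: "E 1 (E 1 (E 2 (E 1 w))) = 0"
proof -
  let ?X = "E 1 (E 1 (E 2 (E 1 w)))" and ?Z = "E 1 (E 2 (E 1 (E 1 w)))"
  have "s d (E 1 (E 2 (E 1 w))) = E 2 (E 1 (E 1 w))"
    using E_serre[of 1 2 w] w[of 2] by (simp add: E_lin)
  then have "E 1 (s d (E 1 (E 2 (E 1 w)))) = E 1 (E 2 (E 1 (E 1 w)))" by simp
  then have 1: "s d ?X = ?Z" by (simp add: E_lin)
  have 2: "?X = s d ?Z"
    using E_serre[of 1 2 "E 1 w"] w3 by (simp add: E_lin)
  have "s (d * d - 1) ?X = 0"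
    using 1 2 by (simp add: scale_left_diff_distrib flip: scale_scale)
  moreover have "d * d - 1 \<noteq> 0"
    using qq_sq_nonzero(3) by (simp add: field_simps)
  ultimately show ?thesis by simp
qed

text \<open>E_1 w is the symmetric vector with indices 1, 0, where the chain begins; w itself begins
  the diagonal.\<close>

sublocale S: serre_chain s E "E 1 w"
proof
  fix k :: nat assume "3 \<le> k"
  then show "E k (E 1 w) = 0" using E_commute[of k 1 w] w[of k] by (simp add: E_lin)
next
  show "E 2 (E 2 (E 1 w)) = 0" by (rule E_sq) (use w[of 2] in auto)
qed (rule E11211)

sublocale L: serre_chain s E l
proof
  show "E 1 (E 1 (E 2 l)) = 0" by (rule E_sq) (use l[of 1] in auto)
qed (use l l2 in auto)

text \<open>By \<open>E_diag\<close> this is the divided power E_(a+1)^2 / (q + q^-1) applied to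
  \<open>diag a\<close>, normalised as in V \<otimes> V, where E_(a+1)^2 takes the square of a basis
  vector to q + q^-1 times the square of the next.\<close>

primrec diag :: "nat \<Rightarrow> 'a" where
  "diag 0 = w"
| "diag (Suc a) = s (inverse d) (E (a + 1) (row (col (E 1 w) a) a))"

lemma diag_high: "k \<ge> a + 2 \<Longrightarrow> E k (diag a) = 0"
  by (cases a) (auto simp: w E_lin E_commute[of k] S.row_high simp del: One_nat_def)

lemma E_diag: "E (a + 1) (diag a) = row (col (E 1 w) a) a"
proof (induction a)
  case (Suc a)
  have "E (a + 2) (E (a + 1) (E (a + 1) (diag a))) = s d (E (a + 1) (E (a + 2) (E (a + 1) (diag a))))"
    using E_serre[of "a + 1" "a + 2" "diag a"] diag_high[of a "a + 2"]
    by (simp add: E_lin algebra_simps eq_neg_iff_add_eq_0)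
  then have "E (a + 2) (E (a + 1) (row (col (E 1 w) a) a)) = s d (row (col (E 1 w) (Suc a)) (Suc a))"
    unfolding Suc S.row_col[OF order_refl] by simp
  then show ?case by (simp add: E_lin)
qed simp

lemma E_diag3: "E (a + 1) (E (a + 1) (E (a + 1) (diag a))) = 0"
proof (cases a)
  case 0
  then show ?thesis using w3 by simp
next
  case (Suc b)
  let ?y = "row (col (E 1 w) b) b"
  have "E (b + 2) (E (b + 2) ?y) = 0"
    unfolding S.row_col[OF order_refl] by (rule S.row_high) auto
  then have "E (b + 2) (E (b + 2) (E (b + 1) (E (b + 2) ?y))) = 0"
    by (intro E_sq) auto
  moreover have "row (col (E 1 w) (Suc b)) (Suc b) = E (b + 1) (E (b + 2) ?y)"
    using S.row_col[of b b] by simp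
  ultimately show ?thesis unfolding E_diag unfolding Suc by simp
qed

lemma diag_low: "1 \<le> k \<Longrightarrow> k \<le> a \<Longrightarrow> E k (diag a) = 0"
proof (cases a)
  case (Suc b)
  assume k: "1 \<le> k" "k \<le> a"
  let ?y = "row (col (E 1 w) b) b"
  consider "k = b + 1" | "k = b" | "k < b" using k Suc by linarith
  then have "E k (E (b + 1) ?y) = 0"
  proof cases
    case 1
    then show ?thesis using E_diag3[of b] E_diag[of b] by simp
  next
    case 2
    then obtain c where b: "b = Suc c" using k by (cases b) auto
    have "E (c + 2) (row (col (E 1 w) b) c) = 0"
      by (rule S.row_high) (use b in auto)
    then have "E (c + 1) (E (c + 2) (E (c + 1) (row (col (E 1 w) b) c))) = 0"
      by (rule E_sandwich) (use b S.row_sq[of c b] in auto)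
    then show ?thesis using 2 by (simp add: b)
  next
    case 3
    then show ?thesis using k E_commute[of k "b + 1" ?y] S.row_mid[of k b b] by (simp add: E_lin)
  qed
  then show ?thesis using Suc by (simp add: E_lin)
qed auto

lemma diag_zero: "k \<noteq> a + 1 \<Longrightarrow> E k (diag a) = 0"
proof -
  assume "k \<noteq> a + 1"
  then consider "k = 0" | "1 \<le> k \<and> k \<le> a" | "k \<ge> a + 2" by linarith
  then show ?thesis using diag_low diag_high E_0 by cases auto
qed

definition sym :: "nat \<Rightarrow> nat \<Rightarrow> 'a" where
  "sym a b = row (col (E 1 w) (a - 1)) b"

definition alt :: "nat \<Rightarrow> nat \<Rightarrow> 'a" where
  "alt a b = row (col l (a - 1)) b"

text \<open>Solves, for a > b, the equations \<open>sym a b\<close> = \<open>Y a b\<close> + q^-1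
  \<open>Y b a\<close> and \<open>alt a b\<close> = \<open>Y a b\<close> - q \<open>Y b a\<close>,
  which hold for the symmetric and exterior vectors in V \<otimes> V.\<close>

definition Y :: "nat \<Rightarrow> nat \<Rightarrow> 'a" where
  "Y a b = (if a = b then diag a
     else if b < a then s (inverse d) (s qq (sym a b) + s pp (alt a b))
     else s (inverse d) (sym b a - alt b a))"

lemma E_sym:
  assumes "b < a"
  shows "E k (sym a b) = (if k = a + 1 then sym (a + 1) b else if k = b + 1 then (if k
      = a then s d (diag a) else sym a (b + 1)) else 0)"
proof -
  obtain c where a: "a = Suc c" using assms by (cases a) auto
  show ?thesis
    using assms S.row_col[of b c] S.row_zero[of b c k] unfolding sym_def a by auto
qed

lemma E_alt:
  assumes "b < a"
  shows "E k (alt a b) = (if k = a + 1 then alt (a + 1) b else if k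
      = b + 1 \<and> k \<noteq> a then alt a (b + 1) else 0)"
proof -
  obtain c where a: "a = Suc c" using assms by (cases a) auto
  show ?thesis
    using assms L.row_col[of b c] L.row_zero[of b c k] L.row_diag[of c] l[of 1] unfolding alt_def a by auto
qed

lemma E_Y: "E k (Y a b) = (if k = a + 1 then Y k b else 0) +
    (if k = b + 1 then s (qq powi (of_bool (a = k) - of_bool (a + 1 = k))) (Y a k) else 0)"
proof -
  have dd: "inverse d * d = 1" "s (inverse d) (s d x) = x" for x by simp_all
  consider "a = b" | "b < a" | "a < b" by linarith
  then show ?thesis
  proof cases
    case 1
    have "sym (a + 1) a = s (inverse d) (s qq (sym (a + 1) a) + s pp (alt (a + 1) a))
        + s pp (s (inverse d) (sym (a + 1) a - alt (a + 1) a))"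
    proof -
      have "s (inverse d) (s qq (sym (a + 1) a) + s pp (alt (a + 1) a))
        + s pp (s (inverse d) (sym (a + 1) a - alt (a + 1) a)) = s (inverse d) (s d (sym (a + 1) a))"
        by (simp only: scale_left_distrib scale_right_distrib scale_right_diff_distrib
            scale_left_commute[of pp "inverse d"]) simp
      then show ?thesis unfolding dd by simp
    qed
    then show ?thesis using 1 diag_zero[of k a] E_diag[of a]
      by (auto simp: Y_def sym_def power_int_minus)
  next
    case 2
    then show ?thesis
      by (auto simp: Y_def E_lin E_sym E_alt scale_left_commute[of _ qq] simp del: scale_scale simp: dd)
  next
    case 3
    then show ?thesis
      by (auto simp: Y_def E_lin E_sym E_alt simp del: scale_scale simp: dd)
  qed
qed

lemma Y_00: "Y 0 0 = w"
  by (simp add: Y_def)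

lemma Y_alt: "Y 1 0 - s qq (Y 0 1) = l"
proof -
  have "Y 1 0 - s qq (Y 0 1) = s (inverse d) (s d l)"
    by (simp add: Y_def sym_def alt_def scale_left_distrib scale_right_distrib scale_right_diff_distrib
        scale_left_commute[of qq "inverse d"] del: scale_scale)
  then show ?thesis by simp
qed

end

section \<open>The presented algebra\<close>

text \<open>All the algebras \<^term>\<open>pres_alg n\<close> are subalgebras of a single one, in which the \<open>u\<^sub>i\<close> exist
  for all \<open>i\<close>: the relations are homogeneous, so the \<open>u\<^sub>i\<close> with \<open>i \<ge> n\<close> can be set to \<open>0\<close>.\<close>

definition prels :: "nat set \<Rightarrow> (nat \<Rightarrow> pgen free) \<Rightarrow> pgen free set" where
  "prels I u =
     {bracket pp (u i) (bracket qq (u i) (u j)) | i j. i \<in> I \<and> j \<in> I \<and> (i = j + 1 \<or> j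
         = i + 1)} \<union>
     {u i * u j - u j * u i | i j. i \<in> I \<and> j \<in> I \<and> (i + 1 < j \<or> j + 1 < i)} \<union>
     {u i * ww - ww * u i | i. i \<in> I \<and> i \<noteq> 1} \<union>
     {u i * zz - zz * u i | i. i \<in> I \<and> i \<noteq> 2} \<union>
     {zz * ww - ww * zz,
      bracket (pp ^ 2) (u 1) (bracket (qq ^ 2) (u 1) (bracket 1 (u 1) ww)),
      bracket pp (u 2) (bracket qq (u 2) zz),
      bracket (pp ^ 2) ww (bracket (qq ^ 2) ww (u 1)) + scale hh (ww * zz),
      bracket qq zz (bracket qq (u 2) (bracket (qq ^ 2) (u 1) ww))
        - bracket (qq ^ 2) ww (bracket qq (u 1) (bracket qq (u 2) zz)),
      scale 2 (bracket pp zz (bracket qq zz (u 2)))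
        - scale hh
           (zz * bracket qq (u 1) (u 2) * ww
            + ww * bracket pp (u 2) (u 1) * zz
            + ww * u 1 * bracket qq zz (u 2)
            + bracket pp (u 2) zz * u 1 * ww)}"

lemma pres_rels_eq: "pres_rels n = prels {1..n - 1} (uu n)"
  unfolding pres_rels_def prels_def ..

abbreviation ug :: "nat \<Rightarrow> pgen free" where
  "ug i \<equiv> mon [GU i]"

text \<open>\<open>GU 0\<close> is a letter of the type but no generator of any presentation; it is
  made a relator, so that \<open>pu 0\<close> = 0.\<close>

definition all_rels :: "pgen free set" where
  "all_rels = insert (ug 0) (prels {1..} ug)"

lemma prels_cases:
  assumes "r \<in> prels I u"
  obtains
      i j where "r = bracket pp (u i) (bracket qq (u i) (u j))" "i \<in> I" "j \<in> I" "i = j + 1 \<or> j = i + 1"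
    | i j where "r = u i * u j - u j * u i" "i \<in> I" "j \<in> I" "i + 1 < j \<or> j + 1 < i"
    | i where "r = u i * ww - ww * u i" "i \<in> I" "i \<noteq> 1"
    | i where "r = u i * zz - zz * u i" "i \<in> I" "i \<noteq> 2"
    | "r = zz * ww - ww * zz"
    | "r = bracket (pp ^ 2) (u 1) (bracket (qq ^ 2) (u 1) (bracket 1 (u 1) ww))"
    | "r = bracket pp (u 2) (bracket qq (u 2) zz)"
    | "r = bracket (pp ^ 2) ww (bracket (qq ^ 2) ww (u 1)) + scale hh (ww * zz)"
    | "r = bracket qq zz (bracket qq (u 2) (bracket (qq ^ 2) (u 1) ww))
        - bracket (qq ^ 2) ww (bracket qq (u 1) (bracket qq (u 2) zz))"
    | "r = scale 2 (bracket pp zz (bracket qq zz (u 2)))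
        - scale hh
           (zz * bracket qq (u 1) (u 2) * ww
            + ww * bracket pp (u 2) (u 1) * zz
            + ww * u 1 * bracket qq zz (u 2)
            + bracket pp (u 2) zz * u 1 * ww)"
  using assms unfolding prels_def by blast

lemma prelsI:
  "i \<in> I \<Longrightarrow> j \<in> I \<Longrightarrow> i = j + 1 \<or> j = i + 1 \<Longrightarrow>
      bracket pp (u i) (bracket qq (u i) (u j)) \<in> prels I u"
  "i \<in> I \<Longrightarrow> j \<in> I \<Longrightarrow> i + 1 < j \<or> j + 1 < i \<Longrightarrow>
      u i * u j - u j * u i \<in> prels I u"
  "i \<in> I \<Longrightarrow> i \<noteq> 1 \<Longrightarrow> u i * ww - ww * u i \<in> prels I u"
  "i \<in> I \<Longrightarrow> i \<noteq> 2 \<Longrightarrow> u i * zz - zz * u i \<in> prels I u"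
  unfolding prels_def by blast+

section \<open>The weight grading of the presented algebra\<close>

definition wtp :: "nat \<Rightarrow> pgen \<Rightarrow> int" where
  "wtp k g = (case g of GU j \<Rightarrow> cartan k j | GW \<Rightarrow> - 2 * of_bool (k
      = 1) | GZ \<Rightarrow> - of_bool (k = 2))"

definition kfree :: "nat \<Rightarrow> pgen free \<Rightarrow> pgen free" where
  "kfree k = linear_ext (\<lambda>v. scale (qq powi (\<Sum>g\<leftarrow>letters v. wtp k g)) (basis v))"

lemma kfree_lin: "lin (kfree k)"
  unfolding kfree_def by (rule lin_linear_ext)

lemmas kfree_simps = linD[OF kfree_lin]

lemma kfree_mult: "kfree k (x * y) = kfree k x * kfree k y"
proof (induction x rule: free_induct)
  case (mon v)
  show ?case
    by (induction y rule: free_induct)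
      (auto simp: kfree_def mon_mult distrib_left distrib_left power_int_add)
qed (auto simp: kfree_simps distrib_right)

lemma kfree_mon1: "kfree k (mon [g]) = scale (qq powi (wtp k g)) (mon [g])"
  by (simp add: kfree_def)

lemma kfree_one: "kfree k 1 = 1"
  by (simp add: kfree_def one_eq_mon)

definition homog :: "nat \<Rightarrow> int \<Rightarrow> pgen free \<Rightarrow> bool" where
  "homog k m x \<longleftrightarrow> kfree k x = scale (qq powi m) x"

lemma homog_mon: "homog k (wtp k g) (mon [g])"
  by (simp add: homog_def kfree_mon1)

lemma homog_mult: "homog k m x \<Longrightarrow> homog k m' y \<Longrightarrow> homog k (m + m') (x * y)"
  by (simp add: homog_def kfree_mult power_int_add)

lemma homog_scale: "homog k m x \<Longrightarrow> homog k m (scale c x)"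
  by (simp add: homog_def kfree_simps mult.commute)

lemma homog_add: "homog k m x \<Longrightarrow> homog k m' y \<Longrightarrow> m = m' \<Longrightarrow>
    homog k m (x + y)"
  by (simp add: homog_def kfree_simps scale.scale_right_distrib)

lemma homog_diff: "homog k m x \<Longrightarrow> homog k m' y \<Longrightarrow> m = m' \<Longrightarrow>
    homog k m (x - y)"
  by (simp add: homog_def kfree_simps scale.scale_right_diff_distrib)

lemma homog_bracket: "homog k m x \<Longrightarrow> homog k m' y \<Longrightarrow> homog k (m + m') (bracket v x y)"
  unfolding bracket_def
  using homog_diff[OF homog_mult homog_scale[OF homog_mult], of k m x m' y m' y m x v] by simp

text \<open>z has the weight of u_1 w, as v_(n-1) \<otimes> v_n has that of E_(n-1) (v_n \<otimes>
  v_n). This makes the relators homogeneous that compare w w u_1 with w z or z z u_2 with z u_1 u_2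
  w.\<close>

lemma wtp_z: "k \<ge> 1 \<Longrightarrow> wtp k GZ = wtp k (GU 1) + wtp k GW"
  by (auto simp: wtp_def cartan_def)

lemma all_rels_homog:
  assumes "k \<ge> 1" "r \<in> all_rels"
  shows "\<exists>m. homog k m r"
proof (cases "r = ug 0")
  case True
  then show ?thesis using homog_mon by blast
next
  case False
  then have "r \<in> prels {1..} ug" using assms by (simp add: all_rels_def)
  then show ?thesis
    by (cases rule: prels_cases)
      (hypsubst, rule exI, ((rule homog_bracket homog_diff homog_add homog_scale homog_mult homog_mon
        | simp add: wtp_z[OF assms(1)])+)[1])+
qed

lemma kfree_rideal:
  assumes "k \<ge> 1" "x \<in> rideal all_rels" shows "kfree k x \<in> rideal all_rels"
  using assms(2)
proof (induction rule: rideal.induct)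
  case (incl r)
  then show ?case
    using all_rels_homog[OF assms(1) incl] rideal_scale[OF rideal.incl[OF incl]] by (auto simp: homog_def)
qed (auto simp: kfree_simps kfree_mult intro: rideal.intros)

\<comment> \<open>A type cannot depend on n, so the quotient is taken once with all u_i present.
  That each \<open>pres_alg n\<close> embeds in it is
  \<open>cls_eq_0_imp_pres_ideal\<close>.\<close>
quotient_type palg = "pgen free" / "\<lambda>x y. x - y \<in> rideal all_rels"
proof (rule equivpI)
  show "reflp (\<lambda>x y. x - y \<in> rideal all_rels)"
    by (rule reflpI) (simp add: rideal.zero)
  show "symp (\<lambda>x y. x - y \<in> rideal all_rels)"
    by (rule sympI) (metis minus_diff_eq rideal_uminus)
  show "transp (\<lambda>x y. x - y \<in> rideal all_rels)"
  proof (rule transpI)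
    fix x y z :: "pgen free"
    assume "x - y \<in> rideal all_rels" "y - z \<in> rideal all_rels"
    from rideal.add[OF this] show "x - z \<in> rideal all_rels" by simp
  qed
qed

lift_definition psc :: "Cq \<Rightarrow> palg \<Rightarrow> palg" is scale
  by (metis rideal_scale scale.scale_right_diff_distrib)

instantiation palg :: "{ring, monoid_mult}"
begin

lift_definition zero_palg :: palg is 0 .
lift_definition one_palg :: palg is 1 .
lift_definition plus_palg :: "palg \<Rightarrow> palg \<Rightarrow> palg" is "(+)"
proof -
  fix a b c d :: "pgen free"
  assume "a - b \<in> rideal all_rels" "c - d \<in> rideal all_rels"
  from rideal.add[OF this] show "a + c - (b + d) \<in> rideal all_rels"
    by (simp add: algebra_simps)
qed
lift_definition minus_palg :: "palg \<Rightarrow> palg \<Rightarrow> palg" is "(-)"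
proof -
  fix a b c d :: "pgen free"
  assume "a - b \<in> rideal all_rels" "c - d \<in> rideal all_rels"
  from rideal_diff[OF this] show "a - c - (b - d) \<in> rideal all_rels"
    by (simp add: algebra_simps)
qed
lift_definition uminus_palg :: "palg \<Rightarrow> palg" is uminus
  by (metis minus_diff_minus rideal_uminus)
lift_definition times_palg :: "palg \<Rightarrow> palg \<Rightarrow> palg" is "(*)"
proof -
  fix a b c d :: "pgen free"
  assume "a - b \<in> rideal all_rels" "c - d \<in> rideal all_rels"
  then have "(a - b) * c + b * (c - d) \<in> rideal all_rels"
    by (intro rideal.add rideal.lmult rideal.rmult)
  then show "a * c - b * d \<in> rideal all_rels"
    by (simp add: algebra_simps)
qed

instance
  by standard (transfer, simp add: rideal.zero algebra_simps)+

end

interpretation psc: vector_space psc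
proof
  fix a b and x y :: palg
  show "psc a (x + y) = psc a x + psc a y"
    by (induction x rule: palg.abs_induct, induction y rule: palg.abs_induct)
      (simp add: psc.abs_eq plus_palg.abs_eq scale.scale_right_distrib)
  show "psc (a + b) x = psc a x + psc b x" "psc a (psc b x) = psc (a * b) x" "psc 1 x = x"
    by (induction x rule: palg.abs_induct; simp add: psc.abs_eq plus_palg.abs_eq scale.scale_left_distrib)+
qed

lemma psc_mult_left [simp]: "psc c x * y = psc c (x * y)"
  by (induction x rule: palg.abs_induct, induction y rule: palg.abs_induct)
    (simp add: psc.abs_eq times_palg.abs_eq)

lemma psc_mult_right [simp]: "x * psc c y = psc c (x * y)"
  by (induction x rule: palg.abs_induct, induction y rule: palg.abs_induct)
    (simp add: psc.abs_eq times_palg.abs_eq)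

abbreviation cls :: "pgen free \<Rightarrow> palg" where
  "cls \<equiv> abs_palg"

lemma cls_simps: "cls (x + y) = cls x + cls y" "cls (x - y) = cls x - cls y" "cls (x * y) = cls x * cls y"
    "cls 0 = 0" "cls 1 = 1" "cls (scale c x) = psc c (cls x)"
  by (simp_all add: plus_palg.abs_eq minus_palg.abs_eq times_palg.abs_eq zero_palg_def one_palg_def psc.abs_eq)

lemma cls_eq_0_iff: "cls x = 0 \<longleftrightarrow> x \<in> rideal all_rels"
  by (simp add: zero_palg_def palg.abs_eq_iff)

definition pu :: "nat \<Rightarrow> palg" where "pu k = cls (ug k)"
definition pw :: palg where "pw = cls ww"
definition pz :: palg where "pz = cls zz"

text \<open>The relators are not homogeneous for index 0, since \<open>cartan 0 1\<close> = -1;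
  there the identity is used, which keeps \<open>kap\<close> a ring endomorphism for every
  index.\<close>

lift_definition kap :: "nat \<Rightarrow> palg \<Rightarrow> palg" is "\<lambda>k. if k
    = 0 then (\<lambda>x. x) else kfree k"
  using kfree_rideal by (auto simp flip: kfree_simps(5))

lemma kap_simps: "kap k (x + y) = kap k x + kap k y" "kap k (x - y) = kap k x - kap k y"
  "kap k (x * y) = kap k x * kap k y" "kap k (psc c x) = psc c (kap k x)" "kap k 0 = 0" "kap k 1 = 1"
proof -
  show "kap k (x + y) = kap k x + kap k y"
    by transfer (simp add: kfree_simps rideal.zero)
  show "kap k (x - y) = kap k x - kap k y"
    by transfer (simp add: kfree_simps rideal.zero)
  show "kap k (x * y) = kap k x * kap k y"
    by transfer (simp add: kfree_mult rideal.zero)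
  show "kap k (psc c x) = psc c (kap k x)"
    by transfer (simp add: kfree_simps rideal.zero)
  show "kap k 0 = 0"
    by transfer (simp add: kfree_simps rideal.zero)
  show "kap k 1 = 1"
    by transfer (simp add: kfree_one rideal.zero)
qed

lemma kap_pu: "k \<ge> 1 \<Longrightarrow> kap k (pu j) = psc (qq powi cartan k j) (pu j)"
  by (simp add: pu_def kap.abs_eq psc.abs_eq kfree_mon1 wtp_def)

lemma kap_pw: "k \<ge> 1 \<Longrightarrow> kap k pw = psc (qq powi (- 2 * of_bool (k = 1))) pw"
  by (simp add: pw_def kap.abs_eq psc.abs_eq kfree_mon1 wtp_def)

lemma kap_pz: "k \<ge> 1 \<Longrightarrow> kap k pz = psc (qq powi (- of_bool (k = 2))) pz"
  by (simp add: pz_def kap.abs_eq psc.abs_eq kfree_mon1 wtp_def)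

lemma kap_kap: "kap i (kap j x) = kap j (kap i x)"
proof -
  have "kfree i (kfree j x) = kfree j (kfree i x)" for x
    by (induction x rule: free_induct) (simp_all add: kfree_simps, simp add: kfree_def mult.commute)
  then show ?thesis by transfer (simp add: rideal.zero)
qed

lemma cls_all_rels: "r \<in> all_rels \<Longrightarrow> cls r = 0"
  by (simp add: cls_eq_0_iff rideal.incl)

definition pbr :: "Cq \<Rightarrow> palg \<Rightarrow> palg \<Rightarrow> palg" where
  "pbr v a b = a * b - psc v (b * a)"

lemma cls_bracket: "cls (bracket v a b) = pbr v (cls a) (cls b)"
  by (simp add: bracket_def pbr_def cls_simps)

lemma pu_0: "pu 0 = 0"
  unfolding pu_def by (rule cls_all_rels) (simp add: all_rels_def)

lemma all_relsI: "r \<in> prels {1..} ug \<Longrightarrow> cls r = 0"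
  by (rule cls_all_rels) (simp add: all_rels_def)

lemma pu_serre:
  assumes "i = j + 1 \<or> j = i + 1"
  shows "pu i * (pu i * pu j) - psc (qq + pp) (pu i * (pu j * pu i)) + pu j * (pu i * pu i) = 0"
proof (cases "i = 0 \<or> j = 0")
  case True
  then show ?thesis by (auto simp: pu_0)
next
  case False
  then have "bracket pp (ug i) (bracket qq (ug i) (ug j)) \<in> prels {1..} ug"
    using assms by (intro prelsI(1)) auto
  from all_relsI[OF this] show ?thesis
    by (simp add: cls_bracket pbr_def algebra_simps psc.scale_right_diff_distrib psc.scale_left_distrib flip: pu_def)
qed

lemma pu_commute:
  assumes "i + 1 < j \<or> j + 1 < i"
  shows "pu i * pu j = pu j * pu i"
proof (cases "i = 0 \<or> j = 0")
  case True
  then show ?thesis by (auto simp: pu_0)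
next
  case False
  then have "ug i * ug j - ug j * ug i \<in> prels {1..} ug"
    using assms by (intro prelsI(2)) auto
  from all_relsI[OF this] show ?thesis
    by (simp add: cls_simps flip: pu_def)
qed

lemma pu_pw:
  assumes "i \<noteq> 1"
  shows "pu i * pw = pw * pu i"
proof (cases "i = 0")
  case True
  then show ?thesis by (auto simp: pu_0)
next
  case False
  then have "ug i * ww - ww * ug i \<in> prels {1..} ug"
    using assms by (intro prelsI(3)) auto
  from all_relsI[OF this] show ?thesis
    by (simp add: cls_simps flip: pu_def pw_def)
qed

lemma pu_pz:
  assumes "i \<noteq> 2"
  shows "pu i * pz = pz * pu i"
proof (cases "i = 0")
  case True
  then show ?thesis by (auto simp: pu_0)
next
  case False
  then have "ug i * zz - zz * ug i \<in> prels {1..} ug"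
    using assms by (intro prelsI(4)) auto
  from all_relsI[OF this] show ?thesis
    by (simp add: cls_simps flip: pu_def pz_def)
qed

section \<open>The adjoint operators\<close>

definition ad :: "nat \<Rightarrow> palg \<Rightarrow> palg" where
  "ad k x = pu k * x - kap k x * pu k"

lemma ad_simps: "ad k (x + y) = ad k x + ad k y" "ad k (psc c x) = psc c (ad k x)"
  by (simp_all add: ad_def kap_simps algebra_simps psc.scale_right_diff_distrib)

lemma ad_0: "ad 0 x = 0"
  by (simp add: ad_def pu_0)

lemma kap_ad: "k \<ge> 1 \<Longrightarrow> j \<ge> 1 \<Longrightarrow> kap k (ad j x)
    = psc (qq powi cartan k j) (ad j (kap k x))"
  by (simp add: ad_def kap_simps kap_pu kap_kap[of k j] psc.scale_right_diff_distrib)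

interpretation ad_cop: coproduct psc psc "(*)" ad kap "\<lambda>k. (*) (pu k)" "\<lambda>k. (*) (pu k)"
    "\<lambda>k. k \<ge> 1"
  by unfold_locales
    (simp_all add: ad_simps kap_simps kap_ad algebra_simps kap_kap, simp_all add: ad_def algebra_simps)

text \<open>With second factor 1 the coproduct formula reads S(u) x = S(ad)(x) + kappa(x) S(u) for a
  Serre element S and kappa the matching product of the \<open>kap\<close>. As S(u) = 0 in the
  algebra, S(ad) = 0.\<close>

interpretation ad_mod: serre_module psc ad
proof (intro serre_module.intro serre_module_axioms.intro)
  fix i j :: nat and x
  show "Vector_Spaces.linear psc psc (ad i)"
    by (simp add: Vector_Spaces.linear_iff ad_simps psc.vector_space_axioms)
  show "ad 0 x = 0" by (rule ad_0)
  show "ad i (ad i (ad j x)) - psc (qq + pp) (ad i (ad j (ad i x))) + ad j (ad i (ad i x)) = 0"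
    if adj: "i = j + 1 \<or> j = i + 1"
  proof (cases "i = 0 \<or> j = 0")
    case True
    then show ?thesis by (auto simp: ad_0) (simp_all add: ad_def kap_simps)
  next
    case False
    have "(pu i * (pu i * pu j) - psc (qq + pp) (pu i * (pu j * pu i)) + pu j * (pu i * pu i)) * x = 0"
      by (simp add: pu_serre[OF adj])
    then have 1: "pu i * (pu i * (pu j * x)) - psc (qq + pp) (pu i * (pu j * (pu i * x))) + pu j * (pu i *
        (pu i * x)) = 0"
      by (simp add: algebra_simps)
    have "kap i (kap i (kap j x)) * (pu i * (pu i * pu j) - psc (qq + pp) (pu i * (pu j * pu i)) + pu j *
        (pu i * pu i)) = 0"
      by (simp add: pu_serre[OF adj])
    then have 2: "kap i (kap i (kap j x)) * (pu i * (pu i * pu j))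
        - psc (qq + pp) (kap i (kap i (kap j x)) * (pu i * (pu j * pu i))) + kap i (kap i (kap j x)) * (pu j *
            (pu i * pu i)) = 0"
      by (simp add: algebra_simps)
    show ?thesis using ad_cop.coproduct_serre[OF adj, of x 1] False 1 2 by simp
  qed
  show "ad i (ad j x) = ad j (ad i x)" if far: "i + 1 < j \<or> j + 1 < i"
  proof (cases "i = 0 \<or> j = 0")
    case True
    then show ?thesis by (auto simp: ad_0) (simp_all add: ad_def kap_simps)
  next
    case False
    have "pu i * (pu j * x) = pu j * (pu i * x)"
      by (metis mult.assoc pu_commute[OF far])
    then show ?thesis using ad_cop.coproduct_commutator[OF far, of x 1] False pu_commute[OF far] by simp
  qed
qed (rule psc.vector_space_axioms)

lemma powi_two: "qq powi 2 = qq * qq" "qq powi - 2 = pp * pp"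
  by (simp_all add: power_int_minus power2_eq_square)

lemma psc_cancel: "psc qq (psc pp x) = x" "psc pp (psc qq x) = x"
  by simp_all

text \<open>The factor \<open>pp\<close> undoes the factor q in z = q (v_(n-1) \<otimes> v_n - q v_n
  \<otimes> v_(n-1)), so that the second vector is \<open>Y 1 0\<close> - q
  \<open>Y 0 1\<close>.\<close>

interpretation V2: tensor_square psc ad pw "psc pp pz"
proof (intro tensor_square.intro tensor_square_axioms.intro)
  have e: "{1::nat..} = Collect ((\<le>) 1)" by auto
  show "ad k pw = 0" if "k \<noteq> 1" for k
    using that pu_pw[of k] by (cases "k = 0") (simp_all add: ad_0, simp add: ad_def kap_pw)
  show "ad k (psc pp pz) = 0" if "k \<noteq> 2" for k
    using that pu_pz[of k] by (cases "k = 0") (simp_all add: ad_0, simp add: ad_def kap_pz kap_simps)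
  have "bracket (pp ^ 2) (ug 1) (bracket (qq ^ 2) (ug 1) (bracket 1 (ug 1) ww)) \<in> prels {1..} ug"
    unfolding prels_def by blast
  from all_relsI[OF this] have 1: "pbr (pp ^ 2) (pu 1) (pbr (qq ^ 2) (pu 1) (pbr 1 (pu 1) pw)) = 0"
    by (simp add: cls_bracket flip: pu_def pw_def)
  have kap: "kap 1 pw = psc pp (psc pp pw)" "kap 1 (pu 1) = psc qq (psc qq (pu 1))"
    by (simp_all add: kap_pw kap_pu cartan_simps powi_two del: power_int_numeral)
  have sq: "psc (qq ^ 2) x = psc qq (psc qq x)" "psc (pp ^ 2) x = psc pp (psc pp x)" for x
    by (simp_all add: power2_eq_square)
  \<comment> \<open>Here \<open>kap 1\<close> scales w and its first two images under
    \<open>ad 1\<close> by q^-2, 1 and q^2. The maps x -> [u_1, x]_v commute for different v, so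
    these parameters may be permuted into the order of the relator.\<close>
  have "ad 1 (ad 1 (ad 1 pw)) = pbr (pp ^ 2) (pu 1) (pbr (qq ^ 2) (pu 1) (pbr 1 (pu 1) pw))"
    by (simp add: ad_def pbr_def kap_simps kap sq algebra_simps psc.scale_right_diff_distrib psc.scale_right_distrib
        psc_cancel del: psc.scale_scale One_nat_def)
  then show "ad 1 (ad 1 (ad 1 pw)) = 0" using 1 by simp
  have "bracket pp (ug 2) (bracket qq (ug 2) zz) \<in> prels {1..} ug"
    unfolding prels_def by blast
  from all_relsI[OF this] have 2: "pbr pp (pu 2) (pbr qq (pu 2) pz) = 0"
    by (simp add: cls_bracket flip: pu_def pz_def)
  have kap: "kap 2 pz = psc pp pz" "kap 2 (pu 2) = psc qq (psc qq (pu 2))"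
    by (simp_all add: kap_pz kap_pu cartan_simps power_int_minus power2_eq_square)
  have "ad 2 (ad 2 pz) = pbr pp (pu 2) (pbr qq (pu 2) pz)"
    by (simp add: ad_def pbr_def kap_simps kap sq algebra_simps psc.scale_right_diff_distrib psc.scale_right_distrib
        psc_cancel del: psc.scale_scale)
  then show "ad 2 (ad 2 (psc pp pz)) = 0" using 2 by (simp add: ad_simps)
qed (rule ad_mod.serre_module_axioms)

abbreviation pY :: "nat \<Rightarrow> nat \<Rightarrow> palg" where
  "pY \<equiv> V2.Y"

section \<open>Weights of the elements Y a b\<close>

definition wt1 :: "nat \<Rightarrow> nat \<Rightarrow> int" where
  "wt1 k a = of_bool (a = k) - of_bool (a + 1 = k)"

lemma wt1_Suc: "k \<ge> 1 \<Longrightarrow> wt1 k (Suc a) = wt1 k a + cartan k (Suc a)"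
  by (auto simp: wt1_def cartan_def)

lemma kap_col:
  assumes "k \<ge> 1" "kap k x = psc (qq powi (wt1 k 1 + wt1 k 0)) x"
  shows "kap k (ad_mod.col x a) = psc (qq powi (wt1 k (a + 1) + wt1 k 0)) (ad_mod.col x a)"
  using assms by (induction a) (simp_all add: kap_ad ad_simps wt1_Suc power_int_add mult_ac)

lemma kap_row:
  assumes "k \<ge> 1" "kap k x = psc (qq powi (m + wt1 k 0)) x"
  shows "kap k (ad_mod.row x b) = psc (qq powi (m + wt1 k b)) (ad_mod.row x b)"
  using assms by (induction b) (simp_all add: kap_ad ad_simps wt1_Suc power_int_add mult_ac)

lemma kap_sym_alt:
  assumes "k \<ge> 1" "a \<ge> 1"
  shows "kap k (V2.sym a b) = psc (qq powi (wt1 k a + wt1 k b)) (V2.sym a b)"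
    "kap k (V2.alt a b) = psc (qq powi (wt1 k a + wt1 k b)) (V2.alt a b)"
proof -
  have "kap k (ad 1 pw) = psc (qq powi (wt1 k 1 + wt1 k 0)) (ad 1 pw)"
    using assms by (simp add: kap_ad ad_simps kap_pw flip: power_int_add) (auto simp: wt1_def cartan_def)
  from kap_row[OF assms(1) kap_col[OF assms(1) this]]
  show "kap k (V2.sym a b) = psc (qq powi (wt1 k a + wt1 k b)) (V2.sym a b)"
    using assms(2) by (auto simp: V2.sym_def dest!: spec[of _ "a - 1"])
  have "kap k (psc pp pz) = psc (qq powi (wt1 k 1 + wt1 k 0)) (psc pp pz)"
    using assms by (simp add: kap_simps kap_pz) (auto simp: wt1_def)
  from kap_row[OF assms(1) kap_col[OF assms(1) this]]
  show "kap k (V2.alt a b) = psc (qq powi (wt1 k a + wt1 k b)) (V2.alt a b)"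
    using assms(2) by (auto simp: V2.alt_def dest!: spec[of _ "a - 1"])
qed

lemma kap_pY:
  assumes "k \<ge> 1"
  shows "kap k (pY a b) = psc (qq powi (wt1 k a + wt1 k b)) (pY a b)"
proof -
  consider "a = 0" "b = 0" | c where "a = Suc c" "a = b" | "b < a" | "a < b" by (cases a) (auto, linarith)
  then show ?thesis
  proof cases
    case 1
    then show ?thesis using assms by (auto simp: V2.Y_def kap_pw wt1_def)
  next
    case (2 c)
    have dbl: "qq powi (2 * m) = qq powi m * qq powi m" for m
      by (simp flip: power_int_add)
    show ?thesis using 2 kap_sym_alt(1)[OF assms, of a c] assms
      by (simp add: dbl V2.Y_def kap_simps kap_ad ad_simps V2.sym_def wt1_Suc power_int_add mult_ac)
  next
    case 3
    then show ?thesis using kap_sym_alt[OF assms, of a b]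
      by (simp add: V2.Y_def kap_simps psc.scale_right_distrib mult_ac)
  next
    case 4
    then show ?thesis using kap_sym_alt[OF assms, of b a]
      by (simp add: V2.Y_def kap_simps psc.scale_right_diff_distrib mult_ac add.commute)
  qed
qed

lemma pY_00: "pY 0 0 = pw"
  by (rule V2.Y_00)

lemma pY_pz: "psc qq (pY 1 0 - psc qq (pY 0 1)) = pz"
  unfolding V2.Y_alt by simp

lemma ad_pY: "ad k (pY a b) = (if k = a + 1 then pY k b else 0) +
    (if k = b + 1 then psc (qq powi wt1 k a) (pY a k) else 0)"
  unfolding wt1_def by (rule V2.E_Y)

lemma pu_mult: "pu k * (x * y) = ad k x * y + kap k x * (pu k * y)"
  by (simp add: ad_def algebra_simps)

lemma ad_mult: "ad k (x * y) = ad k x * y + kap k x * ad k y"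
  by (simp add: ad_def kap_simps algebra_simps)

section \<open>The action on the tensor algebra\<close>

definition Eop :: "nat \<Rightarrow> nat free \<Rightarrow> nat free" where
  "Eop i = linear_ext (\<lambda>w. E_word i (letters w))"

definition Kop :: "nat \<Rightarrow> nat free \<Rightarrow> nat free" where
  "Kop i = linear_ext (\<lambda>w. scale (qq powi wt i (letters w)) (basis w))"

lemma Eop_lin: "lin (Eop i)" and Kop_lin: "lin (Kop i)"
  unfolding Eop_def Kop_def by (rule lin_linear_ext)+

lemmas Eop_simps = linD[OF Eop_lin] and Kop_simps = linD[OF Kop_lin]

lemma Eop_mon: "Eop i (mon w) = E_word i w" and Kop_mon: "Kop i (mon w) = scale (qq powi wt i w) (mon w)"
  by (simp_all add: Eop_def Kop_def)

lemma wt_append: "wt i (u @ v) = wt i u + wt i v"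
  by (simp add: wt_def)

lemma wt_Cons: "wt i (a # v) = wt i [a] + wt i v"
  by (simp add: wt_def)

lemma wt_Nil: "wt i [] = 0"
  by (simp add: wt_def)

lemma E_word_append: "E_word i (u @ v) = E_word i u * mon v + scale (qq powi wt i u) (mon u * E_word i v)"
proof (induction u)
  case Nil
  then show ?case by (simp add: wt_Nil flip: one_eq_mon)
next
  case (Cons a u)
  have "mon (a # u) = mon [a] * mon u" by (simp add: mon_mult)
  then show ?case
    by (simp add: Cons distrib_left distrib_right scale.scale_right_distrib wt_Cons[of i a u] power_int_add
        mon_mult mult.assoc flip: mult.assoc)
qed

lemma Eop_mult: "Eop i (x * y) = Eop i x * y + Kop i x * Eop i y"
proof (induction x rule: free_induct)
  case (mon v)
  show ?case
    by (induction y rule: free_induct)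
      (simp_all add: Eop_simps Kop_simps Eop_mon Kop_mon mon_mult E_word_append distrib_left
          scale.scale_right_distrib mult.commute)
qed (simp_all add: Eop_simps Kop_simps distrib_right scale.scale_right_distrib)

lemma Kop_mult: "Kop i (x * y) = Kop i x * Kop i y"
proof (induction x rule: free_induct)
  case (mon v)
  show ?case
    by (induction y rule: free_induct)
      (simp_all add: Kop_simps Kop_mon mon_mult wt_append power_int_add distrib_left mult.commute)
qed (simp_all add: Kop_simps distrib_right)

lemma Eop_one: "Eop i 1 = 0" and Kop_one: "Kop i 1 = 1"
  by (simp_all add: one_eq_mon Eop_mon Kop_mon wt_Nil)

lemma Eop_letter: "Eop i (mon [a]) = (if a = i + 1 then mon [i] else 0)"
  by (simp add: Eop_mon mon_mult wt_Nil flip: one_eq_mon)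

lemma Kop_Eop: "Kop i (Eop j x) = scale (qq powi cartan i j) (Eop j (Kop i x))"
proof (induction x rule: free_induct)
  case (mon w)
  then show ?case
  proof (induction w)
    case Nil
    then show ?case by (simp add: Eop_one Kop_one Kop_simps flip: one_eq_mon)
  next
    case (Cons a w)
    have 1: "Kop i (Eop j (mon [a])) = scale (qq powi cartan i j) (Eop j (Kop i (mon [a])))"
    proof (cases "a = j + 1")
      case True
      have "wt i [j] = cartan i j + wt i [j + 1]"
        by (auto simp: wt_def cartan_def)
      then show ?thesis using True by (simp add: Eop_simps Eop_letter Kop_mon power_int_add)
    qed (simp add: Eop_letter Kop_simps Kop_mon Eop_simps)
    have "Kop i (Kop j (mon [a])) = Kop j (Kop i (mon [a]))"
      by (simp add: Kop_simps Kop_mon mult.commute)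
    then have "Kop i (Eop j (mon [a] * mon w)) = scale (qq powi cartan i j) (Eop j (Kop i (mon [a] * mon w)))"
      by (simp add: Eop_mult Kop_mult Kop_simps Cons 1 scale.scale_right_distrib)
    then show ?case by (simp add: mon_mult)
  qed
qed (simp_all add: Eop_simps Kop_simps scale.scale_right_distrib mult.commute)

lemma Kop_Kop: "Kop i (Kop j x) = Kop j (Kop i x)"
  by (induction x rule: free_induct) (simp_all add: Kop_simps Kop_mon mult.commute)

interpretation wcop: coproduct scale scale "(*)" Eop Kop Eop Eop "\<lambda>_. True"
  by unfold_locales (simp_all add: Eop_simps Kop_simps Kop_Eop Kop_Kop Eop_mult)

lemma Eop_serre:
  assumes "i = j + 1 \<or> j = i + 1"
  shows "Eop i (Eop i (Eop j x)) - scale (qq + pp) (Eop i (Eop j (Eop i x))) + Eop j (Eop i (Eop i x)) = 0"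
proof (induction x rule: free_induct)
  case (mon w)
  then show ?case
  proof (induction w)
    case Nil
    then show ?case by (simp add: Eop_one Eop_simps flip: one_eq_mon)
  next
    case (Cons a w)
    have 1: "Eop i (Eop i (Eop j (mon [a]))) = 0" "Eop i (Eop j (Eop i (mon [a])))
        = 0" "Eop j (Eop i (Eop i (mon [a]))) = 0"
      using assms by (auto simp: Eop_letter Eop_simps)
    let ?k = "Kop i (Kop i (Kop j (mon [a])))"
    have "?k * (Eop i (Eop i (Eop j (mon w))) - scale (qq + pp) (Eop i (Eop j (Eop i (mon w)))) + Eop j (Eop i
        (Eop i (mon w)))) = 0"
      using Cons by simp
    then have 2: "?k * Eop i (Eop i (Eop j (mon w))) - scale (qq + pp) (?k * Eop i (Eop j (Eop i (mon w))))
        + ?k * Eop j (Eop i (Eop i (mon w))) = 0"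
      by (simp add: algebra_simps)
    show ?case
      using wcop.coproduct_serre[OF assms, of "mon [a]" "mon w"] 1 2 by (simp add: mon_mult)
  qed
next
  case (add x y)
  have "Eop i (Eop i (Eop j (x + y))) - scale (qq + pp) (Eop i (Eop j (Eop i (x + y)))) + Eop j (Eop i (Eop i (x
      + y)))
    = (Eop i (Eop i (Eop j x)) - scale (qq + pp) (Eop i (Eop j (Eop i x))) + Eop j (Eop i (Eop i x)))
     + (Eop i (Eop i (Eop j y)) - scale (qq + pp) (Eop i (Eop j (Eop i y))) + Eop j (Eop i (Eop i y)))"
    by (simp add: Eop_simps scale.scale_right_distrib)
  then show ?case unfolding add by simp
next
  case (scale c x)
  have "Eop i (Eop i (Eop j (scale c x))) - scale (qq + pp) (Eop i (Eop j (Eop i (scale c x)))) + Eop j (Eop i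
      (Eop i (scale c x)))
    = scale c (Eop i (Eop i (Eop j x)) - scale (qq + pp) (Eop i (Eop j (Eop i x))) + Eop j (Eop i (Eop i x)))"
    by (simp add: Eop_simps scale.scale_right_distrib scale.scale_right_diff_distrib mult.commute)
  then show ?case unfolding scale by simp
qed (simp add: Eop_simps)

lemma Eop_commute:
  assumes "i + 1 < j \<or> j + 1 < i"
  shows "Eop i (Eop j x) = Eop j (Eop i x)"
proof (induction x rule: free_induct)
  case (mon w)
  then show ?case
  proof (induction w)
    case Nil
    then show ?case by (simp add: Eop_one Eop_simps flip: one_eq_mon)
  next
    case (Cons a w)
    have 1: "Eop i (Eop j (mon [a])) = 0" "Eop j (Eop i (mon [a])) = 0"
      using assms by (auto simp: Eop_letter Eop_simps)
    show ?case
      using wcop.coproduct_commutator[OF assms, of "mon [a]" "mon w"] 1 Cons by (simp add: mon_mult)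
  qed
qed (simp_all add: Eop_simps)

subsection \<open>Tensors of fixed degree\<close>

definition tens :: "nat \<Rightarrow> nat \<Rightarrow> nat free set" where
  "tens n d = {x. \<forall>w\<in>Poly_Mapping.keys x. set (letters w) \<subseteq> {1..n} \<and> length
      (letters w) = d}"

lemma V4_eq: "V4 n = tens n 4"
  unfolding V4_def tens_def by auto

lemma tens_mon: "mon w \<in> tens n d \<longleftrightarrow> set w \<subseteq> {1..n} \<and> length w = d"
  by (simp add: tens_def)

lemma keys_plus_bex: "(\<forall>w\<in>Poly_Mapping.keys x. Q w) \<Longrightarrow>
    (\<forall>w\<in>Poly_Mapping.keys y. Q w) \<Longrightarrow> (\<forall>w\<in>Poly_Mapping.keys (x + y). Q w)"
  using Poly_Mapping.keys_add[of x y] by blast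

lemma keys_scale_ball: "(\<forall>w\<in>Poly_Mapping.keys x. Q w) \<Longrightarrow>
    (\<forall>w\<in>Poly_Mapping.keys (scale c x). Q w)"
  using keys_scale[of c x] by blast

lemma keys_diff_ball: "(\<forall>w\<in>Poly_Mapping.keys x. Q w) \<Longrightarrow>
    (\<forall>w\<in>Poly_Mapping.keys y. Q w) \<Longrightarrow> (\<forall>w\<in>Poly_Mapping.keys (x - y). Q w)"
  for x y :: "'k \<Rightarrow>\<^sub>0 Cq"
  using Poly_Mapping.keys_diff[of x y] by blast

lemma tens_zero: "0 \<in> tens n d" and tens_add: "x \<in> tens n d \<Longrightarrow>
    y \<in> tens n d \<Longrightarrow> x + y \<in> tens n d"
  and tens_scale: "x \<in> tens n d \<Longrightarrow> scale c x \<in> tens n d"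
  and tens_diff: "x \<in> tens n d \<Longrightarrow> y \<in> tens n d \<Longrightarrow> x - y \<in> tens n d"
  unfolding tens_def mem_Collect_eq by (simp, (rule keys_plus_bex keys_scale_ball keys_diff_ball; assumption)+)

lemma tens_induct [consumes 1, case_names zero add scale mon]:
  assumes "x \<in> tens n d" "P 0" "\<And>x y. P x \<Longrightarrow> P y \<Longrightarrow>
      P (x + y)" "\<And>c x. P x \<Longrightarrow> P (scale c x)"
    "\<And>w. set w \<subseteq> {1..n} \<Longrightarrow> length w = d \<Longrightarrow> P (mon w)"
  shows "P x"
proof -
  have "Poly_Mapping.keys x \<subseteq> {w. set (letters w) \<subseteq> {1..n} \<and> length (letters w) = d}"
    using assms(1) by (auto simp: tens_def)
  then show ?thesis
    by (rule span_basis_induct) (use assms(2-) in \<open>auto, metis word.collapse\<close>)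
qed

lemma tens_mult: "x \<in> tens n d \<Longrightarrow> y \<in> tens n e \<Longrightarrow> x * y \<in> tens n (d + e)"
proof (induction x rule: tens_induct)
  case (mon v)
  show ?case using mon(3)
    by (induction y rule: tens_induct)
        (use mon(1,2) in \<open>auto simp: mon_mult tens_mon distrib_left intro: tens_zero tens_add
        tens_scale\<close>)
qed (auto simp: distrib_right intro: tens_zero tens_add tens_scale)

lemma E_word_tens: "i \<in> {1..n - 1} \<Longrightarrow> set w \<subseteq> {1..n} \<Longrightarrow>
    E_word i w \<in> tens n (length w)"
proof (induction w)
  case (Cons a w)
  have "(if a = i + 1 then mon [i] else 0) * mon w \<in> tens n (1 + length w)"
    using Cons.prems by (intro tens_mult) (auto simp: tens_mon tens_zero)
  moreover have "mon [a] * E_word i w \<in> tens n (1 + length w)"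
    using Cons by (intro tens_mult) (auto simp: tens_mon)
  ultimately show ?case by (auto intro!: tens_add tens_scale)
qed (simp add: tens_zero)

lemma Eop_tens: "x \<in> tens n d \<Longrightarrow> i \<in> {1..n - 1} \<Longrightarrow> Eop i x \<in> tens n d"
  by (induction x rule: tens_induct)
    (auto simp: Eop_simps Eop_mon E_word_tens tens_zero intro: tens_add tens_scale)

lemma Kop_tens: "x \<in> tens n d \<Longrightarrow> Kop i x \<in> tens n d"
  by (induction x rule: tens_induct)
    (auto simp: Kop_simps Kop_mon tens_mon tens_zero intro: tens_add tens_scale)

subsection \<open>The braiding is equivariant\<close>

definition Tlin :: "nat free \<Rightarrow> nat free" where
  "Tlin = linear_ext (\<lambda>w. T_op (letters w ! 0) (letters w ! 1))"

lemma Tlin_lin: "lin Tlin" and Psi_i_lin: "lin (Psi_i j)"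
  unfolding Tlin_def Psi_i_def by (rule lin_linear_ext)+

lemmas Tlin_simps = linD[OF Tlin_lin] and Psi_i_simps = linD[OF Psi_i_lin]

lemma Tlin_mon: "Tlin (mon [a, b]) = T_op a b"
  by (simp add: Tlin_def)

lemma Psi_i_mon: "length p = j - 1 \<Longrightarrow> j \<ge> 1 \<Longrightarrow> Psi_i j (mon (p @ a # b # s))
    = mon p * T_op a b * mon s"
  by (cases j) (simp_all add: Psi_i_def nth_append)

lemma Psi_i_mult:
  assumes "x \<in> tens n (j - 1)" "y \<in> tens n 2" "j \<ge> 1"
  shows "Psi_i j (x * y * z) = x * Tlin y * z"
  using assms(1)
proof (induction x rule: tens_induct)
  case (mon p)
  note p = mon
  show ?case using assms(2)
  proof (induction y rule: tens_induct)
    case (mon w)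
    then obtain a b where w: "w = [a, b]"
      by (auto simp: length_Suc_conv numeral_2_eq_2)
    show ?case
    proof (induction z rule: free_induct)
      case (mon s)
      show ?case using Psi_i_mon[OF p(2) assms(3), of a b s] by (simp add: w mon_mult Tlin_mon)
    qed (simp_all add: Psi_i_simps distrib_left)
  qed (simp_all add: Psi_i_simps Tlin_simps distrib_left distrib_right)
qed (simp_all add: Psi_i_simps distrib_right)

lemma T_op_tens: "a \<in> {1..n} \<Longrightarrow> b \<in> {1..n} \<Longrightarrow> T_op a b \<in> tens n 2"
  unfolding T_op_def by (auto intro!: tens_scale tens_diff simp: tens_mon)

lemma Kop_T_op: "Kop i (T_op a b) = scale (qq powi wt i [a, b]) (T_op a b)"
proof -
  have "wt i [b, a] = wt i [a, b]" by (simp add: wt_def)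
  then show ?thesis
    by (auto simp: T_op_def Kop_simps Kop_mon scale.scale_right_diff_distrib mult.commute)
qed

text \<open>The braiding commutes with E_i on V \<otimes> V; only the positions of a and b relative
  to i and i + 1 matter, which gives the cases.\<close>

lemma Eop_T_op: "Eop i (T_op a b) = Tlin (Eop i (mon [a, b]))"
proof -
  have m: "mon [x, y] = mon [x] * mon [y]" for x y :: nat by (simp add: mon_mult)
  have E2: "Eop i (mon [x, y]) = (if x = i + 1 then mon [i, y] else 0) +
      (if y = i + 1 then scale (qq powi wt i [x]) (mon [x, i]) else 0)" for x y
    unfolding m Eop_mult Eop_letter Kop_mon by (simp add: mon_mult)
  have w: "qq powi wt i [i] = qq" "qq powi wt i [Suc i] = pp" "x \<noteq> i \<Longrightarrow>
      x \<noteq> Suc i \<Longrightarrow> qq powi wt i [x] = 1" for x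
    by (simp_all add: wt_def power_int_minus)
  consider "a = Suc i" "b = Suc i" | "a = Suc i" "b = i" | "a = i" "b = Suc i"
    | "a = Suc i" "b < i" | "a = Suc i" "b > Suc i" | "b = Suc i" "a < i" | "b = Suc i" "a > Suc i"
    | "a \<noteq> Suc i" "b \<noteq> Suc i" by linarith
  then show ?thesis
    by cases (simp_all add: T_op_def Eop_simps E2 w Tlin_simps Tlin_mon
      scale.scale_right_distrib scale.scale_left_diff_distrib scale.scale_right_diff_distrib del: scale.scale_scale)
qed

lemma split_word:
  assumes "length w = 4" "j \<in> {1, 2, 3}" "set w \<subseteq> {1..n}"
  obtains p a b s where "w = p @ [a, b] @ s" "length p = j - 1" "length s = 3 - j"
    "set p \<subseteq> {1..n}" "set s \<subseteq> {1..n}" "a \<in> {1..n}" "b \<in> {1..n}"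
proof -
  obtain c0 c1 c2 c3 where w: "w = [c0, c1, c2, c3]"
    using assms(1) by (auto simp: length_Suc_conv eval_nat_numeral)
  from assms(2) consider "j = 1" | "j = 2" | "j = 3" by auto
  then show ?thesis
  proof cases
    case 1
    then show ?thesis using that[of "[]" c0 c1 "[c2, c3]"] assms(3) w by auto
  next
    case 2
    then show ?thesis using that[of "[c0]" c1 c2 "[c3]"] assms(3) w by auto
  next
    case 3
    then show ?thesis using that[of "[c0, c1]" c2 c3 "[]"] assms(3) w by auto
  qed
qed

lemma Psi_i_word:
  assumes "length w = 4" "j \<in> {1, 2, 3}" "set w \<subseteq> {1..n}"
  shows "Psi_i j (mon w) \<in> tens n 4" "Kop i (Psi_i j (mon w)) = Psi_i j (Kop i (mon w))"
    "i \<in> {1..n - 1} \<Longrightarrow> Eop i (Psi_i j (mon w)) = Psi_i j (Eop i (mon w))"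
proof -
  obtain p a b s where w: "w = p @ [a, b] @ s" "length p = j - 1" "length s = 3 - j"
    and set: "set p \<subseteq> {1..n}" "set s \<subseteq> {1..n}" "a \<in> {1..n}" "b \<in> {1..n}"
    by (rule split_word[OF assms(1-3)])
  have j: "j \<ge> 1" using assms(2) by auto
  have m: "mon w = mon p * mon [a, b] * mon s" by (simp add: w mon_mult)
  have tp: "mon p \<in> tens n (j - 1)" "mon [a, b] \<in> tens n 2"
    using w set by (auto simp: tens_mon)
  have P: "Psi_i j (mon w) = mon p * T_op a b * mon s"
    unfolding m Psi_i_mult[OF tp j] Tlin_mon ..
  have "mon p * T_op a b * mon s \<in> tens n (j - 1 + 2 + (3 - j))"
    using w set by (intro tens_mult T_op_tens) (auto simp: tens_mon)
  moreover have "j - 1 + 2 + (3 - j) = 4" using assms(2) by auto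
  ultimately show "Psi_i j (mon w) \<in> tens n 4" by (simp add: P)
  have wt: "wt i w = wt i p + wt i [a, b] + wt i s"
    by (simp add: w wt_def)
  show "Kop i (Psi_i j (mon w)) = Psi_i j (Kop i (mon w))"
    using wt by (simp add: P Kop_mult Kop_T_op Kop_mon Psi_i_simps power_int_add mult_ac)
  assume i: "i \<in> {1..n - 1}"
  have "Eop i (mon w) = Eop i (mon p) * mon [a, b] * mon s + Kop i (mon p) * Eop i (mon [a, b]) * mon s
      + Kop i (mon p) * Kop i (mon [a, b]) * Eop i (mon s)"
    unfolding m Eop_mult Kop_mult by (simp add: algebra_simps)
  then have "Psi_i j (Eop i (mon w)) = Eop i (mon p) * T_op a b * mon s + Kop i (mon p) * Tlin (Eop i (mon [a,
      b])) * mon s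
      + Kop i (mon p) * Tlin (Kop i (mon [a, b])) * Eop i (mon s)"
    by (simp only: Psi_i_simps Tlin_mon Psi_i_mult[OF Eop_tens[OF tp(1) i] tp(2) j]
        Psi_i_mult[OF Kop_tens[OF tp(1)] Eop_tens[OF tp(2) i] j] Psi_i_mult[OF Kop_tens[OF tp(1)] Kop_tens[OF
            tp(2)] j])
  also have "\<dots> = Eop i (Psi_i j (mon w))"
    unfolding P Eop_mult Kop_mult Eop_T_op by (simp add: Kop_T_op Kop_mon[of i "[a,
        b]"] Tlin_simps Tlin_mon algebra_simps)
  finally show "Eop i (Psi_i j (mon w)) = Psi_i j (Eop i (mon w))" ..
qed

lemma Psi_i_tens:
  assumes "x \<in> tens n 4" "j \<in> {1, 2, 3}"
  shows "Psi_i j x \<in> tens n 4"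
  using assms(1)
proof (induction x rule: tens_induct)
  case (mon w)
  show ?case by (rule Psi_i_word(1)[OF mon(2) assms(2) mon(1)])
qed (auto simp: Psi_i_simps tens_zero intro: tens_add tens_scale)

lemma Psi_i_equivariant:
  assumes "x \<in> tens n 4" "j \<in> {1, 2, 3}" "i \<in> {1..n - 1}"
  shows "Eop i (Psi_i j x) = Psi_i j (Eop i x)" "Kop i (Psi_i j x) = Psi_i j (Kop i x)"
  using assms(1)
proof (induction x rule: tens_induct)
  case (mon w)
  {
    case 1
    show ?case by (rule Psi_i_word(3)[OF mon(2) assms(2) mon(1) assms(3)])
  next
    case 2
    show ?case by (rule Psi_i_word(2)[OF mon(2) assms(2) mon(1)])
  }
qed (simp_all add: Eop_simps Kop_simps Psi_i_simps)

lemma Psi_tens: "x \<in> tens n 4 \<Longrightarrow> Psi x \<in> tens n 4"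
  unfolding Psi_def by (intro tens_add tens_scale Psi_i_tens) auto

lemma Psi_lin: "lin Psi"
  unfolding Psi_def by (rule linI) (simp_all add: Psi_i_simps scale.scale_right_distrib mult.commute algebra_simps)

lemmas Psi_simps = linD[OF Psi_lin]

lemma Psi_equivariant:
  assumes "x \<in> tens n 4" "i \<in> {1..n - 1}"
  shows "Eop i (Psi x) = Psi (Eop i x)" "Kop i (Psi x) = Psi (Kop i x)"
  unfolding Psi_def using assms
  by (simp_all add: Eop_simps Kop_simps Psi_i_equivariant[where n = n] Psi_i_tens Eop_tens Kop_tens)

section \<open>The braided cross product\<close>

lemma tensor_lin1: "lin (\<lambda>a. tensor a x)"
  unfolding tensor_def by (rule lin_linear_ext)

lemma tensor_lin2: "lin (tensor a)"
proof (rule linI)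
  have "lin (\<lambda>v. linear_ext (\<lambda>v. linear_ext (\<lambda>e. basis (v, e)) x) v)" for x :: "nat free"
    by (rule lin_linear_ext)
  fix x y :: "nat free" and c
  show "tensor a (x + y) = tensor a x + tensor a y"
    unfolding tensor_def linear_ext_def[of _ a]
    by (simp add: scale.scale_right_distrib sum.distrib)
  show "tensor a (scale c x) = scale c (tensor a x)"
    unfolding tensor_def linear_ext_def[of _ a]
    by (simp add: scale.scale_sum_right mult.commute)
qed

lemmas tensor_simps = linD[OF tensor_lin1] linD[OF tensor_lin2]

lemma tensor_basis: "tensor (basis v) (basis e) = basis (v, e)"
  by (simp add: tensor_def)

lemma cross_induct [case_names zero add scale tensor]:
  fixes z :: cross
  assumes "P 0" "\<And>x y. P x \<Longrightarrow> P y \<Longrightarrow>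
      P (x + y)" "\<And>c x. P x \<Longrightarrow> P (scale c x)"
    "\<And>v e. P (tensor (mon v) (mon e))"
  shows "P z"
proof (rule span_basis_induct[of z UNIV])
  fix k :: "nat word \<times> nat word"
  obtain v e where "k = (Word v, Word e)" by (metis surj_pair word.exhaust)
  then show "P (basis k)" using assms(4)[of v e] by (simp add: tensor_basis)
qed (use assms in auto)

lemma E_lmult_lin: "lin (E_lmult i)" and S_lmult_lin: "lin (S_lmult s)"
  unfolding E_lmult_def S_lmult_def by (rule lin_linear_ext)+

lemmas E_lmult_simps = linD[OF E_lmult_lin] and S_lmult_simps = linD[OF S_lmult_lin]

lemma E_lmult_tensor: "E_lmult i (tensor a x) = tensor (Eop i a) x + tensor (Kop i a) (mon [i] * x)"
proof (induction a rule: free_induct)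
  case (mon v)
  show ?case
  proof (induction x rule: free_induct)
    case (mon e)
    show ?case
      by (simp add: tensor_basis E_lmult_def Eop_mon Kop_mon tensor_simps)
  qed (simp_all add: tensor_simps E_lmult_simps distrib_left scale.scale_right_distrib)
qed (simp_all add: tensor_simps E_lmult_simps Eop_simps Kop_simps scale.scale_right_distrib)

lemma S_lmult_tensor: "S_lmult s (tensor a x) = tensor (basis s * a) x"
proof (induction a rule: free_induct)
  case (mon v)
  show ?case
  proof (induction x rule: free_induct)
    case (mon e)
    show ?case by (simp add: tensor_basis S_lmult_def mult_single)
  qed (simp_all add: tensor_simps S_lmult_simps)
qed (simp_all add: tensor_simps S_lmult_simps distrib_left)

section \<open>Left multiplications and associativity\<close>

definition SL :: "nat free \<Rightarrow> cross \<Rightarrow> cross" where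
  "SL a z = linear_ext (\<lambda>s. S_lmult s z) a"

lemma SL_lin1: "lin (\<lambda>a. SL a z)"
  unfolding SL_def by (rule lin_linear_ext)

lemma SL_lin2: "lin (SL a)"
  by (rule linI)
    (simp_all add: SL_def linear_ext_def S_lmult_simps scale.scale_right_distrib sum.distrib
        scale.scale_sum_right mult.commute)

lemmas SL_simps = linD[OF SL_lin1] linD[OF SL_lin2]

lemma SL_basis: "SL (basis s) = S_lmult s"
  by (simp add: SL_def fun_eq_iff)

lemma SL_tensor: "SL a (tensor b x) = tensor (a * b) x"
proof (induction a rule: free_induct)
  case (mon v)
  then show ?case by (simp add: SL_basis S_lmult_tensor)
qed (simp_all add: SL_simps tensor_simps distrib_right)

lemma SL_SL: "SL a (SL b z) = SL (a * b) z"
  by (induction z rule: cross_induct) (simp_all add: SL_simps SL_tensor mult.assoc)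

lemma E_lmult_SL: "E_lmult i (SL a z) = SL (Eop i a) z + SL (Kop i a) (E_lmult i z)"
  by (induction z rule: cross_induct)
    (simp_all add: SL_simps SL_tensor E_lmult_simps E_lmult_tensor Eop_mult Kop_mult tensor_simps
        scale.scale_right_distrib)

abbreviation UL :: "nat free \<Rightarrow> cross \<Rightarrow> cross" where
  "UL \<equiv> act scale E_lmult"

interpretation UL: free_module scale E_lmult
  by (intro free_module.intro free_module_axioms.intro E_lmult_lin scale.vector_space_axioms)

lemma cross_mult_lin1: "lin (\<lambda>x. cross_mult x y)"
  unfolding cross_mult_def by (rule lin_linear_ext)

lemma cross_mult_lin2: "lin (cross_mult x)"
proof -
  have l: "lin (foldr E_lmult e)" for e by (rule lin_foldr) (rule E_lmult_lin)
  show ?thesis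
    by (rule linI)
      (simp_all add: cross_mult_def linear_ext_def S_lmult_simps linD[OF l] scale.scale_right_distrib sum.distrib
        scale.scale_sum_right mult.commute split_def)
qed

lemmas cross_mult_simps = linD[OF cross_mult_lin1] linD[OF cross_mult_lin2]

lemma cross_mult_tensor: "cross_mult (tensor a x) y = SL a (UL x y)"
proof (induction a rule: free_induct)
  case (mon v)
  show ?case
  proof (induction x rule: free_induct)
    case (mon e)
    show ?case by (simp add: tensor_basis cross_mult_def SL_basis UL.act_mon)
  qed (simp_all add: tensor_simps cross_mult_simps SL_simps UL.act_left)
qed (simp_all add: tensor_simps cross_mult_simps SL_simps)

lemma cross_mult_SL: "cross_mult (SL a x) y = SL a (cross_mult x y)"
  by (induction x rule: cross_induct) (simp_all add: cross_mult_simps SL_simps SL_tensor cross_mult_tensor SL_SL)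

lemma UL_mon1: "UL (mon [i]) z = E_lmult i z"
  by (simp add: UL.act_mon)

text \<open>Moving E_i past \<open>SL a\<close> by \<open>E_lmult_SL\<close> produces the same two
  terms as \<open>E_lmult_tensor\<close>. Once left multiplications commute with the right factor y,
  associativity follows, because a tensor multiplies as a composite of left multiplications.\<close>

lemma cross_mult_E: "cross_mult (E_lmult i x) y = E_lmult i (cross_mult x y)"
proof (induction x rule: cross_induct)
  case (tensor v e)
  show ?case
    unfolding E_lmult_tensor cross_mult_simps cross_mult_tensor E_lmult_SL UL.act_mult UL_mon1 ..
qed (simp_all add: cross_mult_simps E_lmult_simps)

lemma cross_mult_UL: "cross_mult (UL a x) y = UL a (cross_mult x y)"
proof (induction a rule: free_induct)
  case (mon w)
  show ?case by (induction w) (simp_all add: UL.act_mon cross_mult_E)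
qed (simp_all add: UL.act_left cross_mult_simps)

lemma cross_mult_assoc: "cross_mult (cross_mult x y) z = cross_mult x (cross_mult y z)"
  by (induction x rule: cross_induct)
    (simp_all add: cross_mult_simps cross_mult_tensor cross_mult_SL cross_mult_UL)

lemma UL_one: "UL x (tensor 1 1) = tensor 1 x"
proof (induction x rule: free_induct)
  case (mon e)
  show ?case
  proof (induction e)
    case Nil
    then show ?case by (simp add: UL.act_one flip: one_eq_mon)
  next
    case (Cons i e)
    then show ?case
      by (simp add: UL.act_mon E_lmult_tensor Eop_one Kop_one tensor_simps mon_mult)
  qed
qed (simp_all add: UL.act_left tensor_simps)

lemma cross_mult_one: "cross_mult (tensor 1 1) y = y" "cross_mult y (tensor 1 1) = y"
proof -
  show "cross_mult (tensor 1 1) y = y"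
    by (induction y rule: cross_induct)
        (simp_all add: cross_mult_simps cross_mult_tensor UL.act_one SL_simps SL_tensor)
  show "cross_mult y (tensor 1 1) = y"
    by (induction y rule: cross_induct) (simp_all add: cross_mult_simps cross_mult_tensor UL_one SL_tensor)
qed

section \<open>The carrier of the free cross product\<close>

lemma free_cross_ops [simp]: "x \<otimes>\<^bsub>free_cross n\<^esub> y
    = cross_mult x y" "x \<oplus>\<^bsub>free_cross n\<^esub> y = x + y"
    "\<one>\<^bsub>free_cross n\<^esub> = tensor 1 1" "\<zero>\<^bsub>free_cross n\<^esub> = 0"
  by (simp_all add: free_cross_def)

abbreviation CC :: "nat \<Rightarrow> cross set" where
  "CC n \<equiv> carrier (free_cross n)"

lemma CC_iff: "x \<in> CC n \<longleftrightarrow> (\<forall>k\<in>Poly_Mapping.keys x. letters (fst k)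
    \<in> even_words n \<and> letters (snd k) \<in> lists {1..n - 1})"
  by (auto simp: free_cross_def)

lemma CC_zero: "0 \<in> CC n" and CC_add: "x \<in> CC n \<Longrightarrow> y \<in> CC n \<Longrightarrow>
    x + y \<in> CC n"
  and CC_scale: "x \<in> CC n \<Longrightarrow> scale c x \<in> CC n" and CC_diff: "x
      \<in> CC n \<Longrightarrow> y \<in> CC n \<Longrightarrow> x - y \<in> CC n"
  unfolding CC_iff by (simp, (rule keys_plus_bex keys_scale_ball keys_diff_ball; assumption)+)

lemma CC_induct [consumes 1, case_names zero add scale tensor]:
  assumes "x \<in> CC n" "P 0" "\<And>x y. P x \<Longrightarrow> P y \<Longrightarrow>
      P (x + y)" "\<And>c x. P x \<Longrightarrow> P (scale c x)"
    "\<And>v e. v \<in> even_words n \<Longrightarrow> set e \<subseteq> {1..n - 1} \<Longrightarrow>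
        P (tensor (mon v) (mon e))"
  shows "P x"
proof -
  have "Poly_Mapping.keys x \<subseteq> {k. letters (fst k) \<in> even_words n \<and> letters (snd k)
      \<in> lists {1..n - 1}}"
    using assms(1) by (auto simp: CC_iff)
  then show ?thesis
  proof (rule span_basis_induct)
    fix k :: "nat word \<times> nat word"
    assume "k \<in> {k. letters (fst k) \<in> even_words n \<and> letters (snd k) \<in> lists {1..n - 1}}"
    moreover obtain v e where "k = (Word v, Word e)" by (metis surj_pair word.exhaust)
    ultimately show "P (basis k)" using assms(5)[of v e] by (auto simp: tensor_basis)
  qed (use assms in auto)
qed

lemma TVV_iff: "a \<in> carrier (TVV n) \<longleftrightarrow> (\<forall>w\<in>Poly_Mapping.keys a. letters w
    \<in> even_words n)"
  by (simp add: TVV_def subalg_def)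

lemma TVV_zero: "0 \<in> carrier (TVV n)" and TVV_add: "x \<in> carrier (TVV n) \<Longrightarrow>
    y \<in> carrier (TVV n) \<Longrightarrow> x + y \<in> carrier (TVV n)"
  and TVV_scale: "x \<in> carrier (TVV n) \<Longrightarrow> scale c x \<in> carrier (TVV n)"
  and TVV_diff: "x \<in> carrier (TVV n) \<Longrightarrow> y \<in> carrier (TVV n) \<Longrightarrow>
      x - y \<in> carrier (TVV n)"
  unfolding TVV_iff by (simp, (rule keys_plus_bex keys_scale_ball keys_diff_ball; assumption)+)

lemma TVV_mon: "mon v \<in> carrier (TVV n) \<longleftrightarrow> v \<in> even_words n"
  by (simp add: TVV_iff)

lemma TVV_ops [simp]: "x \<otimes>\<^bsub>TVV n\<^esub> y = x * y" "x \<oplus>\<^bsub>TVV n\<^esub> y = x + y"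
    "\<one>\<^bsub>TVV n\<^esub> = 1" "\<zero>\<^bsub>TVV n\<^esub> = 0"
  by (simp_all add: TVV_def subalg_def)

lemma TVV_one: "1 \<in> carrier (TVV n)"
  using ring.ring_simprules(6)[OF ring_TVV] by simp

lemma TVV_mult: "x \<in> carrier (TVV n) \<Longrightarrow> y \<in> carrier (TVV n) \<Longrightarrow>
    x * y \<in> carrier (TVV n)"
  using ring.ring_simprules(5)[OF ring_TVV] by simp

lemma tens_TVV: "even d \<Longrightarrow> x \<in> tens n d \<Longrightarrow> x \<in> carrier (TVV n)"
  by (auto simp: tens_def TVV_iff even_words_def)

lemma TVV_induct [consumes 1, case_names zero add scale mon]:
  assumes "x \<in> carrier (TVV n)" "P 0" "\<And>x y. P x \<Longrightarrow> P y \<Longrightarrow>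
      P (x + y)" "\<And>c x. P x \<Longrightarrow> P (scale c x)"
    "\<And>v. v \<in> even_words n \<Longrightarrow> P (mon v)"
  shows "P x"
proof -
  have "Poly_Mapping.keys x \<subseteq> {w. letters w \<in> even_words n}"
    using assms(1) by (auto simp: TVV_iff)
  then show ?thesis
    by (rule span_basis_induct) (use assms(2-) in \<open>auto, metis word.collapse\<close>)
qed

lemma Eop_TVV: "a \<in> carrier (TVV n) \<Longrightarrow> i \<in> {1..n - 1} \<Longrightarrow>
    Eop i a \<in> carrier (TVV n)"
proof (induction a rule: TVV_induct)
  case (mon v)
  then show ?case using E_word_tens[of i n v] by (auto simp: Eop_mon even_words_def intro!: tens_TVV)
qed (auto simp: Eop_simps intro: TVV_zero TVV_add TVV_scale)

lemma Kop_TVV: "a \<in> carrier (TVV n) \<Longrightarrow> Kop i a \<in> carrier (TVV n)"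
  by (induction a rule: TVV_induct) (auto simp: Kop_simps Kop_mon TVV_mon intro: TVV_zero TVV_add TVV_scale)

lemma Uplus_mon: "mon e \<in> carrier (Uplus_free n) \<longleftrightarrow> set e \<subseteq> {1..n - 1}"
  by (simp add: Uplus_free_def mon_carrier)

lemma Uplus_induct [consumes 1, case_names zero add scale mon]:
  assumes "x \<in> carrier (Uplus_free n)" "P 0" "\<And>x y. P x \<Longrightarrow> P y \<Longrightarrow>
      P (x + y)" "\<And>c x. P x \<Longrightarrow> P (scale c x)"
    "\<And>e. set e \<subseteq> {1..n - 1} \<Longrightarrow> P (mon e)"
  shows "P x"
proof -
  have "Poly_Mapping.keys x \<subseteq> {w. set (letters w) \<subseteq> {1..n - 1}}"
    using assms(1) by (auto simp: Uplus_free_def carrier_free_alg)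
  then show ?thesis
    by (rule span_basis_induct) (use assms(2-) in \<open>auto, metis word.collapse\<close>)
qed

lemma tensor_CC: "a \<in> carrier (TVV n) \<Longrightarrow> x \<in> carrier (Uplus_free n) \<Longrightarrow>
    tensor a x \<in> CC n"
proof (induction a rule: TVV_induct)
  case (mon v)
  note v = mon(1)
  show ?case using mon(2)
  proof (induction x rule: Uplus_induct)
    case (mon e)
    then show ?case using v by (auto simp: tensor_basis CC_iff)
  qed (auto simp: tensor_simps CC_zero intro: CC_add CC_scale)
qed (auto simp: tensor_simps CC_zero intro: CC_add CC_scale)

lemma E_lmult_CC: "z \<in> CC n \<Longrightarrow> i \<in> {1..n - 1} \<Longrightarrow> E_lmult i z \<in> CC n"
proof (induction z rule: CC_induct)
  case (tensor v e)
  then show ?case unfolding E_lmult_tensor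
    by (intro CC_add tensor_CC Eop_TVV Kop_TVV) (auto simp: TVV_mon Uplus_mon mon_mult)
qed (auto simp: E_lmult_simps CC_zero intro: CC_add CC_scale)

lemma SL_CC: "z \<in> CC n \<Longrightarrow> a \<in> carrier (TVV n) \<Longrightarrow> SL a z \<in> CC n"
proof (induction z rule: CC_induct)
  case (tensor v e)
  then show ?case by (simp add: SL_tensor tensor_CC TVV_mult TVV_mon Uplus_mon)
qed (auto simp: SL_simps CC_zero intro: CC_add CC_scale)

lemma UL_CC: "x \<in> carrier (Uplus_free n) \<Longrightarrow> z \<in> CC n \<Longrightarrow> UL x z \<in> CC n"
proof (induction x rule: Uplus_induct)
  case (mon e)
  then show ?case by (induction e) (auto simp: UL.act_mon E_lmult_CC)
qed (auto simp: UL.act_left CC_zero intro: CC_add CC_scale)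

lemma cross_mult_CC: "x \<in> CC n \<Longrightarrow> y \<in> CC n \<Longrightarrow> cross_mult x y \<in> CC n"
  by (induction x rule: CC_induct)
    (auto simp: cross_mult_simps cross_mult_tensor CC_zero TVV_mon Uplus_mon intro: CC_add CC_scale intro!:
        SL_CC UL_CC)

lemma ring_free_cross: "ring (free_cross n)"
proof (rule ringI)
  show "abelian_group (free_cross n)"
  proof (rule abelian_groupI)
    fix x assume "x \<in> CC n"
    then have "- x \<in> CC n" using CC_diff[OF CC_zero, of x] by simp
    then show "\<exists>y\<in>CC n. y \<oplus>\<^bsub>free_cross n\<^esub> x = \<zero>\<^bsub>free_cross n\<^esub>"
      by (intro bexI[of _ "- x"]) simp_all
  qed (simp_all add: CC_add CC_zero add.assoc add.commute)
  have "tensor 1 1 \<in> CC n"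
    by (rule tensor_CC) (simp_all add: TVV_one Uplus_free_def carrier_free_alg_0_1)
  then show "Group.monoid (free_cross n)"
    by (intro monoidI) (simp_all add: cross_mult_CC cross_mult_assoc cross_mult_one)
qed (simp_all add: cross_mult_simps)

subsection \<open>The defining ideal\<close>

lemma Sq_gens_TVV: "{Psi x - x | x. x \<in> V4 n} \<subseteq> carrier (TVV n)"
  unfolding V4_eq by (auto intro!: tens_TVV[of 4] tens_diff Psi_tens)

lemma Sq_ideal: "ideal (Sq_ideal n) (TVV n)"
  unfolding Sq_ideal_def by (rule ring.genideal_ideal[OF ring_TVV Sq_gens_TVV])

lemma Sq_ideal_TVV: "a \<in> Sq_ideal n \<Longrightarrow> a \<in> carrier (TVV n)"
  using additive_subgroup.a_Hcarr[OF ideal.axioms(1)[OF Sq_ideal]] .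

lemma Sq_ideal_intros: "0 \<in> Sq_ideal n" "a \<in> Sq_ideal n \<Longrightarrow>
    b \<in> Sq_ideal n \<Longrightarrow> a + b \<in> Sq_ideal n"
   "a \<in> Sq_ideal n \<Longrightarrow> c \<in> carrier (TVV n) \<Longrightarrow> c * a \<in> Sq_ideal n"
   "a \<in> Sq_ideal n \<Longrightarrow> c \<in> carrier (TVV n) \<Longrightarrow> a * c \<in> Sq_ideal n"
  using additive_subgroup.zero_closed[OF ideal.axioms(1)[OF Sq_ideal]]
    additive_subgroup.a_closed[OF ideal.axioms(1)[OF Sq_ideal], of a n b]
    ideal.I_l_closed[OF Sq_ideal, of a n c] ideal.I_r_closed[OF Sq_ideal, of a n c] by simp_all

lemma Psi_Sq_ideal: "x \<in> tens n 4 \<Longrightarrow> Psi x - x \<in> Sq_ideal n"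
  using ring.genideal_self[OF ring_TVV Sq_gens_TVV] unfolding Sq_ideal_def V4_eq by blast

text \<open>The generators are permuted by equivariance of Psi. Stability under E_i and K_i is
  proved together, because E_i(x a) = E_i(x) a + K_i(x) E_i(a).\<close>

lemma Sq_ideal_stable:
  assumes "i \<in> {1..n - 1}" "a \<in> Sq_ideal n"
  shows "Eop i a \<in> Sq_ideal n" "Kop i a \<in> Sq_ideal n"
proof -
  have "a \<in> Sq_ideal n \<and> Eop i a \<in> Sq_ideal n \<and> Kop i a \<in> Sq_ideal n"
  using ring_TVV Sq_gens_TVV assms(2)[unfolded Sq_ideal_def]
  proof (induction rule: genideal_induct)
  case (incl r)
  then obtain x where x: "r = Psi x - x" "x \<in> tens n 4" by (auto simp: V4_eq)
  then have "Eop i r = Psi (Eop i x) - Eop i x" "Kop i r = Psi (Kop i x) - Kop i x"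
    using assms(1) by (simp_all add: Eop_simps Kop_simps Psi_equivariant[where n = n])
  then show ?case using x assms(1) by (auto intro!: Psi_Sq_ideal Eop_tens Kop_tens)
next
  case (lmult a x)
  then show ?case using assms(1)
    by (auto simp: Eop_mult Kop_mult intro!: Sq_ideal_intros(2,3) Eop_TVV Kop_TVV)
next
  case (rmult a x)
  then show ?case using assms(1)
    by (auto simp: Eop_mult Kop_mult intro!: Sq_ideal_intros(2,4) Eop_TVV Kop_TVV)
qed (auto simp: Eop_simps Kop_simps intro: Sq_ideal_intros(1,2))
  then show "Eop i a \<in> Sq_ideal n" "Kop i a \<in> Sq_ideal n" by auto
qed

lemma kernel_carrier: "x \<in> Uplus_kernel n \<Longrightarrow> x \<in> carrier (Uplus_free n)"
  by (simp add: Uplus_kernel_eq)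

lemma kernel_lmult: "x \<in> Uplus_kernel n \<Longrightarrow> a \<in> carrier (Uplus_free n) \<Longrightarrow>
    a * x \<in> Uplus_kernel n"
  and kernel_rmult: "x \<in> Uplus_kernel n \<Longrightarrow> a \<in> carrier (Uplus_free n) \<Longrightarrow>
      x * a \<in> Uplus_kernel n"
  by (auto simp: Uplus_kernel_eq Uplus_free_def intro: carrier_free_alg_mult rideal.intros)

abbreviation NN :: "nat \<Rightarrow> cross set" where
  "NN \<equiv> cross_ideal"

lemma NN_intros: "0 \<in> NN n" "x \<in> NN n \<Longrightarrow> y \<in> NN n \<Longrightarrow>
    x + y \<in> NN n" "x \<in> NN n \<Longrightarrow> scale c x \<in> NN n"
  "x \<in> NN n \<Longrightarrow> y \<in> NN n \<Longrightarrow> x - y \<in> NN n"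
  unfolding cross_ideal_def by (simp_all add: scale.span_zero scale.span_add scale.span_scale scale.span_diff)

lemma NN_tensor: "a \<in> Sq_ideal n \<Longrightarrow> x \<in> carrier (Uplus_free n) \<Longrightarrow>
    tensor a x \<in> NN n"
  "a \<in> carrier (TVV n) \<Longrightarrow> x \<in> Uplus_kernel n \<Longrightarrow> tensor a x \<in> NN n"
  unfolding cross_ideal_def by (rule scale.span_base; blast)+

lemma NN_induct [consumes 1, case_names zero add scale Sq kernel]:
  assumes "z \<in> NN n" "P 0" "\<And>x y. P x \<Longrightarrow> P y \<Longrightarrow>
      P (x + y)" "\<And>c x. P x \<Longrightarrow> P (scale c x)"
    "\<And>a x. a \<in> Sq_ideal n \<Longrightarrow> x \<in> carrier (Uplus_free n) \<Longrightarrow> P (tensor a x)"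
    "\<And>a x. a \<in> carrier (TVV n) \<Longrightarrow> x \<in> Uplus_kernel n \<Longrightarrow> P (tensor a x)"
  shows "P z"
  using assms(1) unfolding cross_ideal_def
proof (induction rule: scale.span_induct_alt)
  case (step c x y)
  then have "P x" using assms(5,6) by blast
  then show ?case using step assms(3,4) by blast
qed (rule assms(2))

lemma NN_CC: "z \<in> NN n \<Longrightarrow> z \<in> CC n"
  by (induction z rule: NN_induct)
    (auto intro: CC_zero CC_add CC_scale tensor_CC Sq_ideal_TVV kernel_carrier)

lemma E_lmult_NN: "z \<in> NN n \<Longrightarrow> i \<in> {1..n - 1} \<Longrightarrow> E_lmult i z \<in> NN n"
proof (induction z rule: NN_induct)
  case (Sq a x)
  then show ?case unfolding E_lmult_tensor
    by (intro NN_intros NN_tensor(1) Sq_ideal_stable)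
      (auto simp: Uplus_free_def mon_carrier intro!: carrier_free_alg_mult)
next
  case (kernel a x)
  then show ?case unfolding E_lmult_tensor
    by (intro NN_intros NN_tensor(2) Eop_TVV Kop_TVV kernel_lmult) (auto simp: Uplus_mon)
qed (auto simp: E_lmult_simps intro: NN_intros)

lemma SL_NN: "z \<in> NN n \<Longrightarrow> a \<in> carrier (TVV n) \<Longrightarrow> SL a z \<in> NN n"
proof (induction z rule: NN_induct)
  case (Sq b x)
  then show ?case by (simp add: SL_tensor NN_tensor(1) Sq_ideal_intros)
next
  case (kernel b x)
  then show ?case by (simp add: SL_tensor NN_tensor(2) TVV_mult)
qed (auto simp: SL_simps intro: NN_intros)

lemma SL_Sq_NN: "z \<in> CC n \<Longrightarrow> a \<in> Sq_ideal n \<Longrightarrow> SL a z \<in> NN n"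
proof (induction z rule: CC_induct)
  case (tensor v e)
  then show ?case by (simp add: SL_tensor NN_tensor(1) Sq_ideal_intros TVV_mon Uplus_mon)
qed (auto simp: SL_simps intro: NN_intros)

lemma UL_NN: "x \<in> carrier (Uplus_free n) \<Longrightarrow> z \<in> NN n \<Longrightarrow> UL x z \<in> NN n"
proof (induction x rule: Uplus_induct)
  case (mon e)
  then show ?case by (induction e) (auto simp: UL.act_mon E_lmult_NN)
qed (auto simp: UL.act_left intro: NN_intros)

interpretation tcop: coproduct scale scale tensor Eop Kop "\<lambda>i. (*) (mon [i])" E_lmult "\<lambda>_. True"
  by unfold_locales (simp_all add: tensor_simps Eop_simps Kop_simps Kop_Eop Kop_Kop E_lmult_simps E_lmult_tensor)

text \<open>On a tensor the Serre element S acts as S \<otimes> 1 plus a product of K tensored with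
  left multiplication by S. The first part is zero, as the tensor algebra satisfies the Serre
  relations; the second lies in the kernel part of \<open>cross_ideal\<close>.\<close>

lemma UL_Serre_rels:
  assumes "r \<in> Serre_rels n" "z \<in> CC n"
  shows "UL r z \<in> NN n"
  using assms(2)
proof (induction z rule: CC_induct)
  case (tensor v e)
  have ker: "r * mon e \<in> Uplus_kernel n"
  proof -
    have "r \<in> carrier (Uplus_free n)"
      using assms(1) rideal_Serre_rels_imp_genideal(1)[OF _ rideal.zero, of n] carrier_free_alg_0_1(1)
      by (auto simp: Uplus_free_def)
    then show ?thesis
      using rideal.rmult[OF rideal.incl[OF assms(1)]] tensor(2)
      by (auto simp: Uplus_kernel_eq Uplus_free_def mon_carrier intro!: carrier_free_alg_mult)
  qed
  from assms(1) consider
      i j where "r = serre (mon [i]) (mon [j])" "i = j + 1 \<or> j = i + 1"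
    | i j where "r = mon [i] * mon [j] - mon [j] * mon [i]" "i + 1 < j \<or> j + 1 < i"
    unfolding Serre_rels_def by blast
  then show ?case
  proof cases
    case (1 i j)
    have "(Eop i (Eop i (Eop j (mon v))) - scale (qq + pp) (Eop i (Eop j (Eop i (mon v)))) + Eop j (Eop i (Eop i
        (mon v)))) = 0"
      by (rule Eop_serre[OF 1(2)])
    then have "tensor (Eop i (Eop i (Eop j (mon v))) - scale (qq + pp) (Eop i (Eop j (Eop i (mon v)))) + Eop j
        (Eop i (Eop i (mon v)))) (mon e) = 0"
      by (simp only: tensor_simps)
    then have "UL r (tensor (mon v) (mon e)) = tensor (Kop i (Kop i (Kop j (mon v)))) (r * mon e)"
      using tcop.coproduct_serre[OF 1(2), of "mon v" "mon e"]
      unfolding 1(1) serre_def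
      by (simp add: UL.act_left UL.act_mult UL_mon1 tensor_simps distrib_right left_diff_distrib mult.assoc)
    then show ?thesis using ker tensor by (auto intro!: NN_tensor(2) Kop_TVV simp: TVV_mon)
  next
    case (2 i j)
    have "UL r (tensor (mon v) (mon e)) = tensor (Kop i (Kop j (mon v))) (r * mon e)"
      using tcop.coproduct_commutator[OF 2(2), of "mon v" "mon e"] Eop_commute[OF 2(2)]
      unfolding 2(1)
      by (simp add: UL.act_left UL.act_mult UL_mon1 tensor_simps distrib_right left_diff_distrib mult.assoc)
    then show ?thesis using ker tensor by (auto intro!: NN_tensor(2) Kop_TVV simp: TVV_mon)
  qed
qed (auto simp: UL.act_right intro: NN_intros)

lemma UL_kernel:
  assumes "x \<in> Uplus_kernel n" "z \<in> CC n"
  shows "UL x z \<in> NN n"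
proof -
  have x: "x \<in> carrier (Uplus_free n)" "x \<in> rideal (Serre_rels n)"
    using assms(1) by (auto simp: Uplus_kernel_eq)
  note gi = rideal_Serre_rels_imp_genideal[OF x, unfolded Uplus_free_def]
  have "\<forall>z\<in>CC n. UL x z \<in> NN n"
    using ring_free_alg gi
  proof (rule genideal_induct)
    fix a y assume *: "a \<in> carrier (free_alg {1..n - 1})" "\<forall>z\<in>CC n. UL y z \<in> NN n"
    then show "\<forall>z\<in>CC n. UL (a \<otimes>\<^bsub>free_alg {1..n - 1}\<^esub> y) z \<in> NN n"
        "\<forall>z\<in>CC n. UL (y \<otimes>\<^bsub>free_alg {1..n - 1}\<^esub> a) z \<in> NN n"
      by (simp_all add: UL.act_mult UL_NN[unfolded Uplus_free_def] UL_CC[unfolded Uplus_free_def])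
  qed (auto simp: UL.act_left UL_Serre_rels intro: NN_intros)
  then show ?thesis using assms(2) by blast
qed

lemma NN_cross_mult_left: "x \<in> CC n \<Longrightarrow> z \<in> NN n \<Longrightarrow> cross_mult x z \<in> NN n"
  by (induction x rule: CC_induct)
    (auto simp: cross_mult_simps cross_mult_tensor TVV_mon Uplus_mon intro!: NN_intros SL_NN UL_NN)

lemma NN_cross_mult_right: "z \<in> NN n \<Longrightarrow> x \<in> CC n \<Longrightarrow> cross_mult z x \<in> NN n"
proof (induction z rule: NN_induct)
  case (Sq a y)
  then show ?case by (simp add: cross_mult_tensor SL_Sq_NN UL_CC)
next
  case (kernel a y)
  then show ?case by (simp add: cross_mult_tensor SL_NN UL_kernel)
qed (auto simp: cross_mult_simps intro: NN_intros)

lemma ideal_NN: "ideal (NN n) (free_cross n)"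
proof (rule idealI)
  show "ring (free_cross n)" by (rule ring_free_cross)
  show "subgroup (NN n) (add_monoid (free_cross n))"
  proof (rule group.subgroupI)
    show "Group.group (add_monoid (free_cross n))"
      using ring.is_abelian_group[OF ring_free_cross] abelian_group.a_group by blast
    fix x assume x: "x \<in> NN n"
    have "- x \<in> CC n" "- x \<in> NN n"
      using CC_diff[OF CC_zero NN_CC[OF x]] NN_intros(4)[OF NN_intros(1) x] by simp_all
    moreover have "\<ominus>\<^bsub>free_cross n\<^esub> x = - x"
      using abelian_group.minus_equality[OF ring.is_abelian_group[OF ring_free_cross], of n
          "- x" x] NN_CC[OF x] calculation
      by simp
    ultimately show "inv\<^bsub>add_monoid (free_cross n)\<^esub> x \<in> NN n"
      unfolding a_inv_def by simp
  qed (auto intro: NN_CC NN_intros)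
qed (simp_all add: NN_cross_mult_left NN_cross_mult_right)

section \<open>The two homomorphisms\<close>

subsection \<open>From the presentation to the cross product\<close>

definition z_vec :: "nat \<Rightarrow> nat free" where
  "z_vec n = scale qq (mon [n - 1, n] - scale qq (mon [n, n - 1]))"

text \<open>Generators are sent to left multiplications, so that \<open>Phi\<close> is evaluation at
  1 \<otimes> 1. This makes \<open>Phi\<close> multiplicative and lets relators be computed by
  applying operators one after the other.\<close>

primrec pgen_op :: "nat \<Rightarrow> pgen \<Rightarrow> cross \<Rightarrow> cross" where
  "pgen_op n (GU k) = E_lmult (n - k)"
| "pgen_op n GW = SL (mon [n, n])"
| "pgen_op n GZ = SL (z_vec n)"

abbreviation PL :: "nat \<Rightarrow> pgen free \<Rightarrow> cross \<Rightarrow> cross" where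
  "PL n \<equiv> act scale (pgen_op n)"

interpretation PL: free_module scale "pgen_op n" for n
proof (intro free_module.intro free_module_axioms.intro scale.vector_space_axioms)
  fix g show "lin (pgen_op n g)" by (cases g) (simp_all add: E_lmult_lin SL_lin2)
qed

definition Phi :: "nat \<Rightarrow> pgen free \<Rightarrow> cross" where
  "Phi n p = PL n p (tensor 1 1)"

lemma PL_mon1: "PL n (mon [g]) z = pgen_op n g z"
  by (simp add: PL.act_mon)

lemma cross_mult_PL: "cross_mult (PL n p x) y = PL n p (cross_mult x y)"
proof (induction p rule: free_induct)
  case (mon w)
  have "cross_mult (pgen_op n g x) y = pgen_op n g (cross_mult x y)" for g x
    by (cases g) (simp_all add: cross_mult_E cross_mult_SL)
  then show ?case by (induction w) (simp_all add: PL.act_mon)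
qed (simp_all add: PL.act_left cross_mult_simps)

lemma cross_mult_Phi: "cross_mult (Phi n p) y = PL n p y"
  unfolding Phi_def cross_mult_PL cross_mult_one ..

lemma Phi_mult: "Phi n (p * r) = cross_mult (Phi n p) (Phi n r)"
  unfolding cross_mult_Phi by (simp add: Phi_def PL.act_mult)

lemma Phi_simps: "Phi n (x + y) = Phi n x + Phi n y" "Phi n (x - y) = Phi n x - Phi n y" "Phi n 0 = 0"
   "Phi n (scale c x) = scale c (Phi n x)" "Phi n 1 = tensor 1 1"
  by (simp_all add: Phi_def PL.act_left PL.act_one)

abbreviation pgens :: "nat \<Rightarrow> pgen set" where
  "pgens n \<equiv> GU ` {1..n - 1} \<union> {GW, GZ}"

lemma pres_induct [consumes 1, case_names zero add scale mon]:
  assumes "x \<in> carrier (pres_free n)" "P 0" "\<And>x y. P x \<Longrightarrow> P y \<Longrightarrow>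
      P (x + y)" "\<And>c x. P x \<Longrightarrow> P (scale c x)"
    "\<And>e. set e \<subseteq> pgens n \<Longrightarrow> P (mon e)"
  shows "P x"
proof -
  have "Poly_Mapping.keys x \<subseteq> {w. set (letters w) \<subseteq> pgens n}"
    using assms(1) by (auto simp: pres_free_def carrier_free_alg)
  then show ?thesis
    by (rule span_basis_induct) (use assms(2-) in \<open>auto, metis word.collapse\<close>)
qed

lemma z_vec_tens: "n \<ge> 2 \<Longrightarrow> z_vec n \<in> tens n 2"
  unfolding z_vec_def by (intro tens_scale tens_diff) (auto simp: tens_mon)

lemma nn_tens: "n \<ge> 2 \<Longrightarrow> mon [n, n] \<in> tens n 2"
  by (auto simp: tens_mon)

lemma pgen_op_CC: "n \<ge> 2 \<Longrightarrow> g \<in> pgens n \<Longrightarrow> z \<in> CC n \<Longrightarrow>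
    pgen_op n g z \<in> CC n"
  by (cases g) (auto intro!: E_lmult_CC SL_CC tens_TVV[of 2] z_vec_tens nn_tens)

lemma PL_CC: "p \<in> carrier (pres_free n) \<Longrightarrow> n \<ge> 2 \<Longrightarrow>
    z \<in> CC n \<Longrightarrow> PL n p z \<in> CC n"
proof (induction p rule: pres_induct)
  case (mon w)
  then show ?case by (induction w) (auto simp: PL.act_mon intro!: pgen_op_CC)
qed (auto simp: PL.act_left CC_zero intro: CC_add CC_scale)

lemma one_CC: "tensor 1 1 \<in> CC n"
  by (rule tensor_CC) (simp_all add: TVV_one Uplus_free_def carrier_free_alg_0_1)

lemma Phi_CC: "n \<ge> 2 \<Longrightarrow> p \<in> carrier (pres_free n) \<Longrightarrow> Phi n p \<in> CC n"
  unfolding Phi_def by (intro PL_CC one_CC)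

subsection \<open>From the cross product to the presentation\<close>

text \<open>The second clause is meant for the empty word; words of odd length, where it ignores the
  last letter, lie outside \<open>TVV\<close>. Indices are reversed, \<open>Y a b\<close> standing
  for v_(n-a) \<otimes> v_(n-b).\<close>

fun Y_word :: "nat \<Rightarrow> nat list \<Rightarrow> palg" where
  "Y_word n (a # b # v) = pY (n - a) (n - b) * Y_word n v"
| "Y_word n v = 1"

definition YL :: "nat \<Rightarrow> nat free \<Rightarrow> palg" where
  "YL n = lext psc (\<lambda>w. Y_word n (letters w))"

definition UW :: "nat \<Rightarrow> nat free \<Rightarrow> palg" where
  "UW n = lext psc (\<lambda>w. prod_list (map (\<lambda>i. pu (n - i)) (letters w)))"

definition Theta :: "nat \<Rightarrow> cross \<Rightarrow> palg" where
  "Theta n = lext psc (\<lambda>k. Y_word n (letters (fst k)) * prod_list (map (\<lambda>i. pu (n - i)) (letters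
      (snd k))))"

lemma psc_lext: "lext psc f (x + y) = lext psc f x + lext psc f y" "lext psc f (scale c x) = psc c (lext psc f x)"
   "lext psc f 0 = 0" "lext psc f (x - y) = lext psc f x - lext psc f y"
  using linear_lext[OF psc.vector_space_axioms, of f]
  unfolding module_hom_iff_linear[symmetric]
  by (auto simp: module_hom.add module_hom.scale module_hom.zero module_hom.diff)

lemmas YL_simps = psc_lext[where f = "\<lambda>w. Y_word n (letters w)" for n, folded YL_def]
lemmas UW_simps = psc_lext[where f = "\<lambda>w. prod_list (map (\<lambda>i. pu (n - i)) (letters w))" for n,
    folded UW_def]
lemmas Theta_simps = psc_lext[where f = "\<lambda>k. Y_word n (letters (fst k)) * prod_list (map (\<lambda>i. pu
    (n - i)) (letters (snd k)))" for n, folded Theta_def]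

lemma YL_mon: "YL n (mon v) = Y_word n v"
  by (simp add: YL_def psc.vector_space_axioms)

lemma UW_mon: "UW n (mon e) = prod_list (map (\<lambda>i. pu (n - i)) e)"
  by (simp add: UW_def psc.vector_space_axioms)

lemma Theta_tensor: "Theta n (tensor a x) = YL n a * UW n x"
proof (induction a rule: free_induct)
  case (mon v)
  show ?case
  proof (induction x rule: free_induct)
    case (mon e)
    show ?case by (simp add: tensor_basis Theta_def YL_mon UW_mon psc.vector_space_axioms)
  qed (simp_all add: tensor_simps Theta_simps UW_simps distrib_left)
qed (simp_all add: tensor_simps Theta_simps YL_simps distrib_right)

lemma UW_mult: "UW n (x * y) = UW n x * UW n y"
proof (induction x rule: free_induct)
  case (mon v)
  show ?case by (induction y rule: free_induct) (simp_all add: UW_simps UW_mon mon_mult distrib_left)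
qed (simp_all add: UW_simps distrib_right)

lemma Y_word_append: "even (length u) \<Longrightarrow> Y_word n (u @ v) = Y_word n u * Y_word n v"
  by (induction n u rule: Y_word.induct) (auto simp: mult.assoc)

lemma YL_mult:
  assumes "a \<in> carrier (TVV n')"
  shows "YL n (a * b) = YL n a * YL n b"
  using assms
proof (induction a rule: TVV_induct)
  case (mon v)
  then show ?case
    by (induction b rule: free_induct)
      (auto simp: YL_simps YL_mon mon_mult distrib_left Y_word_append even_words_def)
qed (simp_all add: YL_simps distrib_right)

lemma even_words_induct [consumes 1, case_names Nil Cons]:
  assumes "v \<in> even_words n" "P []"
    "\<And>a b v. a \<in> {1..n} \<Longrightarrow> b \<in> {1..n} \<Longrightarrow>
        v \<in> even_words n \<Longrightarrow> P v \<Longrightarrow> P (a # b # v)"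
  shows "P v"
  using assms(1)
proof (induction v rule: induct_list012)
  case (3 a b v)
  then show ?case using assms(3)[of a b v] by (auto simp: even_words_def)
qed (use assms(2) in \<open>auto simp: even_words_def\<close>)

lemma wt1_eq_wt:
  assumes "i \<in> {1..n - 1}" "a \<in> {1..n}"
  shows "wt1 (n - i) (n - a) = wt i [a]"
  using assms by (auto simp: wt1_def wt_def)

lemma pair_action:
  assumes "i \<in> {1..n - 1}" "a \<in> {1..n}" "b \<in> {1..n}"
  shows "ad (n - i) (YL n (mon [a, b])) = YL n (Eop i (mon [a, b]))"
    "kap (n - i) (YL n (mon [a, b])) = YL n (Kop i (mon [a, b]))"
proof -
  have k: "n - i \<ge> 1" and eq: "n - i = n - x + 1 \<longleftrightarrow> x = i + 1" if "x \<in> {1..n}" for x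
    using assms(1) that by auto
  have "Eop i (mon [a] * mon [b]) = (if a = i + 1 then mon [i, b] else 0) + (if b
      = i + 1 then scale (qq powi wt i [a]) (mon [a, i]) else 0)"
    unfolding Eop_mult Eop_letter Kop_mon by (simp add: mon_mult)
  then have "Eop i (mon [a, b]) = (if a = i + 1 then mon [i, b] else 0) + (if b
      = i + 1 then scale (qq powi wt i [a]) (mon [a, i]) else 0)"
    by (simp add: mon_mult)
  then show "ad (n - i) (YL n (mon [a, b])) = YL n (Eop i (mon [a, b]))"
    using eq[OF assms(2)] eq[OF assms(3)] wt1_eq_wt[OF assms(1,2)]
    by (auto simp: YL_simps YL_mon ad_pY)
  show "kap (n - i) (YL n (mon [a, b])) = YL n (Kop i (mon [a, b]))"
    using wt1_eq_wt[OF assms(1,2)] wt1_eq_wt[OF assms(1,3)] kap_pY[OF k[OF assms(2)], of "n - a" "n - b"]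
    by (simp add: Kop_mon YL_simps YL_mon wt_Cons[of i a "[b]"])
qed

lemma YL_action:
  assumes "i \<in> {1..n - 1}" "a \<in> carrier (TVV n)"
  shows "ad (n - i) (YL n a) = YL n (Eop i a)" "kap (n - i) (YL n a) = YL n (Kop i a)"
proof -
  have "ad (n - i) (YL n a) = YL n (Eop i a) \<and> kap (n - i) (YL n a) = YL n (Kop i a)"
    using assms(2)
  proof (induction a rule: TVV_induct)
    case (mon v)
    then show ?case
    proof (induction v rule: even_words_induct)
      case Nil
      then show ?case
        by (simp add: Eop_one Kop_one YL_simps flip: one_eq_mon) (simp add: one_eq_mon YL_mon ad_def kap_simps)
    next
      case (Cons a b v)
      have t: "mon [a, b] \<in> tens n 2" using Cons by (auto simp: tens_mon)
      have m: "mon (a # b # v) = mon [a, b] * mon v" by (simp add: mon_mult)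
      note tv = tens_TVV[of 2, simplified, OF t] tens_TVV[of 2, simplified,
          OF Eop_tens[OF t assms(1)]] tens_TVV[of 2, simplified, OF Kop_tens[OF t]]
      show ?case
        unfolding m Eop_mult Kop_mult YL_simps YL_mult[OF tv(1)] YL_mult[OF tv(2)] YL_mult[OF tv(3)] ad_mult kap_simps
        using pair_action[OF assms(1) Cons(1,2)] Cons(4) by simp
    qed
  qed (auto simp: YL_simps Eop_simps Kop_simps ad_simps kap_simps ad_mod.E_lin)
  then show "ad (n - i) (YL n a) = YL n (Eop i a)" "kap (n - i) (YL n a) = YL n (Kop i a)" by auto
qed

lemma Theta_SL: "a \<in> carrier (TVV n') \<Longrightarrow> Theta n (SL a z) = YL n a * Theta n z"
  by (induction z rule: cross_induct)
    (simp_all add: SL_simps Theta_simps SL_tensor Theta_tensor YL_mult distrib_left mult.assoc)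

text \<open>\<open>YL\<close> turns E_i and K_i into \<open>ad\<close> and \<open>kap\<close> at n -
  i, so the cross relation becomes the tautology u x = ad(x) + kappa(x) u.\<close>

lemma Theta_E_lmult:
  assumes "z \<in> CC n" "i \<in> {1..n - 1}"
  shows "Theta n (E_lmult i z) = pu (n - i) * Theta n z"
  using assms(1)
proof (induction z rule: CC_induct)
  case (tensor v e)
  then have "mon v \<in> carrier (TVV n)" by (simp add: TVV_mon)
  from YL_action[OF assms(2) this] show ?case
    by (simp add: E_lmult_tensor Theta_simps Theta_tensor UW_mult pu_mult[of "n - i" "YL n (mon v)"])
      (simp add: UW_mon)
qed (simp_all add: E_lmult_simps Theta_simps distrib_left)

lemma YL_z_vec: "n \<ge> 2 \<Longrightarrow> YL n (z_vec n) = pz"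
  using pY_pz by (simp add: z_vec_def YL_simps YL_mon)

lemma Theta_pgen_op:
  assumes "n \<ge> 2" "z \<in> CC n" "g \<in> pgens n"
  shows "Theta n (pgen_op n g z) = cls (mon [g]) * Theta n z"
  using assms(3)
proof (elim UnE imageE insertE emptyE)
  fix k assume "g = GU k" "k \<in> {1..n - 1}"
  moreover from this have "n - k \<in> {1..n - 1}" "n - (n - k) = k" by auto
  ultimately show ?thesis using Theta_E_lmult[OF assms(2), of "n - k"] by (simp add: pu_def)
next
  assume "g = GW"
  then show ?thesis using Theta_SL[OF tens_TVV[OF _ nn_tens[OF assms(1)]], of n z]
    by (simp add: YL_mon pY_00) (simp add: pw_def)
next
  assume "g = GZ"
  then show ?thesis using Theta_SL[OF tens_TVV[OF _ z_vec_tens[OF assms(1)]], of n z]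
    by (simp add: YL_z_vec[OF assms(1)] pz_def)
qed

text \<open>Compatibility with left multiplication by generators propagates along words; at z = 1
  \<otimes> 1 it says that \<open>Theta\<close> after \<open>Phi\<close> is the class map.\<close>

lemma Theta_PL:
  assumes "n \<ge> 2" "z \<in> CC n" "p \<in> carrier (pres_free n)"
  shows "Theta n (PL n p z) = cls p * Theta n z"
  using assms(3)
proof (induction p rule: pres_induct)
  case (mon w)
  then show ?case
  proof (induction w)
    case Nil
    then show ?case by (simp add: PL.act_one cls_simps flip: one_eq_mon)
  next
    case (Cons g w)
    have "PL n (mon w) z \<in> CC n"
      using Cons.prems assms by (intro PL_CC) (auto simp: pres_free_def mon_carrier)
    moreover have "cls (mon (g # w)) = cls (mon [g]) * cls (mon w)"
      by (simp add: mon_mult flip: cls_simps)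
    ultimately show ?case
      using Cons Theta_pgen_op[OF assms(1), of "PL n (mon w) z" g] by (simp add: PL.act_mon mult.assoc)
  qed
qed (simp_all add: PL.act_left Theta_simps cls_simps distrib_right)

lemma YL_one: "YL n 1 = 1" and UW_one: "UW n 1 = 1"
  by (simp_all add: one_eq_mon YL_mon UW_mon)

lemma Theta_Phi: "n \<ge> 2 \<Longrightarrow> p \<in> carrier (pres_free n) \<Longrightarrow> Theta n (Phi n p)
    = cls p"
  unfolding Phi_def by (simp add: Theta_PL one_CC Theta_tensor YL_one UW_one)

subsection \<open>Generating tensors from the lowest letters\<close>

lemma E_word_zero: "i + 1 \<notin> set v \<Longrightarrow> E_word i v = 0"
  by (induction v) auto

text \<open>The raised word contains k + 1 exactly once, so its image under E_k has a single term,
  with a power of q as coefficient.\<close>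

lemma gap_word:
  assumes "k \<in> set w" "k + 1 \<notin> set w"
  obtains p s c where "w = p @ k # s" "c \<noteq> 0" "E_word k (p @ (k + 1) # s) = scale c (mon w)"
proof -
  obtain p s where w: "w = p @ k # s" using assms(1) by (meson split_list)
  have "E_word k (p @ (k + 1) # s) = scale (qq powi wt k p) (mon w)"
    using assms(2) by (simp add: w E_word_append E_word_zero mon_mult)
  then show ?thesis using w by (intro that[of p s]) auto
qed

text \<open>Descending induction on the sum of the letters: a word with a gap is an E_k-image of a
  word with larger sum. Gap-free words are left to \<open>base\<close>, where every word of larger
  sum is available. Used in degree 2 for surjectivity and in degree 4 for the quadratic
  relations.\<close>

lemma word_generation:
  fixes P :: "nat free \<Rightarrow> bool"
  assumes scale: "\<And>c x. P x \<Longrightarrow> P (scale c x)"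
    and E: "\<And>k w. k \<in> {1..n - 1} \<Longrightarrow> set w \<subseteq> {1..n} \<Longrightarrow> length w
        = d \<Longrightarrow> P (mon w) \<Longrightarrow> P (E_word k w)"
    and base: "\<And>w. set w \<subseteq> {1..n} \<Longrightarrow> length w = d \<Longrightarrow>
        (\<forall>k\<in>set w. k < n \<longrightarrow> k + 1 \<in> set w) \<Longrightarrow>
      (\<And>w'. set w' \<subseteq> {1..n} \<Longrightarrow> length w' = d \<Longrightarrow>
          sum_list w' > sum_list w \<Longrightarrow> P (mon w')) \<Longrightarrow> P (mon w)"
    and "set w \<subseteq> {1..n}" "length w = d"
  shows "P (mon w)"
  using assms(4,5)
proof (induction "n * d - sum_list w" arbitrary: w rule: less_induct)
  case less
  have bound: "sum_list w' \<le> n * d" if "set w' \<subseteq> {1..n}" "length w' = d" for w'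
  proof -
    have "sum_list w' \<le> sum_list (map (\<lambda>_. n) w')"
      using sum_list_mono[of w' "\<lambda>x. x" "\<lambda>_. n"] that(1) by force
    then show ?thesis using that by (simp add: sum_list_triv mult.commute)
  qed
  have IH: "P (mon w')" if "set w' \<subseteq> {1..n}" "length w' = d" "sum_list w' > sum_list w" for w'
    using less.hyps[of w'] that bound[OF that(1,2)] by auto
  show ?case
  proof (cases "\<forall>k\<in>set w. k < n \<longrightarrow> k + 1 \<in> set w")
    case True
    then show ?thesis using base less.prems IH by blast
  next
    case False
    then obtain k where k: "k \<in> set w" "k < n" "k + 1 \<notin> set w" by blast
    obtain p s c where c: "w = p @ k # s" "c \<noteq> 0" "E_word k (p @ (k + 1) # s) = scale c (mon w)"
      using gap_word[OF k(1,3)] .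
    have k': "k \<in> {1..n - 1}" using k less.prems by auto
    have "P (mon (p @ (k + 1) # s))"
      by (rule IH) (use less.prems k c in auto)
    then have "P (scale c (mon w))"
      unfolding c(3)[symmetric] using less.prems k c k' by (intro E) auto
    then have "P (scale (inverse c) (scale c (mon w)))" by (rule scale)
    then show ?thesis using c(2) by simp
  qed
qed

section \<open>The quadratic relations\<close>

text \<open>Replacing \<open>pp\<close> by an opaque P with q P = 1 turns the coefficient identities
  below into polynomial identities in two commuting letters, which these rewrite rules normalise
  without division.\<close>

lemma qP_rules:
  fixes x P :: Cq
  assumes "qq * P = 1"
  shows "qq * P = 1" "P * qq = 1" "qq * (P * x) = x" "P * (qq * x) = x"
  using assms by (simp_all add: mult.commute flip: mult.assoc)

lemmas lookup_simps = lookup_add lookup_minus lookup_uminus lookup_scale lookup_zero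

lemma Psi_i_words:
  "Psi_i (Suc 0) (mon [x, y, z, t]) = (if x = y then scale pp (mon [x, y, z, t]) else if x < y then mon [y, x, z, t]
     else mon [y, x, z, t] - scale (qq - pp) (mon [x, y, z, t]))"
  "Psi_i 2 (mon [x, y, z, t]) = (if y = z then scale pp (mon [x, y, z, t]) else if y < z then mon [x, z, y, t]
     else mon [x, z, y, t] - scale (qq - pp) (mon [x, y, z, t]))"
  "Psi_i 3 (mon [x, y, z, t]) = (if z = t then scale pp (mon [x, y, z, t]) else if z < t then mon [x, y, t, z]
     else mon [x, y, t, z] - scale (qq - pp) (mon [x, y, z, t]))"
  by (simp_all add: Psi_i_def T_op_def mon_mult left_diff_distrib right_diff_distrib numeral_2_eq_2 numeral_3_eq_3)

text \<open>\<open>rA\<close> and \<open>rB\<close> are the images of the relators for \<open>[z, w]\<close> and \<open>[w, [w, u\<^sub>1]]\<close>, where \<open>c = n\<close>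
  and \<open>b = n - 1\<close>; \<open>rC\<close> and \<open>rD\<close> are the parts in \<open>V\<^sup>\<otimes>\<^sup>4\<close> of the images of the last two relators, where \<open>a = n - 2\<close>.
  The preimages \<open>xA\<close>, \<dots>, \<open>xD\<close> under \<open>\<Psi> - 1\<close> were found by solving linear systems.\<close>

definition rA :: "nat \<Rightarrow> nat \<Rightarrow> nat free" where
  "rA b c = scale (qq ^ 2) (mon [c, c, c, b]) - scale qq (mon [c, c, b, c]) - scale (qq ^ 2) (mon [c, b, c, c])
    + scale qq (mon [b, c, c, c])"

definition rB :: "nat \<Rightarrow> nat \<Rightarrow> nat free" where
  "rB b c = - scale (qq ^ 3) (mon [c, c, c, b]) - mon [c, c, b, c] + scale pp (mon [c, b, c, c])
    + mon [b, c, c, c]"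

definition rC :: "nat \<Rightarrow> nat \<Rightarrow> nat \<Rightarrow> nat free" where
  "rC a b c = scale (qq ^ 6) (mon [c, c, b, a]) - scale (qq ^ 5) (mon [c, c, a, b])
    - scale (qq ^ 5) (mon [c, b, c, a]) + scale (qq ^ 4 - 1 - qq ^ 6) (mon [c, b, a, c])
    + scale (qq ^ 4) (mon [c, a, c, b]) + scale (qq ^ 5 - qq - qq ^ 3) (mon [c, a, b, c])
    + mon [b, c, c, a] + scale (qq ^ 5) (mon [b, c, a, c]) - scale (qq ^ 4) (mon [b, a, c, c])
    + scale qq (mon [a, c, c, b]) - scale (qq ^ 4) (mon [a, c, b, c])
    + scale (qq ^ 3) (mon [a, b, c, c])"

definition rD :: "nat \<Rightarrow> nat \<Rightarrow> nat \<Rightarrow> nat free" where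
  "rD a b c = scale (1 - qq ^ 4) (mon [c, c, b, a]) + scale (qq ^ 3 - pp) (mon [c, c, a, b])
    + scale (qq - qq ^ 3 - 2 * qq ^ 5) (mon [c, b, c, a]) + scale (qq ^ 2 + qq ^ 4) (mon [c, b, a, c])
    + scale (qq ^ 2 + 2 * qq ^ 4 - 1) (mon [c, a, c, b]) + scale (- qq - qq ^ 3) (mon [c, a, b, c])
    + scale (qq ^ 2 + 2 * qq ^ 4 - 1) (mon [b, c, c, a]) + scale (- qq - qq ^ 3) (mon [b, c, a, c])
    + scale (pp - qq - 2 * qq ^ 3) (mon [a, c, c, b]) + scale (1 + qq ^ 2) (mon [a, c, b, c])"

definition xA :: "nat \<Rightarrow> nat \<Rightarrow> nat free" where
  "xA b c = scale (pp ^ 2 - 1 - qq ^ 2) (mon [c, c, c, b]) + scale pp (mon [c, c, b, c])"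

definition xB :: "nat \<Rightarrow> nat \<Rightarrow> nat free" where
  "xB b c = scale (pp ^ 3 + qq ^ 3 - pp) (mon [c, c, c, b]) + scale (pp ^ 2) (mon [c, c, b, c])"

definition xC :: "nat \<Rightarrow> nat \<Rightarrow> nat \<Rightarrow> nat free" where
  "xC a b c = - scale (qq ^ 8) (mon [c, a, c, b]) + scale pp (mon [c, a, b, c])
    + scale (1 + qq ^ 6 - pp ^ 2) (mon [b, a, c, c]) - scale qq (mon [a, c, c, b])
    + scale (qq ^ 4) (mon [a, c, b, c]) - scale (qq ^ 3) (mon [a, b, c, c])"

definition xD :: "nat \<Rightarrow> nat \<Rightarrow> nat \<Rightarrow> nat free" where
  "xD a b c = scale (2 * qq ^ 3 + qq ^ 5 - pp) (mon [c, b, c, a]) + scale (- 1 - qq ^ 2) (mon [c, b, a, c])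
    + scale (- (qq ^ 2) - qq ^ 4) (mon [b, c, c, a]) + scale (pp + qq) (mon [b, c, a, c])
    + scale (qq ^ 3 - pp) (mon [a, c, c, b])"

text \<open>Consecutive letters are written with \<open>Suc\<close>, so that simplification decides
  every comparison in \<open>Psi_i_words\<close>; the identity is then checked coordinate by
  coordinate.\<close>

lemma Psi_x:
  shows "Psi (xA b (Suc b)) - xA b (Suc b) = rA b (Suc b)" (is ?gA)
    "Psi (xB b (Suc b)) - xB b (Suc b) = rB b (Suc b)" (is ?gB)
    "Psi (xC a (Suc a) (Suc (Suc a))) - xC a (Suc a) (Suc (Suc a)) = rC a (Suc a) (Suc (Suc a))" (is ?gC)
    "Psi (xD a (Suc a) (Suc (Suc a))) - xD a (Suc a) (Suc (Suc a)) = rD a (Suc a) (Suc (Suc a))" (is ?gD)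
proof -
  obtain P where P: "pp = P" "qq * P = 1" by simp
  show ?gA ?gB ?gC ?gD
    unfolding xA_def xB_def xC_def xD_def rA_def rB_def rC_def rD_def Psi_def
    by ((rule poly_mapping_eqI; simp add: Psi_i_words Psi_i_simps del: scale.scale_scale;
        simp only: lookup_simps P(1) power2_eq_square;
        simp add: qP_rules[OF P(2)] algebra_simps eval_nat_numeral)+)
qed

section \<open>Images of the relators in the free cross product\<close>

lemma PL_bracket: "PL n (bracket v p r) z = PL n p (PL n r z) - scale v (PL n r (PL n p z))"
  by (simp add: bracket_def PL.act_left PL.act_mult)

lemma powi_wt:
  "qq powi wt i [] = 1" "qq powi wt i [x] = (if x = i then qq else if x = Suc i then pp else 1)"
  "qq powi wt i (x # y # v) = qq powi wt i [x] * qq powi wt i (y # v)"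
  by (auto simp: wt_Nil wt_Cons[of i x "y # v"] power_int_add) (auto simp: wt_def power_int_minus)

lemmas PL_eval = PL_bracket PL.act_left PL.act_mult PL.act_mon SL_simps SL_tensor tensor_simps E_lmult_tensor
    E_lmult_simps
  z_vec_def mon_mult Eop_simps Eop_mon Kop_mon Kop_simps powi_wt
  distrib_left distrib_right left_diff_distrib right_diff_distrib

lemma Phi_commutator_zw: "Phi (Suc b) (zz * ww - ww * zz) = tensor (rA b (Suc b)) (mon [])"
  (is "?x = ?y")
proof (rule poly_mapping_eqI)
  fix k
  obtain P where P: "pp = P" "qq * P = 1" by simp
  show "Poly_Mapping.lookup ?x k = Poly_Mapping.lookup ?y k"
    unfolding Phi_def one_eq_mon hh_def rA_def
    by (simp add: PL_eval del: scale.scale_scale;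
        simp only: lookup_simps P(1) power2_eq_square;
        simp add: qP_rules[OF P(2)] algebra_simps eval_nat_numeral)
qed

lemma Phi_w3: "Phi (Suc b) (bracket (pp ^ 2) (ug 1) (bracket (qq ^ 2) (ug 1) (bracket 1 (ug 1) ww))) =
  0"
  (is "?x = ?y")
proof (rule poly_mapping_eqI)
  fix k
  obtain P where P: "pp = P" "qq * P = 1" by simp
  show "Poly_Mapping.lookup ?x k = Poly_Mapping.lookup ?y k"
    unfolding Phi_def one_eq_mon hh_def
    by (simp add: PL_eval del: scale.scale_scale;
        simp only: lookup_simps P(1) power2_eq_square;
        simp add: qP_rules[OF P(2)] algebra_simps eval_nat_numeral)
qed

lemma Phi_z2: "Phi (Suc (Suc a)) (bracket pp (ug 2) (bracket qq (ug 2) zz)) = 0"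
  (is "?x = ?y")
proof (rule poly_mapping_eqI)
  fix k
  obtain P where P: "pp = P" "qq * P = 1" by simp
  show "Poly_Mapping.lookup ?x k = Poly_Mapping.lookup ?y k"
    unfolding Phi_def one_eq_mon hh_def
    by (simp add: PL_eval del: scale.scale_scale;
        simp only: lookup_simps P(1) power2_eq_square;
        simp add: qP_rules[OF P(2)] algebra_simps eval_nat_numeral)
qed

lemma Phi_wwu: "Phi (Suc b) (bracket (pp ^ 2) ww (bracket (qq ^ 2) ww (ug 1)) + scale hh (ww * zz)) =
  tensor (rB b (Suc b)) (mon [])"
  (is "?x = ?y")
proof (rule poly_mapping_eqI)
  fix k
  obtain P where P: "pp = P" "qq * P = 1" by simp
  show "Poly_Mapping.lookup ?x k = Poly_Mapping.lookup ?y k"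
    unfolding Phi_def one_eq_mon hh_def rB_def
    by (simp add: PL_eval del: scale.scale_scale;
        simp only: lookup_simps P(1) power2_eq_square;
        simp add: qP_rules[OF P(2)] algebra_simps eval_nat_numeral)
qed

text \<open>The terms that still contain E_(n-1) or E_(n-2) cancel only modulo z w = w z; they are
  collected as multiples of \<open>rA\<close> and of its images under E. The same happens in
  \<open>Phi_zzu\<close>.\<close>

lemma Phi_zuw: "Phi (Suc (Suc a)) (bracket qq zz (bracket qq (ug 2) (bracket (qq ^ 2) (ug 1) ww))
        - bracket (qq ^ 2) ww (bracket qq (ug 1) (bracket qq (ug 2) zz))) =
  tensor (rC a (Suc a) (Suc (Suc a))) (mon []) + scale (pp - qq) (tensor (Eop (Suc a) (rA (Suc a) (Suc
      (Suc a)))) (mon [a]))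
   + scale (pp ^ 2 - 1) (tensor (rA (Suc a) (Suc (Suc a))) (mon [a, Suc a])) + scale (qq ^ 3 - qq) (tensor (rA
       (Suc a) (Suc (Suc a))) (mon [Suc a, a]))
   + scale (pp - qq) (tensor (Eop a (rA (Suc a) (Suc (Suc a)))) (mon [Suc a]))"
  (is "?x = ?y")
proof (rule poly_mapping_eqI)
  fix k
  obtain P where P: "pp = P" "qq * P = 1" by simp
  show "Poly_Mapping.lookup ?x k = Poly_Mapping.lookup ?y k"
    unfolding Phi_def one_eq_mon hh_def rA_def rC_def
    by (simp add: PL_eval del: scale.scale_scale;
        simp only: lookup_simps P(1) power2_eq_square;
        simp add: qP_rules[OF P(2)] algebra_simps eval_nat_numeral)
qed

lemma Phi_zzu: "Phi (Suc (Suc a)) (scale 2 (bracket pp zz (bracket qq zz (ug 2)))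
        - scale hh
           (zz * bracket qq (ug 1) (ug 2) * ww
            + ww * bracket pp (ug 2) (ug 1) * zz
            + ww * ug 1 * bracket qq zz (ug 2)
            + bracket pp (ug 2) zz * ug 1 * ww)) =
  tensor (rD a (Suc a) (Suc (Suc a))) (mon []) + scale (pp ^ 3 - pp) (tensor (rA (Suc a) (Suc (Suc a)))
      (mon [Suc a, a]))
   + scale (1 - pp ^ 2) (tensor (rA (Suc a) (Suc (Suc a))) (mon [a, Suc a]))
   + scale (pp ^ 3 - pp) (tensor (Eop a (rA (Suc a) (Suc (Suc a)))) (mon [Suc a]))"
  (is "?x = ?y")
proof (rule poly_mapping_eqI)
  fix k
  obtain P where P: "pp = P" "qq * P = 1" by simp
  show "Poly_Mapping.lookup ?x k = Poly_Mapping.lookup ?y k"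
    unfolding Phi_def one_eq_mon hh_def rA_def rD_def
    by (simp add: PL_eval del: scale.scale_scale;
        simp only: lookup_simps P(1) power2_eq_square;
        simp add: qP_rules[OF P(2)] algebra_simps eval_nat_numeral)
qed

lemma bracket_0: "bracket v x 0 = 0" "bracket v 0 x = 0"
  by (simp_all add: bracket_def)

lemma x_tens:
  "b \<ge> 1 \<Longrightarrow> xA b (Suc b) \<in> tens (Suc b) 4" "b \<ge> 1 \<Longrightarrow>
      xB b (Suc b) \<in> tens (Suc b) 4"
  "a \<ge> 1 \<Longrightarrow> xC a (Suc a) (Suc (Suc a)) \<in> tens (Suc (Suc a)) 4"
      "a \<ge> 1 \<Longrightarrow> xD a (Suc a) (Suc (Suc a)) \<in> tens (Suc (Suc a)) 4"
  unfolding xA_def xB_def xC_def xD_def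
  by (auto intro!: tens_add tens_diff tens_scale simp: tens_mon)

lemma r_Sq_ideal:
  "b \<ge> 1 \<Longrightarrow> rA b (Suc b) \<in> Sq_ideal (Suc b)" "b \<ge> 1 \<Longrightarrow>
      rB b (Suc b) \<in> Sq_ideal (Suc b)"
  "a \<ge> 1 \<Longrightarrow> rC a (Suc a) (Suc (Suc a)) \<in> Sq_ideal (Suc (Suc a))"
      "a \<ge> 1 \<Longrightarrow> rD a (Suc a) (Suc (Suc a)) \<in> Sq_ideal (Suc (Suc a))"
  unfolding Psi_x[symmetric] by (simp_all add: Psi_Sq_ideal x_tens)

subsection \<open>The relations of the presentation hold in the cross product\<close>

lemma E_lmult_one: "E_lmult i (tensor 1 x) = tensor 1 (mon [i] * x)"
  by (simp add: E_lmult_tensor Eop_one Kop_one tensor_simps)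

lemma serre_bracket: "bracket pp x (bracket qq x y) = serre x y"
  by (simp add: bracket_def serre_def right_diff_distrib left_diff_distrib mult.assoc
      scale.scale_left_distrib scale.scale_right_diff_distrib)

lemma Phi_serre: "Phi n (serre (ug i) (ug j)) = tensor 1 (serre (mon [n - i]) (mon [n - j]))"
  by (simp add: Phi_def serre_def PL.act_left PL.act_mult PL_mon1 E_lmult_one tensor_simps mult.assoc)

lemma Phi_uu_commutator: "Phi n (ug i * ug j - ug j * ug i) = tensor 1 (mon [n - i] * mon [n - j] - mon [n
    - j] * mon [n - i])"
  by (simp add: Phi_def PL.act_left PL.act_mult PL_mon1 E_lmult_one tensor_simps)

lemma Phi_u_commutator:
  assumes "Eop k x = 0" "Kop k x = x" "k = n - i"
  shows "E_lmult k (SL x (tensor 1 1)) - SL x (E_lmult k (tensor 1 1)) = 0"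
  using assms by (simp add: SL_tensor E_lmult_tensor Eop_one Kop_one tensor_simps)

lemma Kop_2: "wt k [x, y] = 0 \<Longrightarrow> Kop k (mon [x, y]) = mon [x, y]"
  by (simp add: Kop_mon)

lemma Phi_pres_rels:
  assumes "n \<ge> 2" "r \<in> pres_rels n"
  shows "Phi n r \<in> NN n"
proof -
  obtain b where n: "n = Suc b" "b \<ge> 1" using assms(1) by (cases n) auto
  have u: "uu n i = ug i" if "i \<in> {1..n - 1}" for i
    using that by (simp add: uu_def)
  have u1: "uu n 1 = ug 1" using assms(1) by (auto simp: uu_def)
  \<comment> \<open>For n = 2 every relator containing u_2 becomes 0; otherwise n is written as a +
    2, the form in which the relators were evaluated.\<close>
  have two: "(n = 2 \<and> uu n 2 = 0) \<or> (\<exists>a\<ge>1. n = Suc (Suc a) \<and> uu n 2 = ug 2)"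
  proof (cases "n = 2")
    case False
    then have "n = Suc (Suc (n - 2))" "n - 2 \<ge> 1" using assms(1) by auto
    then show ?thesis using u[of 2] by auto
  qed (simp add: uu_def)
  have zw: "tensor x (mon e) \<in> NN n" if "x \<in> Sq_ideal n" "set e \<subseteq> {1..n - 1}" for x e
    using that by (intro NN_tensor(1)) (auto simp: Uplus_mon)
  show ?thesis using assms(2)[unfolded pres_rels_eq]
  proof (cases rule: prels_cases)
    case (1 i j)
    have "n - i \<in> {1..n - 1}" "n - j \<in> {1..n - 1}" "n - i = n - j + 1 \<or> n - j = n - i + 1"
      using 1(2-4) by auto
    then have "serre (mon [n - i]) (mon [n - j]) \<in> Serre_rels n"
      unfolding Serre_rels_def by blast
    then have "serre (mon [n - i]) (mon [n - j]) \<in> Uplus_kernel n"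
      using rideal_Serre_rels_imp_genideal(1)[OF _ rideal.zero, of n] carrier_free_alg_0_1(1)
      by (auto simp: Uplus_kernel_eq Uplus_free_def intro: rideal.incl)
    then show ?thesis unfolding 1(1) u[OF 1(2)] u[OF 1(3)] serre_bracket Phi_serre
      by (intro NN_tensor(2) TVV_one)
  next
    case (2 i j)
    have "n - i \<in> {1..n - 1}" "n - j \<in> {1..n - 1}" "n - i + 1 < n - j \<or> n - j + 1 < n - i"
      using 2(2-4) by auto
    then have "mon [n - i] * mon [n - j] - mon [n - j] * mon [n - i] \<in> Serre_rels n"
      unfolding Serre_rels_def by blast
    then have "mon [n - i] * mon [n - j] - mon [n - j] * mon [n - i] \<in> Uplus_kernel n"
      using rideal_Serre_rels_imp_genideal(1)[OF _ rideal.zero, of n] carrier_free_alg_0_1(1)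
      by (auto simp: Uplus_kernel_eq Uplus_free_def intro: rideal.incl)
    then show ?thesis unfolding 2(1) u[OF 2(2)] u[OF 2(3)] Phi_uu_commutator
      by (intro NN_tensor(2) TVV_one)
  next
    case (3 i)
    have k: "n - i \<noteq> n" "n - i + 1 \<noteq> n" using 3(2,3) by auto
    then have "Eop (n - i) (mon [n, n]) = 0" "Kop (n - i) (mon [n, n]) = mon [n, n]"
      using E_word_zero[of "n - i" "[n, n]"] by (simp_all add: Eop_mon Kop_2 wt_def)
    from Phi_u_commutator[OF this refl] show ?thesis
      unfolding 3(1) u[OF 3(2)] by (simp add: Phi_def PL.act_left PL.act_mult PL_mon1 NN_intros)
  next
    case (4 i)
    have k: "n - i \<noteq> n" "n - i + 1 \<noteq> n - 1" using 4(2,3) by auto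
    \<comment> \<open>For i = 1 the two terms of z contribute q and -q to v_(n-1) \<otimes> v_(n-1);
      for i > 2 the letter lowered by E_(n-i) does not occur.\<close>
    have "Eop (n - i) (z_vec n) = 0"
    proof (cases "i = 1")
      case True
      then show ?thesis using n by (simp add: z_vec_def Eop_simps Eop_mon mon_mult powi_wt)
    next
      case False
      then have "n - i + 1 \<notin> set [n - 1, n]" "n - i + 1 \<notin> set [n, n - 1]" using k 4(2) by auto
      then show ?thesis using E_word_zero[of "n - i" "[n - 1, n]"] E_word_zero[of "n - i" "[n, n - 1]"]
        by (simp add: z_vec_def Eop_simps Eop_mon)
    qed
    moreover have "wt (n - i) [n - 1, n] = 0" "wt (n - i) [n, n - 1] = 0"
      using 4(2,3) n by (auto simp: wt_def)
    then have "Kop (n - i) (z_vec n) = z_vec n"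
      by (simp add: z_vec_def Kop_simps Kop_2)
    ultimately show ?thesis
      using Phi_u_commutator[OF _ _ refl]
      unfolding 4(1) u[OF 4(2)] by (simp add: Phi_def PL.act_left PL.act_mult PL_mon1 NN_intros)
  next
    case 5
    then show ?thesis using n zw[OF r_Sq_ideal(1)[OF n(2), folded n(1)], of "[]"] Phi_commutator_zw[of b] by simp
  next
    case 6
    then show ?thesis unfolding u1 using Phi_w3[of b] n by (simp add: NN_intros)
  next
    case 7
    from two show ?thesis
    proof (elim disjE exE conjE)
      fix a assume "n = Suc (Suc a)" "uu n 2 = ug 2"
      then show ?thesis using Phi_z2[of a] 7 by (simp add: NN_intros)
    qed (simp add: 7 bracket_0 Phi_simps NN_intros)
  next
    case 8
    then show ?thesis unfolding u1 using n zw[OF r_Sq_ideal(2)[OF n(2), folded n(1)], of "[]"] Phi_wwu[of b] by simp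
  next
    case 9
    from two show ?thesis
    proof (elim disjE exE conjE)
      fix a assume a: "n = Suc (Suc a)" "uu n 2 = ug 2" "1 \<le> a"
      have b: "b = Suc a" using a n by simp
      have "rA (Suc a) (Suc (Suc a)) \<in> Sq_ideal n" "rC a (Suc a) (Suc (Suc a)) \<in> Sq_ideal n"
        using r_Sq_ideal(1)[OF n(2)] r_Sq_ideal(3)[OF a(3)] b n a by simp_all
      then show ?thesis unfolding 9 u1 a(2) using a(3) unfolding a(1) Phi_zuw
        by (intro NN_intros(2,3) zw[unfolded a(1)] Sq_ideal_stable(1)) auto
    qed (simp add: 9 bracket_0 Phi_simps NN_intros)
  next
    case 10
    from two show ?thesis
    proof (elim disjE exE conjE)
      fix a assume a: "n = Suc (Suc a)" "uu n 2 = ug 2" "1 \<le> a"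
      have b: "b = Suc a" using a n by simp
      have "rA (Suc a) (Suc (Suc a)) \<in> Sq_ideal n" "rD a (Suc a) (Suc (Suc a)) \<in> Sq_ideal n"
        using r_Sq_ideal(1)[OF n(2)] r_Sq_ideal(4)[OF a(3)] b n a by simp_all
      then show ?thesis unfolding 10 u1 a(2) using a(3) unfolding a(1) Phi_zzu
        by (intro NN_intros(2,3) zw[unfolded a(1)] Sq_ideal_stable(1)) auto
    qed (simp add: 10 bracket_0 Phi_simps NN_intros)
  qed
qed

subsection \<open>The quadratic relations hold in the presented algebra\<close>

lemma carrier_bracket: "x \<in> carrier (free_alg X) \<Longrightarrow>
    y \<in> carrier (free_alg X) \<Longrightarrow> bracket v x y \<in> carrier (free_alg X)"
  unfolding bracket_def by (intro carrier_free_alg_intros)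

lemma Theta_Phi_all_rels:
  assumes "n \<ge> 2" "r \<in> prels {1..} ug" "r \<in> carrier (pres_free n)"
  shows "Theta n (Phi n r) = 0"
  using Theta_Phi[OF assms(1,3)] all_relsI[OF assms(2)] by simp

text \<open>The relator has class 0, and its image under \<open>Phi\<close> is already known to be
  \<open>rA\<close> tensored with 1, so applying \<open>Theta\<close> gives the claim without a
  computation in the presented algebra. The next lemmas repeat the argument.\<close>

lemma YL_rA: assumes "b \<ge> 1" shows "YL (Suc b) (rA b (Suc b)) = 0"
proof -
  have "zz * ww - ww * zz \<in> prels {1..} ug" unfolding prels_def by blast
  then have "Theta (Suc b) (Phi (Suc b) (zz * ww - ww * zz)) = 0"
    using assms unfolding pres_free_def
    by (intro Theta_Phi_all_rels) (auto simp: pres_free_def mon_carrier intro!: carrier_free_alg_intros)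
  then show ?thesis by (simp add: Phi_commutator_zw Theta_tensor UW_mon)
qed

lemma YL_rB: assumes "b \<ge> 1" shows "YL (Suc b) (rB b (Suc b)) = 0"
proof -
  let ?r = "bracket (pp ^ 2) ww (bracket (qq ^ 2) ww (ug 1)) + scale hh (ww * zz)"
  have "?r \<in> prels {1..} ug" unfolding prels_def by blast
  then have "Theta (Suc b) (Phi (Suc b) ?r) = 0"
    using assms unfolding pres_free_def
    by (intro Theta_Phi_all_rels)
        (auto simp: pres_free_def mon_carrier intro!: carrier_free_alg_intros carrier_bracket)
  then show ?thesis unfolding Phi_wwu by (simp add: Theta_tensor UW_mon)
qed

lemma YL_Eop_0: "i \<in> {1..n - 1} \<Longrightarrow> x \<in> carrier (TVV n) \<Longrightarrow> YL n x
    = 0 \<Longrightarrow> YL n (Eop i x) = 0"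
  using YL_action(1)[of i n x] by (simp add: ad_mod.E_lin)

lemma YL_rC_rD: assumes "a \<ge> 1" shows "YL (Suc (Suc a)) (rC a (Suc a) (Suc (Suc a)))
    = 0" "YL (Suc (Suc a)) (rD a (Suc a) (Suc (Suc a))) = 0"
proof -
  let ?n = "Suc (Suc a)"
  have A: "YL ?n (rA (Suc a) (Suc (Suc a))) = 0" using YL_rA[of "Suc a"] by simp
  have "rA (Suc a) (Suc (Suc a)) \<in> carrier (TVV ?n)"
    using r_Sq_ideal(1)[of "Suc a"] by (intro Sq_ideal_TVV) simp
  then have E: "YL ?n (Eop (Suc a) (rA (Suc a) (Suc (Suc a)))) = 0" "YL ?n (Eop a (rA (Suc a) (Suc (Suc a)))) = 0"
    using YL_Eop_0[OF _ _ A, of "Suc a"] YL_Eop_0[OF _ _ A, of a] assms by auto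
  let ?r = "bracket qq zz (bracket qq (ug 2) (bracket (qq ^ 2) (ug 1) ww))
        - bracket (qq ^ 2) ww (bracket qq (ug 1) (bracket qq (ug 2) zz))"
  have "?r \<in> prels {1..} ug" unfolding prels_def by blast
  then have "Theta ?n (Phi ?n ?r) = 0"
    using assms unfolding pres_free_def
    by (intro Theta_Phi_all_rels)
        (auto simp: pres_free_def mon_carrier intro!: carrier_free_alg_intros carrier_bracket)
  then show "YL ?n (rC a (Suc a) (Suc (Suc a))) = 0"
    unfolding Phi_zuw by (simp add: Theta_simps Theta_tensor UW_mon A E)
  let ?r = "scale 2 (bracket pp zz (bracket qq zz (ug 2)))
        - scale hh
           (zz * bracket qq (ug 1) (ug 2) * ww
            + ww * bracket pp (ug 2) (ug 1) * zz
            + ww * ug 1 * bracket qq zz (ug 2)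
            + bracket pp (ug 2) zz * ug 1 * ww)"
  have "?r \<in> prels {1..} ug" unfolding prels_def by blast
  then have "Theta ?n (Phi ?n ?r) = 0"
    using assms unfolding pres_free_def
    by (intro Theta_Phi_all_rels)
        (auto simp: pres_free_def mon_carrier intro!: carrier_free_alg_intros carrier_bracket)
  then show "YL ?n (rD a (Suc a) (Suc (Suc a))) = 0"
    unfolding Phi_zzu by (simp add: Theta_simps Theta_tensor UW_mon A E)
qed

section \<open>Vanishing of the quadratic relations on words of length four\<close>

definition qrel :: "nat \<Rightarrow> nat free \<Rightarrow> palg" where
  "qrel n x = YL n (Psi x - x)"

lemma qrel_simps: "qrel n (x + y) = qrel n x + qrel n y" "qrel n (x - y) = qrel n x - qrel n y"
   "qrel n (scale c x) = psc c (qrel n x)" "qrel n 0 = 0" "qrel n (- x) = - qrel n x"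
  by (simp_all add: qrel_def Psi_simps YL_simps psc.scale_right_diff_distrib)

lemma qrel_E_word:
  assumes "qrel n (mon w) = 0" "k \<in> {1..n - 1}" "set w \<subseteq> {1..n}" "length w = 4"
  shows "qrel n (E_word k w) = 0"
proof -
  have w: "mon w \<in> tens n 4" using assms by (simp add: tens_mon)
  have "Psi (E_word k w) - E_word k w = Eop k (Psi (mon w) - mon w)"
    using Psi_equivariant(1)[OF w assms(2)] by (simp add: Eop_simps Eop_mon)
  moreover have "Psi (mon w) - mon w \<in> carrier (TVV n)"
    using w by (intro tens_TVV[of 4] tens_diff Psi_tens) auto
  ultimately show ?thesis
    using YL_Eop_0[OF assms(2)] assms(1) unfolding qrel_def by simp
qed

text \<open>The form in which the induction hypothesis of \<open>word_generation\<close> is used: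
  E_k-images of words with larger letter sum are already settled.\<close>

definition qrel_above :: "nat \<Rightarrow> nat \<Rightarrow> bool" where
  "qrel_above n s \<longleftrightarrow> (\<forall>k w. k \<in> {1..n
      - 1} \<longrightarrow> set w \<subseteq> {1..n} \<longrightarrow> length w
      = 4 \<longrightarrow> sum_list w > s \<longrightarrow>
    qrel n (E_word k w) = 0)"

lemma qrel_aboveD:
  "qrel_above n s \<Longrightarrow> k \<in> {1..n - 1} \<Longrightarrow>
      set w \<subseteq> {1..n} \<Longrightarrow> length w = 4 \<Longrightarrow> sum_list w > s \<Longrightarrow>
    qrel n (E_word k w) = 0"
  unfolding qrel_above_def by blast

lemma qrel_eqI: "x = y \<Longrightarrow> qrel n y = 0 \<Longrightarrow> qrel n x = 0"
  by simp

lemma qrel_cancel: "scale D x = y \<Longrightarrow> D \<noteq> 0 \<Longrightarrow> qrel n y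
    = 0 \<Longrightarrow> qrel n x = 0"
  by (metis psc.scale_eq_0_iff qrel_simps(3))

lemma qq_poly_nonzero: "1 + qq ^ 2 \<noteq> 0" "1 + qq ^ 4 \<noteq> 0" "1 + qq ^ 2 + qq ^ 4 \<noteq> 0"
  by (simp_all add: qq_def Zero_fract_def One_fract_def eq_fract one_pCons eval_nat_numeral)

lemmas E_word_eval = powi_wt mon_mult distrib_left distrib_right left_diff_distrib right_diff_distrib
  scale.scale_right_distrib scale.scale_right_diff_distrib

text \<open>In each content of a word with letters \<open>n\<close>, \<open>n - 1\<close>, \<open>n - 2\<close>, the vectors \<open>xA\<close>, \<dots>, \<open>xD\<close>,
  a fixed vector of \<open>\<Psi>\<close> and the images of the \<open>E\<^sub>k\<close> span all words; the coefficients come from linear algebra over \<open>\<complex>(q)\<close>.\<close>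

definition k13 :: "nat \<Rightarrow> nat \<Rightarrow> nat free" where
  "k13 b c = mon [c, c, c, b] + mon [c, b, c, c]"

definition k22 :: "nat \<Rightarrow> nat \<Rightarrow> nat free" where
  "k22 b c = mon [c, c, b, b] + mon [b, b, c, c]"

definition k112 :: "nat \<Rightarrow> nat \<Rightarrow> nat \<Rightarrow> nat free" where
  "k112 a b c = mon [c, c, b, a] + scale (1 - qq ^ 2) (mon [c, a, c, b]) + mon [b, a, c, c]"

lemma Psi_fixed:
  shows "Psi (k13 b (Suc b)) = k13 b (Suc b)" (is ?g0)
    "Psi (k22 b (Suc b)) = k22 b (Suc b)" (is ?g1)
    "Psi (k112 a (Suc a) (Suc (Suc a))) = k112 a (Suc a) (Suc (Suc a))" (is ?g2)
    "Psi (mon [Suc b, b, Suc b, b]) = mon [Suc b, b, Suc b, b]" (is ?g3)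
    "Psi (mon [b, b, b, b]) = mon [b, b, b, b]" (is ?g4)
proof -
  obtain P where P: "pp = P" "qq * P = 1" by simp
  show ?g0 ?g1 ?g2 ?g3 ?g4
    unfolding k13_def k22_def k112_def Psi_def
    by ((rule poly_mapping_eqI; simp add: Psi_i_words Psi_i_simps del: scale.scale_scale;
        simp only: lookup_simps P(1) power2_eq_square;
        simp add: qP_rules[OF P(2)] algebra_simps eval_nat_numeral)+)
qed

text \<open>This list and the next two are triangular eliminations: a word is expressed by settled
  vectors and by words treated earlier, besides \<open>[c, b, c, b]\<close>, which Psi fixes. The
  denominators 2, 1 + q^2 and 1 + q^4 are cleared on the left and are nonzero in C(q).\<close>

lemma cert_13:
  assumes "c = Suc b"
  shows "scale (1 + qq ^ 2) (mon [c, c, c, b]) = scale (- (pp ^ 2)) (xA b c) + scale pp (xB b c)" (is ?g0)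
    "mon [c, b, c, c] = k13 b c + scale (- 1) (mon [c, c, c, b])" (is ?g1)
    "mon [c, c, b, c] = scale qq (xA b c) + scale (qq + qq ^ 3 - pp) (mon [c, c, c, b])" (is ?g2)
    "mon [b, c, c, c] = E_word b [c, c, c, c] + scale (- pp) (xA b c) + scale (- pp) (k13 b c)
      + scale (- qq) (mon [c, c, c, b])" (is ?g3)
proof -
  obtain P where P: "pp = P" "qq * P = 1" by simp
  show ?g0 ?g1 ?g2 ?g3
    unfolding k13_def xA_def xB_def assms
    by ((rule poly_mapping_eqI; simp add: E_word_eval del: scale.scale_scale;
        simp only: lookup_simps P(1) power2_eq_square;
        simp add: qP_rules[OF P(2)] algebra_simps eval_nat_numeral)+)
qed

lemma cert_22:
  assumes "c = Suc b"
  shows "scale ((1 + qq ^ 2) ^ 2) (mon [c, c, b, b]) = scale (- (qq ^ 3)) (E_word b [b, c, c, c])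
      + scale (- (qq ^ 2)) (E_word b [c, b, c, c]) + scale (qq ^ 3) (E_word b [c, c, b, c])
      + scale (qq ^ 2) (E_word b [c, c, c, b]) + scale (qq ^ 2 + qq ^ 4) (k22 b c)" (is ?g0)
    "mon [b, b, c, c] = k22 b c + scale (- 1) (mon [c, c, b, b])" (is ?g1)
    "mon [c, b, b, c] = E_word b [c, b, c, c] + scale (- pp) (mon [c, b, c, b])
      + scale (- 1) (mon [b, b, c, c])" (is ?g2)
    "mon [b, c, b, c] = E_word b [c, c, b, c] + scale (- pp) (mon [c, c, b, b])
      + scale (- pp) (mon [c, b, b, c])" (is ?g3)
    "mon [b, c, c, b] = E_word b [c, c, c, b] + scale (- pp) (mon [c, b, c, b])
      + scale (- (pp ^ 2)) (mon [c, c, b, b])" (is ?g4)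
proof -
  obtain P where P: "pp = P" "qq * P = 1" by simp
  show ?g0 ?g1 ?g2 ?g3 ?g4
    unfolding k22_def assms
    by ((rule poly_mapping_eqI; simp add: E_word_eval del: scale.scale_scale;
        simp only: lookup_simps P(1) power2_eq_square;
        simp add: qP_rules[OF P(2)] algebra_simps eval_nat_numeral)+)
qed

lemma cert_112:
  assumes "b = Suc a" "c = Suc b"
  shows "scale ((1 + qq ^ 2) * (1 + qq ^ 4)) (mon [c, c, b, a]) = scale (pp + qq) (E_word a [c, c, b, b])
      + scale (qq + qq ^ 3) (E_word a [c, b, b, c]) + scale (qq ^ 2 + qq ^ 4) (E_word a [b, c, b, c])
      + scale (- (qq ^ 3)) (E_word b [a, c, c, c]) + scale (1 - qq ^ 2 - qq ^ 4) (E_word b [c, a, c, c])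
      + scale (- qq - qq ^ 3) (E_word b [c, c, a, c]) + scale (- 1) (xC a b c)
      + scale (qq ^ 2 + qq ^ 4 + qq ^ 6 - pp ^ 2) (k112 a b c)" (is ?g0)
    "mon [c, c, a, b] = E_word a [c, c, b, b] + scale (- pp) (mon [c, c, b, a])" (is ?g1)
    "scale (2 * (1 + qq ^ 2) ^ 2 * (1 + qq ^ 4)) (mon [c, a, c, b])
        = scale (2 * pp ^ 2 + 2 + 2 * qq ^ 2 + 2 * qq ^ 4) (mon [c, c, b, a])
      + scale (- pp - qq ^ 3) (E_word b [a, c, c, c])
      + scale (1 + 2 * qq ^ 2 + 3 * qq ^ 4 + 3 * qq ^ 6 + qq ^ 8 - pp ^ 4 - pp ^ 2) (E_word a [c, b, c, b])
      + scale (- pp - qq - qq ^ 3 - qq ^ 5) (E_word a [c, b, b, c])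
      + scale (- (pp ^ 6) - pp ^ 2 - 1 - qq ^ 4) (k112 a b c)
      + scale (pp ^ 4 + 2 + qq ^ 2 + qq ^ 4 + qq ^ 6) (E_word b [c, a, c, c])
      + scale (qq ^ 5 - pp ^ 3) (E_word a [b, c, c, b])
      + scale (pp ^ 2 + 1 + qq ^ 2 + qq ^ 4) (E_word a [b, c, b, c]) + scale (- (pp ^ 4) - 1) (xC a b c)
      + scale (- (pp ^ 2) - qq ^ 2) (xD a b c)
      + scale (pp ^ 4 - 1 - qq ^ 2 - 2 * qq ^ 4 - qq ^ 6) (E_word b [c, c, c, a])" (is ?g2)
    "mon [c, b, c, a] = scale qq (E_word a [c, b, c, b]) + scale (- qq) (mon [c, a, c, b])" (is ?g3)
    "mon [b, c, c, a] = E_word b [c, c, c, a] + scale (- (pp ^ 2)) (mon [c, c, b, a])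
      + scale (- pp) (mon [c, b, c, a])" (is ?g4)
    "mon [a, c, c, b] = E_word a [b, c, c, b] + scale (- pp) (mon [b, c, c, a])" (is ?g5)
    "mon [b, a, c, c] = k112 a b c + scale (- 1) (mon [c, c, b, a])
      + scale (qq ^ 2 - 1) (mon [c, a, c, b])" (is ?g6)
    "mon [a, b, c, c] = E_word a [b, b, c, c] + scale (- pp) (mon [b, a, c, c])" (is ?g7)
    "mon [c, a, b, c] = scale qq (E_word b [c, a, c, c]) + scale (- pp) (mon [c, a, c, b])
      + scale (- qq) (mon [b, a, c, c])" (is ?g8)
    "mon [c, b, a, c] = scale qq (E_word a [c, b, b, c]) + scale (- qq) (mon [c, a, b, c])" (is ?g9)
    "mon [b, c, a, c] = E_word b [c, c, a, c] + scale (- (pp ^ 2)) (mon [c, c, a, b])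
      + scale (- pp) (mon [c, b, a, c])" (is ?g10)
    "mon [a, c, b, c] = E_word a [b, c, b, c] + scale (- pp) (mon [b, c, a, c])" (is ?g11)
proof -
  obtain P where P: "pp = P" "qq * P = 1" by simp
  show ?g0 ?g1 ?g2 ?g3 ?g4 ?g5 ?g6 ?g7 ?g8 ?g9 ?g10 ?g11
    unfolding k112_def xC_def xD_def assms
    by ((rule poly_mapping_eqI; simp add: E_word_eval del: scale.scale_scale;
        simp only: lookup_simps P(1) power2_eq_square;
        simp add: qP_rules[OF P(2)] algebra_simps eval_nat_numeral)+)
qed

text \<open>The bound \<open>4 * b + 3\<close> is the letter sum of the words concerned. E_b lowers
  the sum by one, so it is applied only to words covered by the induction hypothesis. The bounds in
  the companion lemmas arise in the same way.\<close>

lemma qrel_13: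
  assumes "c = Suc b" and "b \<ge> 1" "qrel_above c (4 * b + 3)"
  shows "qrel c (mon [c, c, c, b]) = 0" "qrel c (mon [c, b, c, c]) = 0" "qrel c (mon [c, c, b, c]) = 0"
    "qrel c (mon [b, c, c, c]) = 0"
proof -
  have x: "qrel c (xA b c) = 0" "qrel c (xB b c) = 0" "qrel c (k13 b c) = 0"
    using assms(2) by (simp_all add: qrel_def assms(1) Psi_x Psi_fixed YL_rA YL_rB YL_simps)
  have e: "qrel c (E_word b [c, c, c, c]) = 0"
    using assms(2) by ((intro qrel_aboveD[OF assms(3)]; simp add: assms(1))+)
  show q0001: "qrel c (mon [c, c, c, b]) = 0"
    by (rule qrel_cancel[OF cert_13(1)[OF assms(1)]]) (simp_all add: qrel_simps x e qq_poly_nonzero del: E_word.simps)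
  show q0100: "qrel c (mon [c, b, c, c]) = 0"
    by (rule qrel_eqI[OF cert_13(2)[OF assms(1)]]) (simp_all add: qrel_simps x e q0001 del: E_word.simps)
  show q0010: "qrel c (mon [c, c, b, c]) = 0"
    by (rule qrel_eqI[OF cert_13(3)[OF assms(1)]]) (simp_all add: qrel_simps x e q0001 del: E_word.simps)
  show q1000: "qrel c (mon [b, c, c, c]) = 0"
    by (rule qrel_eqI[OF cert_13(4)[OF assms(1)]]) (simp_all add: qrel_simps x e q0001 del: E_word.simps)
qed

lemma qrel_22:
  assumes "c = Suc b" and "b \<ge> 1" "qrel_above c (4 * b + 2)"
  shows "qrel c (mon [c, c, b, b]) = 0" "qrel c (mon [b, b, c, c]) = 0" "qrel c (mon [c, b, b, c]) = 0"
    "qrel c (mon [b, c, b, c]) = 0" "qrel c (mon [b, c, c, b]) = 0" "qrel c (mon [c, b, c, b]) = 0"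
proof -
  have x: "qrel c (k22 b c) = 0"
    using assms(2) by (simp_all add: qrel_def assms(1) Psi_x Psi_fixed  YL_simps)
  show q0101: "qrel c (mon [c, b, c, b]) = 0"
    by (simp add: qrel_def assms(1) Psi_fixed YL_simps)
  have e: "qrel c (E_word b [c, c, c, b]) = 0" "qrel c (E_word b [c, c, b, c]) = 0"
    "qrel c (E_word b [c, b, c, c]) = 0" "qrel c (E_word b [b, c, c, c]) = 0"
    using assms(2) by ((intro qrel_aboveD[OF assms(3)]; simp add: assms(1))+)
  show q0011: "qrel c (mon [c, c, b, b]) = 0"
    by (rule qrel_cancel[OF cert_22(1)[OF assms(1)]]) (simp_all add: qrel_simps x e qq_poly_nonzero del: E_word.simps)
  show q1100: "qrel c (mon [b, b, c, c]) = 0"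
    by (rule qrel_eqI[OF cert_22(2)[OF assms(1)]]) (simp_all add: qrel_simps x e q0011 del: E_word.simps)
  show q0110: "qrel c (mon [c, b, b, c]) = 0"
    by (rule qrel_eqI[OF cert_22(3)[OF assms(1)]]) (simp_all add: qrel_simps x e q0101 q1100 del: E_word.simps)
  show q1010: "qrel c (mon [b, c, b, c]) = 0"
    by (rule qrel_eqI[OF cert_22(4)[OF assms(1)]]) (simp_all add: qrel_simps x e q0011 q0110 del: E_word.simps)
  show q1001: "qrel c (mon [b, c, c, b]) = 0"
    by (rule qrel_eqI[OF cert_22(5)[OF assms(1)]]) (simp_all add: qrel_simps x e q0101 q0011 del: E_word.simps)
qed

lemma qrel_112:
  assumes "b = Suc a" "c = Suc b" and "a \<ge> 1" "qrel_above c (4 * a + 5)"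
  shows "qrel c (mon [c, c, b, a]) = 0" "qrel c (mon [c, c, a, b]) = 0" "qrel c (mon [c, a, c, b]) = 0"
    "qrel c (mon [c, b, c, a]) = 0" "qrel c (mon [b, c, c, a]) = 0" "qrel c (mon [a, c, c, b]) = 0"
    "qrel c (mon [b, a, c, c]) = 0" "qrel c (mon [a, b, c, c]) = 0" "qrel c (mon [c, a, b, c]) = 0"
    "qrel c (mon [c, b, a, c]) = 0" "qrel c (mon [b, c, a, c]) = 0" "qrel c (mon [a, c, b, c]) = 0"
proof -
  have x: "qrel c (xC a b c) = 0" "qrel c (xD a b c) = 0" "qrel c (k112 a b c) = 0"
    using assms(3) by (simp_all add: qrel_def assms(1,2) Psi_x Psi_fixed YL_rC_rD YL_simps)
  have e: "qrel c (E_word b [c, c, c, a]) = 0" "qrel c (E_word b [c, c, a, c]) = 0"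
    "qrel c (E_word b [c, a, c, c]) = 0" "qrel c (E_word b [a, c, c, c]) = 0"
    "qrel c (E_word a [c, c, b, b]) = 0" "qrel c (E_word a [c, b, c, b]) = 0"
    "qrel c (E_word a [c, b, b, c]) = 0" "qrel c (E_word a [b, c, c, b]) = 0"
    "qrel c (E_word a [b, c, b, c]) = 0" "qrel c (E_word a [b, b, c, c]) = 0"
    using assms(3) by ((intro qrel_aboveD[OF assms(4)]; simp add: assms(1,2))+)
  show q0012: "qrel c (mon [c, c, b, a]) = 0"
    by (rule qrel_cancel[OF cert_112(1)[OF assms(1,2)]])
        (simp_all add: qrel_simps x e qq_poly_nonzero del: E_word.simps)
  show q0021: "qrel c (mon [c, c, a, b]) = 0"
    by (rule qrel_eqI[OF cert_112(2)[OF assms(1,2)]]) (simp_all add: qrel_simps x e q0012 del: E_word.simps)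
  show q0201: "qrel c (mon [c, a, c, b]) = 0"
    by (rule qrel_cancel[OF cert_112(3)[OF assms(1,2)]])
        (simp_all add: qrel_simps x e q0012 qq_poly_nonzero del: E_word.simps)
  show q0102: "qrel c (mon [c, b, c, a]) = 0"
    by (rule qrel_eqI[OF cert_112(4)[OF assms(1,2)]]) (simp_all add: qrel_simps x e q0201 del: E_word.simps)
  show q1002: "qrel c (mon [b, c, c, a]) = 0"
    by (rule qrel_eqI[OF cert_112(5)[OF assms(1,2)]]) (simp_all add: qrel_simps x e q0012 q0102 del: E_word.simps)
  show q2001: "qrel c (mon [a, c, c, b]) = 0"
    by (rule qrel_eqI[OF cert_112(6)[OF assms(1,2)]]) (simp_all add: qrel_simps x e q1002 del: E_word.simps)
  show q1200: "qrel c (mon [b, a, c, c]) = 0"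
    by (rule qrel_eqI[OF cert_112(7)[OF assms(1,2)]]) (simp_all add: qrel_simps x e q0012 q0201 del: E_word.simps)
  show q2100: "qrel c (mon [a, b, c, c]) = 0"
    by (rule qrel_eqI[OF cert_112(8)[OF assms(1,2)]]) (simp_all add: qrel_simps x e q1200 del: E_word.simps)
  show q0210: "qrel c (mon [c, a, b, c]) = 0"
    by (rule qrel_eqI[OF cert_112(9)[OF assms(1,2)]]) (simp_all add: qrel_simps x e q0201 q1200 del: E_word.simps)
  show q0120: "qrel c (mon [c, b, a, c]) = 0"
    by (rule qrel_eqI[OF cert_112(10)[OF assms(1,2)]]) (simp_all add: qrel_simps x e q0210 del: E_word.simps)
  show q1020: "qrel c (mon [b, c, a, c]) = 0"
    by (rule qrel_eqI[OF cert_112(11)[OF assms(1,2)]]) (simp_all add: qrel_simps x e q0021 q0120 del: E_word.simps)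
  show q2010: "qrel c (mon [a, c, b, c]) = 0"
    by (rule qrel_eqI[OF cert_112(12)[OF assms(1,2)]]) (simp_all add: qrel_simps x e q1020 del: E_word.simps)
qed

text \<open>The coefficient of a permutation of the letters is \<open>(- q)\<close> to the power of its length.\<close>

definition antisym :: "nat \<Rightarrow> nat \<Rightarrow> nat \<Rightarrow> nat \<Rightarrow> nat free" where
  "antisym a b c d = mon [a, b, c, d] - scale qq (mon [b, a, c, d]) - scale qq (mon [a, c, b, d])
    - scale qq (mon [a, b, d, c]) + scale (qq ^ 2) (mon [c, a, b, d])
    + scale (qq ^ 2) (mon [b, c, a, d]) + scale (qq ^ 2) (mon [b, a, d, c])
    + scale (qq ^ 2) (mon [a, d, b, c]) + scale (qq ^ 2) (mon [a, c, d, b])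
    - scale (qq ^ 3) (mon [d, a, b, c]) - scale (qq ^ 3) (mon [c, b, a, d])
    - scale (qq ^ 3) (mon [c, a, d, b]) - scale (qq ^ 3) (mon [b, d, a, c])
    - scale (qq ^ 3) (mon [b, c, d, a]) - scale (qq ^ 3) (mon [a, d, c, b])
    + scale (qq ^ 4) (mon [d, b, a, c]) + scale (qq ^ 4) (mon [d, a, c, b])
    + scale (qq ^ 4) (mon [c, d, a, b]) + scale (qq ^ 4) (mon [c, b, d, a])
    + scale (qq ^ 4) (mon [b, d, c, a]) - scale (qq ^ 5) (mon [d, c, a, b])
    - scale (qq ^ 5) (mon [d, b, c, a]) - scale (qq ^ 5) (mon [c, d, b, a])
    + scale (qq ^ 6) (mon [d, c, b, a])"

lemma Psi_i_antisym:
  shows "Psi_i (Suc 0) (antisym a (Suc a) (Suc (Suc a)) (Suc (Suc (Suc a)))) =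
      scale (- qq) (antisym a (Suc a) (Suc (Suc a)) (Suc (Suc (Suc a))))" (is ?g0)
    "Psi_i 2 (antisym a (Suc a) (Suc (Suc a)) (Suc (Suc (Suc a)))) =
      scale (- qq) (antisym a (Suc a) (Suc (Suc a)) (Suc (Suc (Suc a))))" (is ?g1)
    "Psi_i 3 (antisym a (Suc a) (Suc (Suc a)) (Suc (Suc (Suc a)))) =
      scale (- qq) (antisym a (Suc a) (Suc (Suc a)) (Suc (Suc (Suc a))))" (is ?g2)
proof -
  obtain P where P: "pp = P" "qq * P = 1" by simp
  show ?g0 ?g1 ?g2
    unfolding antisym_def
    by ((rule poly_mapping_eqI; simp only: Psi_i_simps Psi_i_words; simp del: scale.scale_scale;
        simp only: lookup_simps P(1) power2_eq_square;
        simp add: qP_rules[OF P(2)] algebra_simps eval_nat_numeral)+)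
qed

text \<open>On a common eigenvector of the Psi_i with eigenvalue t, Psi acts by (t^2 + (q - q^-1)
  t)^2. The Hecke relation makes this 1 for both eigenvalues of T, t = -q here and t = q^-1 on a
  power of one letter.\<close>

lemma Psi_antisym: "Psi (antisym a (Suc a) (Suc (Suc a)) (Suc (Suc (Suc a)))) =
    antisym a (Suc a) (Suc (Suc a)) (Suc (Suc (Suc a)))" (is "?x = ?y")
proof (rule poly_mapping_eqI)
  fix k
  obtain P where P: "pp = P" "qq * P = 1" by simp
  show "Poly_Mapping.lookup ?x k = Poly_Mapping.lookup ?y k"
    unfolding Psi_def
    by (simp add: Psi_i_antisym Psi_i_simps del: scale.scale_scale;
        simp only: lookup_simps P(1) power2_eq_square;
        simp add: qP_rules[OF P(2)] algebra_simps eval_nat_numeral)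
qed

text \<open>E_k applied to the word with k + 1 in both places gives the unswapped word plus q^-1
  times the swapped one, as the remaining letters have weight 0; the sum is settled by
  induction.\<close>

lemma qrel_swap:
  assumes "qrel_above n s" "k \<in> {1..n - 1}" "set (x @ y @ z) \<subseteq> {1..n} - {k, k + 1}" "length
      (x @ y @ z) = 2"
    and "sum_list (x @ y @ z) + 2 * (k + 1) > s"
  shows "qrel n (mon (x @ (k + 1) # y @ k # z)) = psc (- qq) (qrel n (mon (x @ k # y @ (k + 1) # z)))"
    (is "?v = psc _ ?u")
proof -
  have "wt k v = 0" if "set v \<subseteq> set (x @ y @ z)" for v
  proof -
    have "k \<notin> set v" "k + 1 \<notin> set v" using that assms(3) by auto
    then show ?thesis by (induction v) (auto simp: wt_def)
  qed
  from this[of x] this[of y] have wt: "wt k x = 0" "wt k y = 0" by auto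
  have n: "k + 1 \<notin> set x" "k + 1 \<notin> set y" "k + 1 \<notin> set z" using assms(3) by auto
  have "qrel n (E_word k (x @ (k + 1) # y @ (k + 1) # z)) = 0"
    by (rule qrel_aboveD[OF assms(1,2)]) (use assms(2-) in auto)
  then have "?u + psc pp ?v = 0"
    using n by (simp add: E_word_append E_word_zero mon_mult distrib_left qrel_simps wt powi_wt(2))
  then have "psc qq (?u + psc pp ?v) = 0" by simp
  then have "psc qq ?u + ?v = 0" by (simp add: psc.scale_right_distrib)
  then show ?thesis by (simp add: eq_neg_iff_add_eq_0 add.commute)
qed

text \<open>Modulo settled vectors all 24 words are multiples of the increasing one by (-q)^length.
  Hence the fixed vector \<open>antisym\<close> becomes a nonzero multiple of that word
  alone.\<close>

lemma qrel_1111: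
  assumes "b = Suc a" "c = Suc b" "d = Suc c" and "a \<ge> 1" "qrel_above d (4 * a + 6)"
  shows "qrel d (mon [a, b, c, d]) = 0" "qrel d (mon [b, a, c, d]) = 0" "qrel d (mon [a, c, b, d]) = 0"
    "qrel d (mon [a, b, d, c]) = 0" "qrel d (mon [c, a, b, d]) = 0" "qrel d (mon [b, c, a, d]) = 0"
    "qrel d (mon [b, a, d, c]) = 0" "qrel d (mon [a, d, b, c]) = 0" "qrel d (mon [a, c, d, b]) = 0"
    "qrel d (mon [d, a, b, c]) = 0" "qrel d (mon [c, b, a, d]) = 0" "qrel d (mon [c, a, d, b]) = 0"
    "qrel d (mon [b, d, a, c]) = 0" "qrel d (mon [b, c, d, a]) = 0" "qrel d (mon [a, d, c, b]) = 0"
    "qrel d (mon [d, b, a, c]) = 0" "qrel d (mon [d, a, c, b]) = 0" "qrel d (mon [c, d, a, b]) = 0"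
    "qrel d (mon [c, b, d, a]) = 0" "qrel d (mon [b, d, c, a]) = 0" "qrel d (mon [d, c, a, b]) = 0"
    "qrel d (mon [d, b, c, a]) = 0" "qrel d (mon [c, d, b, a]) = 0" "qrel d (mon [d, c, b, a]) = 0"
proof -
  define f where "f w = qrel d (mon w)" for w
  have swap: "f u = psc (- qq) (f v)"
    if "k \<in> {a, b, c}" "length (x @ y @ z) = 2" "set (x @ y @ z) = {a, b, c, d} - {k, Suc k}"
      and uv: "u = x @ Suc k # y @ k # z" "v = x @ k # y @ Suc k # z" for u v k x y z
  proof -
    \<comment> \<open>Two positions carry two different letters, so the sum along the list equals
      the sum over the set.\<close>
    have "card (set (x @ y @ z)) = 2" unfolding that(3) using that(1) assms(1-3) by auto
    then have "sum_list (x @ y @ z) = \<Sum>(set (x @ y @ z))"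
      using that(2) sum.distinct_set_conv_list[of "x @ y @ z" "\<lambda>x. x"] card_distinct[of "x @ y @ z"] by simp
    moreover have "\<Sum>{a, b, c, d} = \<Sum>(set (x @ y @ z)) + \<Sum>{k, Suc k}"
      unfolding that(3) by (rule sum.subset_diff) (use that(1) assms(1-3) in auto)
    ultimately have "sum_list (x @ y @ z) + 2 * (k + 1) > 4 * a + 6"
      using assms(1-3) by simp
    moreover have "set (x @ y @ z) \<subseteq> {1..d} - {k, k + 1}" "k \<in> {1..d - 1}"
      unfolding that(3) using that(1) assms(1-4) by auto
    ultimately show ?thesis
      using qrel_swap[OF assms(5), of k x y z] that(2) by (simp add: f_def uv)
  qed
  have q1: "f [b, a, c, d] = psc (- qq) (f [a, b, c, d])"
    by (rule swap[of a "[]" "[]" "[c, d]"]; use assms(1-3) in auto)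
  have q2: "f [a, c, b, d] = psc (- qq) (f [a, b, c, d])"
    by (rule swap[of b "[a]" "[]" "[d]"]; use assms(1-3) in auto)
  have q3: "f [a, b, d, c] = psc (- qq) (f [a, b, c, d])"
    by (rule swap[of c "[a, b]" "[]" "[]"]; use assms(1-3) in auto)
  have q4: "f [c, a, b, d] = psc (- qq) (f [b, a, c, d])"
    by (rule swap[of b "[]" "[a]" "[d]"]; use assms(1-3) in auto)
  have q5: "f [b, c, a, d] = psc (- qq) (f [a, c, b, d])"
    by (rule swap[of a "[]" "[c]" "[d]"]; use assms(1-3) in auto)
  have q6: "f [b, a, d, c] = psc (- qq) (f [a, b, d, c])"
    by (rule swap[of a "[]" "[]" "[d, c]"]; use assms(1-3) in auto)
  have q7: "f [a, d, b, c] = psc (- qq) (f [a, c, b, d])"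
    by (rule swap[of c "[a]" "[b]" "[]"]; use assms(1-3) in auto)
  have q8: "f [a, c, d, b] = psc (- qq) (f [a, b, d, c])"
    by (rule swap[of b "[a]" "[d]" "[]"]; use assms(1-3) in auto)
  have q9: "f [d, a, b, c] = psc (- qq) (f [c, a, b, d])"
    by (rule swap[of c "[]" "[a, b]" "[]"]; use assms(1-3) in auto)
  have q10: "f [c, b, a, d] = psc (- qq) (f [c, a, b, d])"
    by (rule swap[of a "[c]" "[]" "[d]"]; use assms(1-3) in auto)
  have q11: "f [c, a, d, b] = psc (- qq) (f [b, a, d, c])"
    by (rule swap[of b "[]" "[a, d]" "[]"]; use assms(1-3) in auto)
  have q12: "f [b, d, a, c] = psc (- qq) (f [a, d, b, c])"
    by (rule swap[of a "[]" "[d]" "[c]"]; use assms(1-3) in auto)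
  have q13: "f [b, c, d, a] = psc (- qq) (f [a, c, d, b])"
    by (rule swap[of a "[]" "[c, d]" "[]"]; use assms(1-3) in auto)
  have q14: "f [a, d, c, b] = psc (- qq) (f [a, d, b, c])"
    by (rule swap[of b "[a, d]" "[]" "[]"]; use assms(1-3) in auto)
  have q15: "f [d, b, a, c] = psc (- qq) (f [d, a, b, c])"
    by (rule swap[of a "[d]" "[]" "[c]"]; use assms(1-3) in auto)
  have q16: "f [d, a, c, b] = psc (- qq) (f [d, a, b, c])"
    by (rule swap[of b "[d, a]" "[]" "[]"]; use assms(1-3) in auto)
  have q17: "f [c, d, a, b] = psc (- qq) (f [b, d, a, c])"
    by (rule swap[of b "[]" "[d, a]" "[]"]; use assms(1-3) in auto)
  have q18: "f [c, b, d, a] = psc (- qq) (f [c, a, d, b])"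
    by (rule swap[of a "[c]" "[d]" "[]"]; use assms(1-3) in auto)
  have q19: "f [b, d, c, a] = psc (- qq) (f [a, d, c, b])"
    by (rule swap[of a "[]" "[d, c]" "[]"]; use assms(1-3) in auto)
  have q20: "f [d, c, a, b] = psc (- qq) (f [d, b, a, c])"
    by (rule swap[of b "[d]" "[a]" "[]"]; use assms(1-3) in auto)
  have q21: "f [d, b, c, a] = psc (- qq) (f [d, a, c, b])"
    by (rule swap[of a "[d]" "[c]" "[]"]; use assms(1-3) in auto)
  have q22: "f [c, d, b, a] = psc (- qq) (f [c, d, a, b])"
    by (rule swap[of a "[c, d]" "[]" "[]"]; use assms(1-3) in auto)
  have q23: "f [d, c, b, a] = psc (- qq) (f [d, c, a, b])"
    by (rule swap[of a "[d, c]" "[]" "[]"]; use assms(1-3) in auto)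
  note q = q1 q2 q3 q4 q5 q6 q7 q8 q9 q10 q11 q12 q13 q14 q15 q16 q17 q18 q19 q20 q21 q22 q23
  \<comment> \<open>\<open>?D\<close> is the sum of q^(2 length) over S_4, the Poincare polynomial
    [4]! in q^2, factored into the polynomials of \<open>qq_poly_nonzero\<close>.\<close>
  let ?F = "f [a, b, c, d]" and ?D = "(1 + qq ^ 2) * ((1 + qq ^ 2 + qq ^ 4) * ((1 + qq ^ 2) * (1 + qq ^ 4)))"
  have "psc ?D ?F = qrel d (antisym a b c d)"
    unfolding antisym_def qrel_simps f_def[symmetric] q psc.scale_scale
    by (simp add: psc.scale_left_distrib algebra_simps eval_nat_numeral;
        simp add: algebra_simps flip: psc.scale_left_distrib)
  also have "\<dots> = 0"
    unfolding assms(1-3) by (simp add: qrel_def Psi_antisym YL_simps)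
  finally have "?F = 0" by (simp add: qq_poly_nonzero)
  then show "qrel d (mon [a, b, c, d]) = 0" "qrel d (mon [b, a, c, d]) = 0" "qrel d (mon [a, c, b, d]) = 0"
    "qrel d (mon [a, b, d, c]) = 0" "qrel d (mon [c, a, b, d]) = 0" "qrel d (mon [b, c, a, d]) = 0"
    "qrel d (mon [b, a, d, c]) = 0" "qrel d (mon [a, d, b, c]) = 0" "qrel d (mon [a, c, d, b]) = 0"
    "qrel d (mon [d, a, b, c]) = 0" "qrel d (mon [c, b, a, d]) = 0" "qrel d (mon [c, a, d, b]) = 0"
    "qrel d (mon [b, d, a, c]) = 0" "qrel d (mon [b, c, d, a]) = 0" "qrel d (mon [a, d, c, b]) = 0"
    "qrel d (mon [d, b, a, c]) = 0" "qrel d (mon [d, a, c, b]) = 0" "qrel d (mon [c, d, a, b]) = 0"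
    "qrel d (mon [c, b, d, a]) = 0" "qrel d (mon [b, d, c, a]) = 0" "qrel d (mon [d, c, a, b]) = 0"
    "qrel d (mon [d, b, c, a]) = 0" "qrel d (mon [c, d, b, a]) = 0" "qrel d (mon [d, c, b, a]) = 0"
    using q by (simp_all add: f_def)
qed

text \<open>A word with the letter \<open>k\<close> at least twice but \<open>k + 1\<close> only once lies in the image of \<open>E\<^sub>k\<close>.\<close>

lemma qrel_rank_aux:
  assumes "k + 1 \<notin> set x0" "k + 1 \<notin> set x1" "k + 1 \<notin> set x2" "k + 1 \<notin> set x3"
    and "qrel n (E_word k (x0 @ (k + 1) # x1 @ (k + 1) # x2 @ k # x3)) = 0"
    and "qrel n (E_word k (x0 @ (k + 1) # x1 @ k # x2 @ (k + 1) # x3)) = 0"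
    and "qrel n (E_word k (x0 @ k # x1 @ (k + 1) # x2 @ (k + 1) # x3)) = 0"
  shows "qrel n (mon (x0 @ (k + 1) # x1 @ k # x2 @ k # x3)) = 0" (is "?f1 = 0")
    "qrel n (mon (x0 @ k # x1 @ (k + 1) # x2 @ k # x3)) = 0" (is "?f2 = 0")
    "qrel n (mon (x0 @ k # x1 @ k # x2 @ (k + 1) # x3)) = 0" (is "?f3 = 0")
proof -
  let ?b = "qq powi wt k x1" and ?c = "qq powi wt k x2"
  have nz: "x + y = 0" if "psc (qq powi m) x + psc (qq powi m) y = 0" for m :: int and x y
  proof -
    have "psc (qq powi m) (x + y) = 0" using that by (simp add: psc.scale_right_distrib)
    then show ?thesis by (simp only: psc.scale_eq_0_iff) simp
  qed
  note ev = E_word_append E_word_zero powi_wt(2) mon_mult distrib_left distrib_right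
    scale.scale_right_distrib qrel_simps
    qP_rules[OF right_inverse[OF qq_nonzero]]
  have "psc (qq powi wt k x0) ?f2 + psc (qq powi wt k x0) (psc (pp * ?b) ?f1) = 0"
    using assms(1-4) assms(5) by (simp add: ev add.commute mult_ac)
  then have 1: "?f2 + psc (pp * ?b) ?f1 = 0" by (rule nz)
  have "psc (qq powi wt k x0) ?f3 + psc (qq powi wt k x0) (psc (?b * ?c) ?f1) = 0"
    using assms(1-4) assms(6) by (simp add: ev add.commute mult_ac)
  then have 2: "?f3 + psc (?b * ?c) ?f1 = 0" by (rule nz)
  have "psc (qq powi wt k x0) (psc (qq * ?b) ?f3) + psc (qq powi wt k x0) (psc (?b * ?c) ?f2) = 0"
    using assms(1-4) assms(7) by (simp add: ev add.commute mult_ac)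
  then have 3: "psc (qq * ?b) ?f3 + psc (?b * ?c) ?f2 = 0" by (rule nz)
  have f: "?f2 = - psc (pp * ?b) ?f1" "?f3 = - psc (?b * ?c) ?f1"
    using 1 2 by (simp_all add: eq_neg_iff_add_eq_0)
  \<comment> \<open>The first two equations express \<open>?f2\<close> and \<open>?f3\<close> by
    \<open>?f1\<close>; in the third they add up instead of cancelling, which leaves q + q^-1 times
    a power of q.\<close>
  have "psc (qq * (?b * (?b * ?c)) + pp * (?b * (?b * ?c))) ?f1 = - (psc (qq * ?b) ?f3 + psc (?b * ?c) ?f2)"
    unfolding f by (simp add: psc.scale_left_distrib mult_ac)
  then have "psc ((qq + pp) * (?b * (?b * ?c))) ?f1 = 0"
    unfolding 3 by (simp add: distrib_right)
  then show "?f1 = 0" by (simp only: psc.scale_eq_0_iff) simp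
  then show "?f2 = 0" "?f3 = 0" using f by simp_all
qed

lemma count_list_two:
  assumes "count_list s k \<ge> 2"
  obtains x y z where "s = x @ k # y @ k # z"
proof -
  have "k \<in> set s" using assms by (metis count_notin not_numeral_le_zero)
  then obtain x t where s: "s = x @ k # t" "k \<notin> set x" by (meson split_list_first)
  then have "count_list t k \<ge> 1" using assms by simp
  then have "k \<in> set t" by (metis count_notin not_one_le_zero)
  then obtain y z where "t = y @ k # z" by (meson split_list)
  then show ?thesis using that s by blast
qed

lemma qrel_rank:
  assumes "count_list w (k + 1) = 1" "count_list w k \<ge> 2" "set w \<subseteq> {1..n}" "length w
      = 4" "k \<in> {1..n - 1}"
    and E: "\<And>w'. set w' \<subseteq> {1..n} \<Longrightarrow> length w' = 4 \<Longrightarrow>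
        sum_list w' > sum_list w \<Longrightarrow> qrel n (E_word k w') = 0"
  shows "qrel n (mon w) = 0"
proof -
  have "k + 1 \<in> set w" using assms(1) by (metis count_notin zero_neq_one)
  then obtain p s where w: "w = p @ (k + 1) # s" "k + 1 \<notin> set p" by (meson split_list_first)
  then have s: "k + 1 \<notin> set s" using assms(1) by (simp add: count_list_0_iff)
  have k1: "k + 1 \<in> {1..n}" using assms(5) by auto
  consider "count_list s k \<ge> 2" | "count_list p k \<ge> 2" | "count_list p k = 1" "count_list s k = 1"
    using assms(2) w by (auto split: if_splits) linarith
  then show ?thesis
  proof cases
    case 1
    then obtain x y z where "s = x @ k # y @ k # z" by (rule count_list_two)
    then have w': "w = p @ (k + 1) # x @ k # y @ k # z" and notin: "k + 1 \<notin> set x" "k + 1 \<notin> set y"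
        "k + 1 \<notin> set z"
      using w s by auto
    have "qrel n (E_word k v) = 0"
      if "v \<in> {p @ (k + 1) # x @ (k + 1) # y @ k # z, p @ (k + 1) # x @ k # y @ (k + 1) # z, p @ k # x @ (k
          + 1) # y @ (k + 1) # z}" for v
      by (rule E; use that w' assms(3,4) k1 in \<open>elim insertE emptyE; simp\<close>)
    then show ?thesis unfolding w' by (intro qrel_rank_aux(1) w(2) notin) simp_all
  next
    case 2
    then obtain x y z where "p = x @ k # y @ k # z" by (rule count_list_two)
    then have w': "w = x @ k # y @ k # z @ (k + 1) # s" and notin: "k + 1 \<notin> set x" "k + 1 \<notin> set y"
        "k + 1 \<notin> set z"
      using w s by auto
    have "qrel n (E_word k v) = 0"
      if "v \<in> {x @ (k + 1) # y @ (k + 1) # z @ k # s, x @ (k + 1) # y @ k # z @ (k + 1) # s, x @ k # y @ (k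
          + 1) # z @ (k + 1) # s}" for v
      by (rule E; use that w' assms(3,4) k1 in \<open>elim insertE emptyE; simp\<close>)
    then show ?thesis unfolding w' by (intro qrel_rank_aux(3) s notin) simp_all
  next
    case 3
    then have "k \<in> set p" "k \<in> set s" by (metis count_notin zero_neq_one)+
    then obtain x y z t where "p = x @ k # y" "s = z @ k # t" by (meson split_list)
    then have w': "w = x @ k # y @ (k + 1) # z @ k # t"
      and notin: "k + 1 \<notin> set x" "k + 1 \<notin> set y" "k + 1 \<notin> set z" "k + 1 \<notin> set t"
      using w s by auto
    have "qrel n (E_word k v) = 0"
      if "v \<in> {x @ (k + 1) # y @ (k + 1) # z @ k # t, x @ (k + 1) # y @ k # z @ (k + 1) # t, x @ k # y @ (k
          + 1) # z @ (k + 1) # t}" for v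
      by (rule E; use that w' assms(3,4) k1 in \<open>elim insertE emptyE; simp\<close>)
    then show ?thesis unfolding w' by (intro qrel_rank_aux(2) notin) simp_all
  qed
qed

section \<open>Exhausting the gap-free words\<close>

lemma upward_closed:
  fixes X :: "nat set"
  assumes "finite X" "X \<noteq> {}" "X \<subseteq> {..n}" "\<forall>k\<in>X. k < n \<longrightarrow> k + 1 \<in> X"
  shows "X = {Min X..n}"
proof -
  have "k \<in> X" if "Min X \<le> k" "k \<le> n" for k
    using that
  proof (induction k rule: dec_induct)
    case base
    show ?case by (rule Min_in[OF assms(1,2)])
  next
    case (step k)
    then show ?case using assms(4) by (metis Suc_eq_plus1 Suc_le_eq less_imp_le)
  qed
  then have "{Min X..n} \<subseteq> X" by auto
  moreover have "X \<subseteq> {Min X..n}"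
    using assms(3) Min_le[OF assms(1)] by (auto simp: subset_iff)
  ultimately show ?thesis by blast
qed

lemma qrel_word:
  assumes "n \<ge> 2" "set w \<subseteq> {1..n}" "length w = 4"
  shows "qrel n (mon w) = 0"
proof (rule word_generation[where P = "\<lambda>x. qrel n x = 0" and n = n and d = 4, OF _ _ _ assms(2,3)])
  fix c x assume "qrel n x = 0" then show "qrel n (scale c x) = 0" by (simp add: qrel_simps)
next
  fix k w assume "k \<in> {1..n - 1}" "set w \<subseteq> {1..n}" "length w = 4" "qrel n (mon w) = 0"
  then show "qrel n (E_word k w) = 0" by (intro qrel_E_word)
next
  fix w
  assume w: "set w \<subseteq> {1..n}" "length w = 4" "\<forall>k\<in>set w. k < n \<longrightarrow> k + 1
      \<in> set w"
    and IH: "\<And>w'. set w' \<subseteq> {1..n} \<Longrightarrow> length w' = 4 \<Longrightarrow>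
        sum_list w < sum_list w' \<Longrightarrow> qrel n (mon w') = 0"
  have E: "qrel n (E_word k w') = 0"
    if "k \<in> {1..n - 1}" "set w' \<subseteq> {1..n}" "length w' = 4" "sum_list w' > sum_list w" for k w'
    using that IH[of w'] by (intro qrel_E_word) auto
  have rank: "qrel n (mon w) = 0" if "count_list w (Suc k) = 1" "count_list w k \<ge> 2" "k \<in> {1..n - 1}" for k
    using qrel_rank[of w k n] that w E by auto
  obtain w1 w2 w3 w4 where w4: "w = [w1, w2, w3, w4]"
    using w(2) by (auto simp: length_Suc_conv eval_nat_numeral)
  define m where "m = Min (set w)"
  have set: "set w = {m..n}"
    unfolding m_def
  proof (rule upward_closed)
    show "set w \<subseteq> {..n}" using w(1) by auto
  qed (use w(3) in \<open>simp_all add: w4\<close>)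
  \<comment> \<open>The letters of a gap-free word fill the interval from m to n, and a word of
    length 4 has at most four different letters.\<close>
  have "card (set w) \<le> 4" using card_length[of w] w(2) by simp
  then have "n < m + 4" unfolding set by simp
  moreover have "m \<in> set w" unfolding m_def by (rule Min_in) (auto simp: w4)
  then have "m \<le> n" "m \<ge> 1" using w(1) by auto
  ultimately consider "n = m" | "n = Suc m" | "n = Suc (Suc m)" | "n = Suc (Suc (Suc m))" by linarith
  then show "qrel n (mon w) = 0"
  proof cases
    case 1
    have s: "set w = {n}" using set 1 by simp
    have "w1 \<in> {n}" "w2 \<in> {n}" "w3 \<in> {n}" "w4 \<in> {n}"
      unfolding s[symmetric] w4 by simp_all
    then show ?thesis using Psi_fixed(5)[of n] by (simp add: w4 qrel_def YL_simps)
  next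
    case 2
    have s: "set w = {m, Suc m}" using set unfolding 2 by (simp add: atLeastAtMostSuc_conv insert_commute)
    have "\<forall>x\<in>set w. x = m \<or> x = Suc m" "m \<in> set w" "Suc m \<in> set w"
      unfolding s by simp_all
    then have m: "w1 = m \<or> w1 = Suc m" "w2 = m \<or> w2 = Suc m" "w3 = m \<or> w3 = Suc m" "w4 = m \<or> w4
        = Suc m"
      and l: "\<not> (w1 \<noteq> m \<and> w2 \<noteq> m \<and> w3 \<noteq> m \<and> w4 \<noteq> m)"
        "\<not> (w1 \<noteq> Suc m \<and> w2 \<noteq> Suc m \<and> w3 \<noteq> Suc m \<and> w4 \<noteq> Suc m)"
      unfolding w4 by auto
    \<comment> \<open>With letters m and m + 1 only, the excess of the letter sum over 4 m counts
      the letter m + 1. The labels list the multiplicities, smallest letter first.\<close>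
    have 13: "qrel n (mon w) = 0" if "sum_list w = 4 * m + 3"
    proof -
      have "qrel_above (Suc m) (4 * m + 3)"
        using E that unfolding 2 qrel_above_def by auto
      note q = qrel_13[OF refl \<open>m \<ge> 1\<close> this]
      show ?thesis
        using m that unfolding 2 w4 by (elim disjE) (simp_all add: q)
    qed
    have 22: "qrel n (mon w) = 0" if "sum_list w = 4 * m + 2"
    proof -
      have "qrel_above (Suc m) (4 * m + 2)"
        using E that unfolding 2 qrel_above_def by auto
      note q = qrel_22[OF refl \<open>m \<ge> 1\<close> this]
      show ?thesis
        using m that unfolding 2 w4 by (elim disjE) (simp_all add: q)
    qed
    have 31: "qrel n (mon w) = 0" if "sum_list w = 4 * m + 1"
    proof (rule rank[of m])
      have "count_list w (Suc m) = 1 \<and> count_list w m \<ge> 2"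
        using m that unfolding w4 by (elim disjE) simp_all
      then show "count_list w (Suc m) = 1" "count_list w m \<ge> 2" by simp_all
    qed (use \<open>m \<ge> 1\<close> in \<open>simp add: 2\<close>)
    have "sum_list w = 4 * m + 1 \<or> sum_list w = 4 * m + 2 \<or> sum_list w = 4 * m + 3"
      using m l unfolding w4 by (elim disjE) simp_all
    then show ?thesis using 13 22 31 by blast
  next
    case 3
    have s: "set w = {m, Suc m, Suc (Suc m)}"
      using set unfolding 3 by (simp add: atLeastAtMostSuc_conv insert_commute)
    have "\<forall>x\<in>set w. x = m \<or> x = Suc m \<or> x
        = Suc (Suc m)" "m \<in> set w" "Suc m \<in> set w" "Suc (Suc m) \<in> set w"
      unfolding s by simp_all
    then have m: "w1 = m \<or> w1 = Suc m \<or> w1 = Suc (Suc m)" "w2 = m \<or> w2 = Suc m \<or> w2 = Suc (Suc m)"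
      "w3 = m \<or> w3 = Suc m \<or> w3 = Suc (Suc m)" "w4 = m \<or> w4 = Suc m \<or> w4 = Suc (Suc m)"
      and l: "\<not> (w1 \<noteq> m \<and> w2 \<noteq> m \<and> w3 \<noteq> m \<and> w4 \<noteq> m)"
        "\<not> (w1 \<noteq> Suc m \<and> w2 \<noteq> Suc m \<and> w3 \<noteq> Suc m \<and> w4 \<noteq> Suc m)"
        "\<not> (w1 \<noteq> Suc (Suc m) \<and> w2 \<noteq> Suc (Suc m) \<and> w3 \<noteq> Suc (Suc m) \<and>
            w4 \<noteq> Suc (Suc m))"
      unfolding w4 by auto
    \<comment> \<open>All three letters occur and one is repeated; the sums 4 m + 5, 4 m + 4, 4 m +
      3 say that it is m + 2, m + 1 or m.\<close>
    have 112: "qrel n (mon w) = 0" if "sum_list w = 4 * m + 5"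
    proof -
      have "qrel_above (Suc (Suc m)) (4 * m + 5)"
        using E that unfolding 3 qrel_above_def by auto
      note q = qrel_112[OF refl refl \<open>m \<ge> 1\<close> this]
      show ?thesis
        using m l that unfolding 3 w4 by (elim disjE) (simp_all add: q)
    qed
    have 121: "qrel n (mon w) = 0" if "sum_list w = 4 * m + 4"
    proof (rule rank[of "Suc m"])
      have "count_list w (Suc (Suc m)) = 1 \<and> count_list w (Suc m) \<ge> 2"
        using m l that unfolding w4 by (elim disjE) simp_all
      then show "count_list w (Suc (Suc m)) = 1" "count_list w (Suc m) \<ge> 2" by simp_all
    qed (simp add: 3)
    have 211: "qrel n (mon w) = 0" if "sum_list w = 4 * m + 3"
    proof (rule rank[of m])
      have "count_list w (Suc m) = 1 \<and> count_list w m \<ge> 2"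
        using m l that unfolding w4 by (elim disjE) simp_all
      then show "count_list w (Suc m) = 1" "count_list w m \<ge> 2" by simp_all
    qed (use \<open>m \<ge> 1\<close> in \<open>simp add: 3\<close>)
    have "sum_list w = 4 * m + 3 \<or> sum_list w = 4 * m + 4 \<or> sum_list w = 4 * m + 5"
      using m l unfolding w4 by (elim disjE) simp_all
    then show ?thesis using 112 121 211 by blast
  next
    case 4
    have s: "set w = {m, Suc m, Suc (Suc m), Suc (Suc (Suc m))}"
      using set unfolding 4 by (simp add: atLeastAtMostSuc_conv insert_commute)
    then have "\<forall>x\<in>set w. x = m \<or> x = Suc m \<or> x = Suc (Suc m) \<or> x = Suc (Suc (Suc m))" by simp
    then have m: "w1 = m \<or> w1 = Suc m \<or> w1 = Suc (Suc m) \<or> w1 = Suc (Suc (Suc m))"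
      "w2 = m \<or> w2 = Suc m \<or> w2 = Suc (Suc m) \<or> w2 = Suc (Suc (Suc m))"
      "w3 = m \<or> w3 = Suc m \<or> w3 = Suc (Suc m) \<or> w3 = Suc (Suc (Suc m))"
      "w4 = m \<or> w4 = Suc m \<or> w4 = Suc (Suc m) \<or> w4 = Suc (Suc (Suc m))"
      unfolding w4 by simp_all
    have "card (set w) = length w" unfolding s w(2) by simp
    then have d: "distinct w" by (rule card_distinct)
    then have "sum_list w = \<Sum>(set w)" using sum.distinct_set_conv_list[of w "\<lambda>x. x"] by simp
    then have sum: "sum_list w = 4 * m + 6" unfolding s by simp
    have "qrel_above (Suc (Suc (Suc m))) (4 * m + 6)"
      using E sum unfolding 4 qrel_above_def by auto
    note q = qrel_1111[OF refl refl refl \<open>m \<ge> 1\<close> this]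
    show ?thesis
      using m d unfolding 4 w4 by (elim disjE) (simp_all add: q)
  qed
qed

section \<open>The inverse map vanishes on the ideal of the cross product\<close>

lemma YL_Sq_ideal:
  assumes "n \<ge> 2" "a \<in> Sq_ideal n"
  shows "YL n a = 0"
proof -
  have Q: "qrel n x = 0" if "x \<in> tens n 4" for x
    using that by (induction x rule: tens_induct) (simp_all add: qrel_simps qrel_word[OF assms(1)])
  show ?thesis
    using ring_TVV Sq_gens_TVV assms(2)[unfolded Sq_ideal_def]
  proof (rule genideal_induct)
    fix r assume "r \<in> {Psi x - x |x. x \<in> V4 n}"
    then show "YL n r = 0" using Q unfolding qrel_def V4_eq by blast
  qed (auto simp: YL_simps YL_mult)
qed

lemma UW_kernel: "x \<in> Uplus_kernel n \<Longrightarrow> UW n x = 0"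
proof -
  assume "x \<in> Uplus_kernel n"
  then have "x \<in> rideal (Serre_rels n)" by (simp add: Uplus_kernel_eq)
  then show ?thesis
  proof (induction rule: rideal.induct)
    case (incl r)
    \<comment> \<open>The indices of a Serre relator lie between 1 and n - 1, where i -> n - i is a
      true reversal despite truncated subtraction.\<close>
    then consider i j where "r = serre (mon [i]) (mon [j])" "n - i = n - j + 1 \<or> n - j = n - i + 1"
      | i j where "r = mon [i] * mon [j] - mon [j] * mon [i]" "n - i + 1 < n - j \<or> n - j + 1 < n - i"
      unfolding Serre_rels_def by fastforce
    then show ?case
    proof cases
      case (1 i j)
      show ?thesis using pu_serre[OF 1(2)] unfolding 1(1)
        by (simp add: serre_def UW_simps UW_mult mult.assoc) (simp add: UW_mon)
    next
      case (2 i j)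
      show ?thesis using pu_commute[OF 2(2)] unfolding 2(1)
        by (simp add: UW_simps UW_mult) (simp add: UW_mon)
    qed
  qed (auto simp: UW_simps UW_mult)
qed

lemma Theta_NN:
  assumes "n \<ge> 2" "z \<in> NN n" shows "Theta n z = 0"
  using assms(2)
  by (induction z rule: NN_induct) (auto simp: Theta_simps Theta_tensor YL_Sq_ideal[OF assms(1)] UW_kernel)

section \<open>The isomorphism\<close>

lemma restrict_bracket: "restrict_words X (bracket v x y) = bracket v (restrict_words X x) (restrict_words X y)"
  by (simp add: bracket_def restrict_words_simps restrict_words_mult)

lemma restrict_gens: "restrict_words (pgens n) (ug i) = uu n i" "restrict_words (pgens n) ww
    = ww" "restrict_words (pgens n) zz = zz"
  by (auto simp: restrict_words_mon uu_def)

lemma pres_rels_carrier: "pres_rels n \<subseteq> carrier (pres_free n)"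
proof
  fix r assume "r \<in> pres_rels n"
  moreover have "uu n i \<in> carrier (free_alg (pgens n))" for i
    by (auto simp: uu_def mon_carrier carrier_free_alg_0_1)
  ultimately show "r \<in> carrier (pres_free n)"
    unfolding pres_rels_eq pres_free_def
    by (cases rule: prels_cases)
      (auto intro!: carrier_free_alg_intros carrier_bracket simp: mon_carrier)
qed

text \<open>Relators of the first four families become 0 if an index leaves the range; every other
  relator becomes the same expression in the \<open>uu n\<close>, including the convention on
  u_2.\<close>

lemma restrict_all_rels:
  assumes "r \<in> all_rels"
  shows "restrict_words (pgens n) r \<in> insert 0 (pres_rels n)"
proof (cases "r = ug 0")
  case True
  then show ?thesis unfolding True restrict_gens by (simp add: uu_def)
next
  case False
  then have "r \<in> prels {1..} ug" using assms by (simp add: all_rels_def)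
  note rs = restrict_bracket restrict_gens restrict_words_simps restrict_words_mult
  have z: "uu n i = 0" if "i \<notin> {1..n - 1}" for i
    using that unfolding uu_def by (rule if_not_P)
  from \<open>r \<in> prels {1..} ug\<close> show ?thesis
  proof (cases rule: prels_cases)
    case (1 i j)
    have r: "restrict_words (pgens n) r = bracket pp (uu n i) (bracket qq (uu n i) (uu n j))"
      unfolding 1(1) rs ..
    show ?thesis unfolding r pres_rels_eq using 1 prelsI(1)[of i "{1..n - 1}" j "uu n"] z[of i] z[of j]
      by (cases "i \<in> {1..n - 1} \<and> j \<in> {1..n - 1}") (auto simp: bracket_0)
  next
    case (2 i j)
    have r: "restrict_words (pgens n) r = uu n i * uu n j - uu n j * uu n i"
      unfolding 2(1) rs ..
    show ?thesis unfolding r pres_rels_eq using 2 prelsI(2)[of i "{1..n - 1}" j "uu n"] z[of i] z[of j]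
      by (cases "i \<in> {1..n - 1} \<and> j \<in> {1..n - 1}") (auto simp: bracket_0)
  next
    case (3 i)
    have r: "restrict_words (pgens n) r = uu n i * ww - ww * uu n i"
      unfolding 3(1) rs ..
    show ?thesis unfolding r pres_rels_eq using 3 prelsI(3)[of i "{1..n - 1}" "uu n"] z[of i]
      by (cases "i \<in> {1..n - 1}") auto
  next
    case (4 i)
    have r: "restrict_words (pgens n) r = uu n i * zz - zz * uu n i"
      unfolding 4(1) rs ..
    show ?thesis unfolding r pres_rels_eq using 4 prelsI(4)[of i "{1..n - 1}" "uu n"] z[of i]
      by (cases "i \<in> {1..n - 1}") auto
  qed (simp_all only: rs pres_rels_eq, simp_all only: prels_def, blast+)
qed

text \<open>Injectivity of \<open>pres_alg n\<close> in \<open>palg\<close>: the retraction fixes p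
  and maps the relators of the large algebra into the ideal of the small one.\<close>

lemma cls_eq_0_imp_pres_ideal:
  assumes "p \<in> carrier (pres_free n)" "cls p = 0"
  shows "p \<in> pres_ideal n"
proof -
  note c = pres_rels_carrier[unfolded pres_free_def]
  have "restrict_words (pgens n) p \<in> genideal (free_alg (pgens n)) (pres_rels n)"
  proof (rule rideal_imp_genideal)
    fix r assume "r \<in> all_rels"
    then show "restrict_words (pgens n) r \<in> genideal (free_alg (pgens n)) (pres_rels n)"
      using restrict_all_rels[of r n] ring.genideal_self[OF ring_free_alg c, of n]
        additive_subgroup.zero_closed[OF ideal.axioms(1)[OF ring.genideal_ideal[OF ring_free_alg c, of n]]]
      by auto
  qed (use c assms(2) in \<open>auto simp: cls_eq_0_iff\<close>)
  then show ?thesis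
    using assms(1) by (simp add: restrict_words_id pres_free_def pres_ideal_def)
qed

lemma Phi_pres_ideal:
  assumes "n \<ge> 2" "p \<in> pres_ideal n"
  shows "p \<in> carrier (pres_free n) \<and> Phi n p \<in> NN n"
  using ring_free_alg pres_rels_carrier[unfolded pres_free_def] assms(2)[unfolded pres_ideal_def pres_free_def]
proof (rule genideal_induct)
  fix r assume "r \<in> pres_rels n"
  then show "r \<in> carrier (pres_free n) \<and> Phi n r \<in> NN n"
    using pres_rels_carrier Phi_pres_rels[OF assms(1)] by auto
next
  fix a x assume "a \<in> carrier (free_alg (pgens n))" "x \<in> carrier (pres_free n) \<and> Phi n x \<in> NN n"
  then show "a \<otimes>\<^bsub>free_alg (pgens n)\<^esub> x \<in> carrier (pres_free n) \<and> Phi n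
      (a \<otimes>\<^bsub>free_alg (pgens n)\<^esub> x) \<in> NN n"
      "x \<otimes>\<^bsub>free_alg (pgens n)\<^esub> a \<in> carrier (pres_free n) \<and> Phi n
          (x \<otimes>\<^bsub>free_alg (pgens n)\<^esub> a) \<in> NN n"
    using Phi_CC[OF assms(1), of a]
    by (auto simp: pres_free_def Phi_mult intro: carrier_free_alg_mult NN_cross_mult_left NN_cross_mult_right)
qed (auto simp: pres_free_def Phi_simps intro: carrier_free_alg_intros NN_intros)

section \<open>The homomorphism to the quotient and its kernel\<close>

definition PhiQ :: "nat \<Rightarrow> pgen free \<Rightarrow> cross set" where
  "PhiQ n p = NN n +>\<^bsub>free_cross n\<^esub> Phi n p"

lemma Phi_ring_hom: "n \<ge> 2 \<Longrightarrow> Phi n \<in> ring_hom (pres_free n) (free_cross n)"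
  by (rule ring_hom_memI) (auto simp: Phi_CC Phi_mult Phi_simps pres_free_def)

lemma PhiQ_ring_hom_ring: "n \<ge> 2 \<Longrightarrow> ring_hom_ring (pres_free n) (cross_product n) (PhiQ n)"
proof -
  assume n: "n \<ge> 2"
  have "(+>\<^bsub>free_cross n\<^esub>) (NN n) \<circ> Phi n \<in> ring_hom (pres_free n) (free_cross n Quot NN n)"
    by (rule ring_hom_trans[OF Phi_ring_hom[OF n] ideal.rcos_ring_hom[OF ideal_NN]])
  moreover have "(+>\<^bsub>free_cross n\<^esub>) (NN n) \<circ> Phi n = PhiQ n"
    by (simp add: PhiQ_def fun_eq_iff)
  ultimately show ?thesis
    unfolding cross_product_def
    by (intro ring_hom_ringI2 ideal.quotient_is_ring[OF ideal_NN]) (auto simp: pres_free_def ring_free_alg)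
qed

lemma PhiQ_eq_iff:
  assumes "x \<in> CC n" "y \<in> CC n"
  shows "NN n +>\<^bsub>free_cross n\<^esub> x = NN n +>\<^bsub>free_cross n\<^esub> y \<longleftrightarrow> x
      - y \<in> NN n"
proof -
  interpret ideal "NN n" "free_cross n" by (rule ideal_NN)
  have "x \<ominus>\<^bsub>free_cross n\<^esub> y = x - y"
  proof -
    have "- y \<in> CC n" using CC_diff[OF CC_zero assms(2)] by simp
    then have "\<ominus>\<^bsub>free_cross n\<^esub> y = - y"
      using minus_equality[of "- y" y] assms(2) by simp
    then show ?thesis by (simp add: a_minus_def)
  qed
  then show ?thesis using quotient_eq_iff_same_a_r_cos[OF ideal_NN assms] by simp
qed

lemma zero_cross_product: "\<zero>\<^bsub>cross_product n\<^esub> = NN n"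
  by (simp add: cross_product_def FactRing_def)

text \<open>If \<open>Phi n p\<close> lies in the ideal of the cross product, the class of p is
  \<open>Theta\<close> of it and hence 0.\<close>

lemma kernel_PhiQ:
  assumes "n \<ge> 2"
  shows "a_kernel (pres_free n) (cross_product n) (PhiQ n) = pres_ideal n"
proof -
  have "NN n +>\<^bsub>free_cross n\<^esub> 0 = NN n"
    using ring.a_rcos_zero[OF ring_free_cross ideal_NN NN_intros(1)] .
  then have "PhiQ n p = \<zero>\<^bsub>cross_product n\<^esub> \<longleftrightarrow> Phi n p \<in> NN n" if "p
      \<in> carrier (pres_free n)" for p
    using PhiQ_eq_iff[OF Phi_CC[OF assms that] CC_zero] by (simp add: PhiQ_def zero_cross_product)
  moreover have "p \<in> pres_ideal n" if "p \<in> carrier (pres_free n)" "Phi n p \<in> NN n" for p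
    using Theta_NN[OF assms that(2)] Theta_Phi[OF assms that(1)] that(1)
    by (intro cls_eq_0_imp_pres_ideal) auto
  ultimately show ?thesis
    using Phi_pres_ideal[OF assms] unfolding a_kernel_def' by blast
qed

section \<open>Surjectivity\<close>

definition Phi_range :: "nat \<Rightarrow> cross set" where
  "Phi_range n = {y \<in> CC n. \<exists>p\<in>carrier (pres_free n). Phi n p - y \<in> NN n}"

lemma Phi_rangeI: "y \<in> CC n \<Longrightarrow> p \<in> carrier (pres_free n) \<Longrightarrow>
    Phi n p - y \<in> NN n \<Longrightarrow> y \<in> Phi_range n"
  unfolding Phi_range_def by blast

lemma Phi_range_add: "x \<in> Phi_range n \<Longrightarrow> y \<in> Phi_range n \<Longrightarrow>
    x + y \<in> Phi_range n"
proof -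
  assume "x \<in> Phi_range n" "y \<in> Phi_range n"
  then obtain p r where *: "x \<in> CC n" "y \<in> CC n" "p \<in> carrier (pres_free n)" "r \<in> carrier
      (pres_free n)"
      "Phi n p - x \<in> NN n" "Phi n r - y \<in> NN n"
    unfolding Phi_range_def by blast
  have "Phi n (p + r) - (x + y) = (Phi n p - x) + (Phi n r - y)"
    by (simp add: Phi_simps)
  then have "Phi n (p + r) - (x + y) \<in> NN n" by (simp only: NN_intros(2)[OF *(5,6)])
  then show ?thesis using *
    by (intro Phi_rangeI[of _ n "p + r"] CC_add) (auto simp: pres_free_def intro: carrier_free_alg_add)
qed

lemma Phi_range_scale: "x \<in> Phi_range n \<Longrightarrow> scale c x \<in> Phi_range n"
proof -
  assume "x \<in> Phi_range n"
  then obtain p where *: "x \<in> CC n" "p \<in> carrier (pres_free n)" "Phi n p - x \<in> NN n"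
    unfolding Phi_range_def by blast
  have "Phi n (scale c p) - scale c x = scale c (Phi n p - x)"
    by (simp add: Phi_simps scale.scale_right_diff_distrib)
  then have "Phi n (scale c p) - scale c x \<in> NN n" by (simp only: NN_intros(3)[OF *(3)])
  then show ?thesis using *
    by (intro Phi_rangeI[of _ n "scale c p"] CC_scale) (auto simp: pres_free_def intro: carrier_free_alg_scale)
qed

lemma Phi_range_diff: "x \<in> Phi_range n \<Longrightarrow> y \<in> Phi_range n \<Longrightarrow>
    x - y \<in> Phi_range n"
  using Phi_range_add[of x n "scale (- 1) y"] Phi_range_scale[of y n "- 1"] by simp

lemma Phi_range_mult:
  assumes "n \<ge> 2" "x \<in> Phi_range n" "y \<in> Phi_range n"
  shows "cross_mult x y \<in> Phi_range n"
proof -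
  obtain p r where *: "x \<in> CC n" "y \<in> CC n" "p \<in> carrier (pres_free n)" "r \<in> carrier (pres_free n)"
      "Phi n p - x \<in> NN n" "Phi n r - y \<in> NN n"
    using assms(2,3) unfolding Phi_range_def by blast
  have "Phi n (p * r) - cross_mult x y = cross_mult (Phi n p) (Phi n r - y) + cross_mult (Phi n p - x) y"
    by (simp add: Phi_mult cross_mult_simps)
  moreover have "\<dots> \<in> NN n"
    using * assms(1) by (intro NN_intros(2) NN_cross_mult_left NN_cross_mult_right Phi_CC)
  ultimately have "Phi n (p * r) - cross_mult x y \<in> NN n" by (simp only:)
  then show ?thesis using *
    by (intro Phi_rangeI[of _ n "p * r"] cross_mult_CC) (auto simp: pres_free_def intro: carrier_free_alg_mult)
qed

lemma Phi_range_Phi: "n \<ge> 2 \<Longrightarrow> p \<in> carrier (pres_free n) \<Longrightarrow>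
    Phi n p \<in> Phi_range n"
  by (rule Phi_rangeI[of _ n p]) (simp_all add: Phi_CC NN_intros(1))

lemma Phi_gens:
  "i \<in> {1..n - 1} \<Longrightarrow> Phi n (ug i) = tensor 1 (mon [n - i])"
  "Phi n ww = tensor (mon [n, n]) 1" "Phi n zz = tensor (z_vec n) 1"
  by (simp_all add: Phi_def PL_mon1 E_lmult_one SL_tensor)

lemma Phi_range_all:
  assumes "n \<ge> 2"
  shows "Phi_range n = CC n"
proof
  let ?R = "Phi_range n"
  have gU: "tensor 1 (mon [i]) \<in> ?R" if "i \<in> {1..n - 1}" for i
  proof -
    have "n - i \<in> {1..n - 1}" "n - (n - i) = i" using that by auto
    then show ?thesis
      using Phi_range_Phi[OF assms, of "ug (n - i)"] Phi_gens(1)[of "n - i" n]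
      by (auto simp: pres_free_def mon_carrier)
  qed
  have gW: "tensor (mon [n, n]) 1 \<in> ?R" and gZ: "tensor (z_vec n) 1 \<in> ?R"
    using Phi_range_Phi[OF assms, of ww] Phi_range_Phi[OF assms, of zz]
    by (simp_all add: Phi_gens pres_free_def mon_carrier)
  have E: "tensor (E_word k w) 1 \<in> ?R" if "k \<in> {1..n - 1}" "tensor (mon w) 1 \<in> ?R" for k w
  proof -
    \<comment> \<open>The cross relation solved for E_k(a), so the image is stable under the action
      of the E_k.\<close>
    have "tensor (E_word k w) 1 = cross_mult (tensor 1 (mon [k])) (tensor (mon w) 1)
        - scale (qq powi wt k w) (cross_mult (tensor (mon w) 1) (tensor 1 (mon [k])))"
      by (simp add: cross_mult_tensor UL_mon1 UL.act_one E_lmult_tensor Eop_mon Kop_mon SL_tensor SL_simps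
          tensor_simps)
    then show ?thesis using that gU by (auto intro!: Phi_range_diff Phi_range_scale Phi_range_mult assms)
  qed
  have pair: "tensor (mon w) 1 \<in> ?R" if "set w \<subseteq> {1..n}" "length w = 2" for w
  proof (rule word_generation[where P = "\<lambda>x. tensor x 1 \<in> ?R", OF _ _ _ that])
    fix c x assume "tensor x 1 \<in> ?R"
    then show "tensor (scale c x) 1 \<in> ?R" by (simp add: tensor_simps Phi_range_scale)
  next
    fix k w assume "k \<in> {1..n - 1}" "tensor (mon w) 1 \<in> ?R"
    then show "tensor (E_word k w) 1 \<in> ?R" by (rule E)
  next
    fix w assume w: "set w \<subseteq> {1..n}" "length w = 2" "\<forall>k\<in>set w. k < n \<longrightarrow> k
        + 1 \<in> set w"
    obtain x y where xy: "w = [x, y]" using w(2) by (auto simp: length_Suc_conv eval_nat_numeral)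
    obtain b where b: "n = Suc b" "b \<ge> 1" using assms by (cases n) auto
    have "E_word b [n, n] = mon [b, n] + scale pp (mon [n, b])"
      unfolding b(1) by (simp add: E_word_eval)
    then have s: "tensor (mon [b, n]) 1 + scale pp (tensor (mon [n, b]) 1) \<in> ?R" (is "?s \<in> _")
      using E[OF _ gW, of b] b by (simp add: tensor_simps)
    have z: "tensor (mon [b, n]) 1 - scale qq (tensor (mon [n, b]) 1) \<in> ?R" (is "?z \<in> _")
      using Phi_range_scale[OF gZ, of pp] b by (simp add: z_vec_def tensor_simps)
    \<comment> \<open>E_(n-1) w and q^-1 z span the symmetric and exterior vectors on v_(n-1), v_n;
      as q + q^-1 is invertible, both tensors are recovered.\<close>
    have "scale (qq + pp) (tensor (mon [n, b]) 1) = ?s - ?z"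
      by (simp add: scale.scale_left_distrib)
    then have "scale (inverse (qq + pp)) (scale (qq + pp) (tensor (mon [n, b]) 1)) \<in> ?R"
      using Phi_range_scale[OF Phi_range_diff[OF s z]] by simp
    then have nb: "tensor (mon [n, b]) 1 \<in> ?R" by simp
    have bn: "tensor (mon [b, n]) 1 \<in> ?R"
      using Phi_range_diff[OF s Phi_range_scale[OF nb, of pp]] by simp
    have "(x = n \<and> y = n) \<or> (x = b \<and> y = n) \<or> (x = n \<and> y = b)"
      using w(1,3) unfolding xy b by auto
    then show "tensor (mon w) 1 \<in> ?R" using gW nb bn by (auto simp: xy)
  qed
  have one: "tensor 1 1 \<in> ?R"
    using Phi_range_Phi[OF assms carrier_free_alg_0_1(2)[of "pgens n", folded pres_free_def]] by (simp add: Phi_simps)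
  have V: "tensor (mon v) 1 \<in> ?R" if "v \<in> even_words n" for v
    using that
  proof (induction v rule: even_words_induct)
    case (Cons a b v)
    have "tensor (mon (a # b # v)) 1 = cross_mult (tensor (mon [a, b]) 1) (tensor (mon v) 1)"
      by (simp add: cross_mult_tensor UL.act_one SL_tensor mon_mult)
    then show ?case using Cons pair[of "[a, b]"] by (auto intro!: Phi_range_mult assms)
  qed (use one in \<open>simp flip: one_eq_mon\<close>)
  have U: "tensor 1 (mon e) \<in> ?R" if "set e \<subseteq> {1..n - 1}" for e
    using that
  proof (induction e)
    case (Cons i e)
    have "tensor 1 (mon (i # e)) = cross_mult (tensor 1 (mon [i])) (tensor 1 (mon e))"
      by (simp add: cross_mult_tensor UL_mon1 E_lmult_one SL_tensor mon_mult)
    then show ?case using Cons gU by (auto intro!: Phi_range_mult assms)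
  qed (use one in \<open>simp flip: one_eq_mon\<close>)
  show "CC n \<subseteq> ?R"
  proof
    fix x assume "x \<in> CC n"
    then show "x \<in> ?R"
    proof (induction x rule: CC_induct)
      case zero
      show ?case using Phi_range_scale[OF one, of 0] by simp
    next
      case (tensor v e)
      have "tensor (mon v) (mon e) = cross_mult (tensor (mon v) 1) (tensor 1 (mon e))"
        by (simp add: cross_mult_tensor UL.act_one SL_tensor)
      then show ?case using V U tensor by (auto intro!: Phi_range_mult assms)
    qed (auto intro: Phi_range_add Phi_range_scale)
  qed
qed (auto simp: Phi_range_def)

lemma PhiQ_surj:
  assumes "n \<ge> 2"
  shows "PhiQ n ` carrier (pres_free n) = carrier (cross_product n)"
proof
  show "PhiQ n ` carrier (pres_free n) \<subseteq> carrier (cross_product n)"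
    using ring_hom_ring.axioms(3)[OF PhiQ_ring_hom_ring[OF assms]] ring_hom_ring.homh[OF PhiQ_ring_hom_ring[OF assms]]
    by (auto simp: ring_hom_def)
  show "carrier (cross_product n) \<subseteq> PhiQ n ` carrier (pres_free n)"
  proof
    fix X assume "X \<in> carrier (cross_product n)"
    then obtain y where y: "y \<in> CC n" "X = NN n +>\<^bsub>free_cross n\<^esub> y"
      by (auto simp: cross_product_def FactRing_def A_RCOSETS_def')
    then obtain p where p: "p \<in> carrier (pres_free n)" "Phi n p - y \<in> NN n"
      using Phi_range_all[OF assms] unfolding Phi_range_def by blast
    then have "PhiQ n p = X"
      using PhiQ_eq_iff[OF Phi_CC[OF assms p(1)] y(1)] y(2) by (simp add: PhiQ_def)
    then show "X \<in> PhiQ n ` carrier (pres_free n)" using p(1) by blast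
  qed
qed

text \<open>The clause on \<open>scale c 1\<close> makes the ring isomorphism linear over C(q);
  existence is the first isomorphism theorem for \<open>PhiQ\<close>.\<close>

theorem theorem1p12:
  fixes n :: nat
  assumes "n \<ge> 2"
  shows "\<exists>\<phi> \<in> ring_iso (pres_alg n) (cross_product n).
     (\<forall>c. \<phi> (pres_elem n (scale c 1)) = cross_elem n (scale c 1) 1) \<and>
     (\<forall>i\<in>{1..n - 1}. \<phi> (pres_elem n (uu n i)) = cross_elem n 1 (mon [n - i])) \<and>
     \<phi> (pres_elem n ww) = cross_elem n (mon [n, n]) 1 \<and>
     \<phi> (pres_elem n zz) =
       cross_elem n (scale qq (mon [n - 1, n] - scale qq (mon [n, n - 1]))) 1"
proof -
  interpret ring_hom_ring "pres_free n" "cross_product n" "PhiQ n"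
    by (rule PhiQ_ring_hom_ring[OF assms])
  define \<phi> where "\<phi> = (\<lambda>X. the_elem (PhiQ n ` X))"
  have iso: "\<phi> \<in> ring_iso (pres_alg n) (cross_product n)"
    using FactRing_iso_set[OF PhiQ_surj[OF assms]]
    unfolding \<phi>_def pres_alg_def kernel_PhiQ[OF assms] .
  have val: "\<phi> (pres_elem n p) = NN n +>\<^bsub>free_cross n\<^esub> Phi n p" if "p \<in> carrier
      (pres_free n)" for p
    using the_elem_simp[OF that] unfolding \<phi>_def pres_elem_def kernel_PhiQ[OF assms] PhiQ_def .
  have "scale c 1 \<in> carrier (pres_free n)" for c
    unfolding pres_free_def by (intro carrier_free_alg_intros)
  then have "\<phi> (pres_elem n (scale c 1)) = cross_elem n (scale c 1) 1" for c
    by (simp add: val cross_elem_def Phi_simps tensor_simps)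
  moreover have "\<phi> (pres_elem n (uu n i)) = cross_elem n 1 (mon [n - i])" if "i \<in> {1..n - 1}" for i
    using val[of "uu n i"] Phi_gens(1)[OF that] that
    by (simp add: uu_def cross_elem_def pres_free_def mon_carrier)
  moreover have "\<phi> (pres_elem n ww) = cross_elem n (mon [n, n]) 1"
    using val[of ww] by (simp add: cross_elem_def pres_free_def mon_carrier Phi_gens)
  moreover have "\<phi> (pres_elem n zz) = cross_elem n (scale qq (mon [n - 1, n] - scale qq (mon [n, n - 1]))) 1"
    using val[of zz] by (simp add: cross_elem_def pres_free_def mon_carrier Phi_gens z_vec_def)
  ultimately show ?thesis using iso by blast
qed

end
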